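(* Let $d\ge 1$ and $r\ge 0$ be integers and let $\sigma_1,\sigma_2>0$. There exist constants $C>0$ and $h_0>0$ depending only on $\sigma_1,\sigma_2,d,r$ (in particular independent of the mesh) such that the following holds for every triangulation $\mathcal{T}_h=\mathcal{T}_h(B_1^d\setminus\{\mathbf 0\})$ with maximum mesh size $h<h_0$ that is shape-regular with constant $\sigma_1$ and satisfies the inverse assumption with constant $\sigma_2$. For every $f\in L^d(B_1^d)$ with $f|_K\in\mathbb{P}_r(K)$ for all $K\in\mathcal{T}_h$ and $f(\mathbf 0)=0$, $$\Big\|\frac{f}{\rho}\Big\|_{L^d(B_1^d)}\le C\log(1/h)\left(\|\nabla_h f\|_{L^d(B_1^d)}+\Big(\sum_{F\in\mathcal{F}_h^i}\|[\![f]\!]\|_{L^\infty(F)}^d\Big)^{1/d}\right),$$ where $\rho(\boldsymbol x)=|\boldsymbol x|$.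
   Context: $B_1^d$ is the unit ball in $\mathbb{R}^d$ centred at the origin. $\mathcal{T}_h(B_1^d\setminus\{\mathbf 0\})$ is a triangulation of $B_1^d\setminus\{\mathbf 0\}$ by simplices (so that the origin is a vertex of the mesh), with maximum mesh size $h$. Shape-regularity with constant $\sigma_1$: $h_K\le\sigma_1\rho_K$ for all $K\in\mathcal{T}_h$, where $h_K=\operatorname{diam}K$ and $\rho_K$ is the diameter of the largest ball inscribed in $K$. Inverse assumption with constant $\sigma_2$: $h\le\sigma_2h_K$ for all $K\in\mathcal{T}_h$. $\mathbb{P}_r(K)$ is the space of polynomials of degree at most $r$ on $K$. The function $f$ may be discontinuous across element interfaces; $f(\mathbf 0)=0$ means that $f|_K(\mathbf 0)=0$ for every element $K$ having $\mathbf 0$ as a vertex. $\nabla_h$ is the elementwise gradient: $\|\nabla_hf\|_{L^d(B_1^d)}^d=\sum_{K\in\mathcal{T}_h}\|\nabla f\|_{L^d(K)}^d$. $\mathcal{F}_h^i$ is the set of interior faces (edges if $d=2$). For $F\in\mathcal{F}_h^i$ shared by $K^+$ and $K^-$, with outward unit normals $\boldsymbol n_1,\boldsymbol n_2$ of $K^+,K^-$ on $F$ and $f^\pm=f|_{K^\pm}$, the jump is $[\![f]\!]|_F=f^+\boldsymbol n_1+f^-\boldsymbol n_2$.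
   Formalization: For d ≥ 2 no finite mesh of simplices fills the ball exactly; here the mesh fills a polyhedral region inside the closed unit ball, with all its boundary vertices on the unit sphere, and the norms over the ball are taken over that region (for d = 1 it is the whole interval [-1,1]). *)

theory Defs
  imports "HOL-Analysis.Analysis"
begin

section \<open>Meshes of the unit ball\<close>

text \<open>
  The ball is not a finite union of simplices unless the dimension is 1, so, as usual for finite
  elements on a curved domain, the meshed region \<open>\<Union>T\<close> is a polyhedral
  approximation of the ball: it lies in the closed ball and its boundary vertices lie on the unit
  sphere. In dimension 1 this forces \<open>\<Union>T = cball 0 1\<close>. A mesh with
  \<open>\<Union>T = cball 0 1\<close> is always allowed, so an estimate over \<open>\<Union>T\<close>
  contains the estimate over the ball for meshes that fill it.
  Conformity (two elements meet in a common face) is part of \<^const>\<open>triangulation\<close>.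
\<close>

definition ball_triangulation :: "(real^'n) set set \<Rightarrow> bool" where
  "ball_triangulation T \<longleftrightarrow>
     triangulation T \<and>
     (\<forall>K\<in>T. int CARD('n) simplex K) \<and>
     (\<exists>K\<in>T. 0 extreme_point_of K) \<and>
     \<Union>T \<subseteq> cball 0 1 \<and>
     (\<forall>K\<in>T. \<forall>v. v extreme_point_of K \<and> v \<in> frontier (\<Union>T) \<longrightarrow> v \<in> sphere 0 1)"

definition mesh_size :: "(real^'n) set set \<Rightarrow> real" where
  "mesh_size T = Max (diameter ` T)"

definition inball_diameter :: "(real^'n) set \<Rightarrow> real" where
  "inball_diameter K = Sup {diameter (cball x s) | x s. cball x s \<subseteq> K}"

definition shape_regular :: "real \<Rightarrow> (real^'n) set set \<Rightarrow> bool" where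
  "shape_regular \<sigma> T \<longleftrightarrow> (\<forall>K\<in>T. diameter K \<le> \<sigma> * inball_diameter K)"

definition inverse_assumption :: "real \<Rightarrow> (real^'n) set set \<Rightarrow> bool" where
  "inverse_assumption \<sigma> T \<longleftrightarrow> (\<forall>K\<in>T. mesh_size T \<le> \<sigma> * diameter K)"

definition interior_faces :: "(real^'n) set set \<Rightarrow> (real^'n) set set" where
  "interior_faces T =
     {F. \<exists>K\<^sub>1\<in>T. \<exists>K\<^sub>2\<in>T. K\<^sub>1 \<noteq> K\<^sub>2 \<and> F facet_of K\<^sub>1 \<and> F facet_of K\<^sub>2}"

definition outward_normal :: "(real^'n) set \<Rightarrow> (real^'n) set \<Rightarrow> real^'n" where
  "outward_normal K F =
     (THE n. norm n = 1 \<and> (\<exists>b. K \<subseteq> {x. n \<bullet> x \<le> b} \<and> F = K \<inter> {x. n \<bullet> x = b}))"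

section \<open>Lebesgue spaces\<close>

definition in_Lp :: "real \<Rightarrow> (real^'n) set \<Rightarrow> (real^'n \<Rightarrow> real) \<Rightarrow> bool" where
  "in_Lp p S f \<longleftrightarrow>
     f \<in> borel_measurable (lebesgue_on S) \<and>
     integrable (lebesgue_on S) (\<lambda>x. \<bar>f x\<bar> powr p)"

text \<open>
  The Bochner integral of a non-integrable function is 0, so this is the norm only of functions
  in the Lebesgue space.
\<close>

definition Lp_norm :: "real \<Rightarrow> (real^'n) set \<Rightarrow> (real^'n \<Rightarrow> 'b::real_normed_vector) \<Rightarrow> real" where
  "Lp_norm p S f = (\<integral>x. norm (f x) powr p \<partial>lebesgue_on S) powr (1 / p)"

section \<open>Broken polynomials\<close>

definition poly_space :: "nat \<Rightarrow> (real^'n \<Rightarrow> real) set" where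
  "poly_space r =
     {p. \<exists>c. \<forall>x. p x = (\<Sum>\<alpha> | (\<Sum>i\<in>UNIV. \<alpha> i) \<le> r. c \<alpha> * (\<Prod>i\<in>UNIV. (x $ i) ^ \<alpha> i))}"

text \<open>
  The function \<open>f\<close> is given up to null sets. Its restriction to \<open>K\<close> agrees
  almost everywhere with the polynomial \<open>g K\<close>, which \<open>f\<close> determines
  uniquely because \<open>K\<close> has nonempty interior. Values and traces of \<open>f\<close> from
  within \<open>K\<close> are values of \<open>g K\<close>.
\<close>

definition piecewise_poly ::
    "nat \<Rightarrow> (real^'n) set set \<Rightarrow> (real^'n \<Rightarrow> real) \<Rightarrow> ((real^'n) set \<Rightarrow> real^'n \<Rightarrow> real) \<Rightarrow> bool" where
  "piecewise_poly r T f g \<longleftrightarrow>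
     (\<forall>K\<in>T. g K \<in> poly_space r \<and> (AE x in lebesgue_on K. f x = g K x))"

definition zero_at_origin ::
    "(real^'n) set set \<Rightarrow> ((real^'n) set \<Rightarrow> real^'n \<Rightarrow> real) \<Rightarrow> bool" where
  "zero_at_origin T g \<longleftrightarrow> (\<forall>K\<in>T. 0 extreme_point_of K \<longrightarrow> g K 0 = 0)"

definition grad :: "(real^'n \<Rightarrow> real) \<Rightarrow> real^'n \<Rightarrow> real^'n" where
  "grad p x = (\<chi> i. frechet_derivative p (at x) (axis i 1))"

definition broken_grad_norm ::
    "(real^'n) set set \<Rightarrow> ((real^'n) set \<Rightarrow> real^'n \<Rightarrow> real) \<Rightarrow> real" where
  "broken_grad_norm T g =
     (\<Sum>K\<in>T. Lp_norm (real CARD('n)) K (grad (g K)) powr real CARD('n)) powr (1 / real CARD('n))"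

text \<open>
  An interior face is a facet of exactly two elements, so the sum below has the two terms
  \<open>f\<^sup>+ n\<^sub>1 + f\<^sup>- n\<^sub>2\<close>.
\<close>

definition jump ::
    "(real^'n) set set \<Rightarrow> ((real^'n) set \<Rightarrow> real^'n \<Rightarrow> real) \<Rightarrow> (real^'n) set \<Rightarrow> real^'n \<Rightarrow> real^'n" where
  "jump T g F x = (\<Sum>K | K \<in> T \<and> F facet_of K. g K x *\<^sub>R outward_normal K F)"

text \<open>
  The jump is polynomial on the compact face \<open>F\<close>, so its essential supremum with
  respect to the surface measure of \<open>F\<close> is its supremum.
\<close>

definition jump_norm ::
    "(real^'n) set set \<Rightarrow> ((real^'n) set \<Rightarrow> real^'n \<Rightarrow> real) \<Rightarrow> real" where
  "jump_norm T g =
     (\<Sum>F\<in>interior_faces T. (SUP x\<in>F. norm (jump T g F x)) powr real CARD('n)) powr (1 / real CARD('n))"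

end

theory Submission
  imports Defs "HOL-Computational_Algebra.Polynomial"
begin

text \<open>
  The estimate is a Hardy inequality with the critical exponent \<open>p = d\<close>. For a differentiable
  \<open>u\<close> with \<open>u 0 = 0\<close> it comes from integrating along rays: \<open>u x\<close> is at most
  \<open>norm x\<close> times the integral of the gradient at \<open>t *\<^sub>R x\<close> over \<open>t\<close>. Hoelder's
  inequality with the weight \<open>1 / t\<close> and the substitution \<open>y = t *\<^sub>R x\<close> turn this into an
  estimate of the weighted norm. The weight and the substitution each produce integrals of \<open>1 / t\<close>,
  which diverge at 0. If \<open>u\<close> vanishes for \<open>norm x \<le> \<tau>\<close>, then they may be cut off at
  \<open>\<tau>\<close>, and together they contribute \<open>ln (1 / \<tau>) ^ d\<close>. On a mesh of size \<open>h\<close>, the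
  cut-off \<open>\<tau>\<close> is a multiple of \<open>h\<close>.

  Piecewise polynomials are first replaced by piecewise constants. In dimension \<open>d\<close> the
  \<open>L\<^sup>d\<close> norm of a gradient is invariant under scaling, so an inverse estimate bounds the
  oscillation of \<open>f\<close> on an element \<open>K\<close> by a mesh-independent multiple of the norm of its gradient
  on \<open>K\<close> (\<open>poly_lipschitz_bound\<close>). Let \<open>w K\<close> be the value of \<open>f\<close> at a centre
  of \<open>K\<close>, and 0 if \<open>K\<close> touches the origin. Across a face, \<open>w\<close> changes by at most
  the jump plus the two oscillations. The error of the replacement is a sum of local terms without logarithm.

  A piecewise constant function has no gradient. Its variation over distances at most \<open>h\<close> takes the
  place of \<open>h\<close> times the gradient, and this is the form in which the Hardy inequality is stated
  (\<open>critical_hardy_inequality\<close>). The variation is controlled by chains of elements in which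
  neighbours share a facet (\<open>neighbour_values\<close>): a segment in general position meets no face of
  codimension two, so it passes from element to element through facets, and only boundedly many elements lie
  within a distance of order \<open>h\<close>, since each of them contains a ball of radius of order \<open>h\<close>.

  Three facts on the mesh enter. It covers the ball of radius \<open>sqrt (1 - h\<^sup>2)\<close>, because its
  boundary faces have all their vertices on the sphere (\<open>ball_subset_Union\<close>). Elements that do not
  contain the origin have a distance of order \<open>h\<close> from it (\<open>distance_from_vertex\<close>). Each
  element contains a ball of radius \<open>\<kappa> * h\<close>, and the ball of half that radius about the
  same centre stays inside the covered ball when \<open>h\<close> is small; the integral of the weighted constant over
  an element is compared with the integral over this inner ball (\<open>element_weighted_integral\<close>), so elements
  that stick out of the covered ball need no separate treatment.
\<close>

section \<open>An inverse estimate for polynomials\<close>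

text \<open>
  Up to sign, the sum is an \<open>n\<close>-th finite difference of \<open>p\<close>, and every difference lowers the degree.
\<close>

lemma alternating_binomial_sum_poly_eq_0:
  fixes p :: "real poly"
  assumes "degree p < n"
  shows "(\<Sum>i\<le>n. (-1) ^ i * real (n choose i) * poly p (real i)) = 0"
  using assms
proof (induction n arbitrary: p)
  case 0
  then show ?case by simp
next
  case (Suc n)
  define q where "q = p - pcompose p [:1, 1:]"
  have q: "poly q (real i) = poly p (real i) - poly p (real (Suc i))" for i
    by (simp add: q_def poly_pcompose)
  have "(\<Sum>i\<le>Suc n. (-1) ^ i * real (Suc n choose i) * poly p (real i))
      = poly p 0 + (\<Sum>i\<le>n. (-1) ^ Suc i * real (Suc n choose Suc i) * poly p (real (Suc i)))"
    by (subst sum.atMost_Suc_shift) (simp del: sum.atMost_Suc)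
  also have "(\<Sum>i\<le>n. (-1) ^ Suc i * real (Suc n choose Suc i) * poly p (real (Suc i)))
      = (\<Sum>i\<le>n. (-1) ^ Suc i * real (n choose i) * poly p (real (Suc i)))
        + (\<Sum>i\<le>n. (-1) ^ Suc i * real (n choose Suc i) * poly p (real (Suc i)))"
    by (simp add: sum.distrib [symmetric] algebra_simps)
  also have "poly p 0 + (\<dots>) = (\<Sum>i\<le>n. (-1) ^ Suc i * real (n choose i) * poly p (real (Suc i)))
        + (\<Sum>i\<le>Suc n. (-1) ^ i * real (n choose i) * poly p (real i))"
    by (subst sum.atMost_Suc_shift) (simp del: sum.atMost_Suc)
  also have "\<dots> = (\<Sum>i\<le>n. (-1) ^ i * real (n choose i) * poly q (real i))"
    by (simp add: q sum.distrib [symmetric] algebra_simps)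
  also have "\<dots> = 0"
  proof (cases "q = 0")
    case True
    then show ?thesis by simp
  next
    case False
    then have "degree p \<noteq> 0" by (metis degree_eq_zeroE pcompose_const q_def right_minus_eq)
    have "degree (pcompose p [:1, 1:]) = degree p" by (simp add: degree_pcompose)
    moreover have "lead_coeff (pcompose p [:1, 1:]) = lead_coeff p" by (subst lead_coeff_comp) auto
    ultimately have "degree q < degree p"
      unfolding q_def using False \<open>degree p \<noteq> 0\<close>
      by (intro degree_less_if_less_eqI) (auto simp: q_def intro!: degree_diff_le)
    then have "degree q < n" using Suc.prems by simp
    then show ?thesis by (rule Suc.IH)
  qed
  finally show ?case .
qed

lemma poly_space_along_line:
  fixes p :: "real^'n \<Rightarrow> real"
  assumes "p \<in> poly_space r"
  obtains P :: "real poly" where "degree P \<le> r" "\<And>t. p (z + t *\<^sub>R v) = poly P t"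
proof -
  obtain c where c: "\<And>x. p x = (\<Sum>\<alpha> | (\<Sum>i\<in>UNIV. \<alpha> i) \<le> r. c \<alpha> * (\<Prod>i\<in>UNIV. (x $ i) ^ \<alpha> i))"
    using assms by (auto simp: poly_space_def)
  define P where "P = (\<Sum>\<alpha> | (\<Sum>i\<in>UNIV. \<alpha> i) \<le> r. smult (c \<alpha>) (\<Prod>i\<in>UNIV. [:z $ i, v $ i:] ^ \<alpha> i))"
  have deg: "degree (smult (c \<alpha>) (\<Prod>i\<in>UNIV. [:z $ i, v $ i:] ^ \<alpha> i)) \<le> r" if "(\<Sum>i\<in>UNIV. \<alpha> i) \<le> r" for \<alpha>
  proof -
    have "degree ([:z $ i, v $ i:] ^ \<alpha> i) \<le> \<alpha> i" for i
      by (rule order.trans [OF degree_power_le]) auto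
    then have "(\<Sum>i\<in>UNIV. degree ([:z $ i, v $ i:] ^ \<alpha> i)) \<le> (\<Sum>i\<in>UNIV. \<alpha> i)"
      by (intro sum_mono)
    moreover have "degree (\<Prod>i\<in>UNIV. [:z $ i, v $ i:] ^ \<alpha> i) \<le> (\<Sum>i\<in>UNIV. degree ([:z $ i, v $ i:] ^ \<alpha> i))"
      using degree_prod_sum_le [of UNIV "\<lambda>i. [:z $ i, v $ i:] ^ \<alpha> i"] by (simp add: o_def)
    ultimately show ?thesis using that degree_smult_le order.trans by (meson order.trans)
  qed
  have "degree P \<le> r"
    unfolding P_def
    by (cases "finite {\<alpha> :: 'n \<Rightarrow> nat. (\<Sum>i\<in>UNIV. \<alpha> i) \<le> r}") (auto intro!: degree_sum_le deg)
  moreover have "p (z + t *\<^sub>R v) = poly P t" for t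
    by (simp add: P_def c poly_sum poly_prod mult.commute)
  ultimately show thesis by (rule that)
qed

lemma poly_space_finite_difference:
  fixes p :: "real^'n \<Rightarrow> real"
  assumes "p \<in> poly_space r"
  shows "(\<Sum>i\<le>Suc r. ((-1) ^ i * real (Suc r choose i)) *\<^sub>R p (z + real i *\<^sub>R v)) = 0"
proof -
  obtain P :: "real poly" where P: "degree P \<le> r" "\<And>t. p (z + t *\<^sub>R v) = poly P t"
    using poly_space_along_line [OF assms, of z v] by metis
  show ?thesis
    using alternating_binomial_sum_poly_eq_0 [of P "Suc r"] P by simp
qed

lemma grad_eqI:
  assumes "(p has_derivative D) (at x)"
  shows "grad p x \<bullet> h = D h" "(p has_derivative (\<bullet>) (grad p x)) (at x)"
proof -
  interpret bounded_linear D using assms by (rule has_derivative_bounded_linear)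
  have fr: "frechet_derivative p (at x) = D" using assms by (metis frechet_derivative_at)
  have *: "grad p x \<bullet> h = D h" for h
  proof -
    have "D h = D (\<Sum>i\<in>UNIV. h $ i *\<^sub>R axis i 1)" by (simp add: basis_expansion flip: scalar_mult_eq_scaleR)
    also have "\<dots> = (\<Sum>i\<in>UNIV. h $ i * D (axis i 1))" by (simp add: sum scaleR)
    finally show ?thesis by (simp add: grad_def fr inner_vec_def mult.commute)
  qed
  then show "grad p x \<bullet> h = D h" .
  have "(\<bullet>) (grad p x) = D" using * by auto
  then show "(p has_derivative (\<bullet>) (grad p x)) (at x)" using assms by simp
qed

lemma poly_space_has_gradient:
  fixes p :: "real^'n \<Rightarrow> real"
  assumes "p \<in> poly_space r"
  shows "(p has_derivative (\<bullet>) (grad p x)) (at x)" and "continuous_on UNIV (grad p)"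
proof -
  obtain c where c: "\<And>x. p x = (\<Sum>\<alpha> | (\<Sum>i\<in>UNIV. \<alpha> i) \<le> r. c \<alpha> * (\<Prod>i\<in>UNIV. (x $ i) ^ \<alpha> i))"
    using assms by (auto simp: poly_space_def)
  define D where "D x h = (\<Sum>\<alpha> | (\<Sum>i\<in>UNIV. \<alpha> i) \<le> r. c \<alpha> * 
     (\<Sum>i\<in>UNIV. (of_nat (\<alpha> i) * h $ i * (x $ i) ^ (\<alpha> i - 1)) * (\<Prod>j\<in>UNIV-{i}. (x $ j) ^ \<alpha> j)))" for x h :: "real^'n"
  have D: "(p has_derivative D x) (at x)" for x
    unfolding c [abs_def] D_def
    by (intro has_derivative_sum has_derivative_mult_right has_derivative_prod has_derivative_power
        bounded_linear.has_derivative [OF bounded_linear_vec_nth] has_derivative_ident)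
  show "(p has_derivative (\<bullet>) (grad p x)) (at x)" using D by (rule grad_eqI)
  have "grad p = (\<lambda>x. \<chi> i. D x (axis i 1))"
    by (auto simp: fun_eq_iff vec_eq_iff grad_eqI(1) [OF D, symmetric] inner_axis)
  moreover have "continuous_on UNIV (\<lambda>x. \<chi> i. D x (axis i 1))"
    unfolding D_def by (intro continuous_intros)
  ultimately show "continuous_on UNIV (grad p)" by simp
qed

lemma poly_space_continuous:
  assumes "p \<in> poly_space r"
  shows "continuous_on UNIV p"
  using has_derivative_continuous [OF poly_space_has_gradient(1) [OF assms]]
  by (simp add: continuous_at_imp_continuous_on)

text \<open>
  Differentiating the identity for \<open>p\<close> in the base point \<open>z\<close> gives the same identity for its gradient.
\<close>

lemma grad_finite_difference:
  fixes p :: "real^'n \<Rightarrow> real"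
  assumes "p \<in> poly_space r"
  shows "(\<Sum>i\<le>Suc r. ((-1) ^ i * real (Suc r choose i)) *\<^sub>R grad p (z + real i *\<^sub>R v)) = 0"
proof -
  let ?c = "\<lambda>i. (-1) ^ i * real (Suc r choose i) :: real"
  have "((\<lambda>z. \<Sum>i\<le>Suc r. ?c i *\<^sub>R p (z + real i *\<^sub>R v)) has_derivative
      (\<lambda>h. \<Sum>i\<le>Suc r. ?c i *\<^sub>R (grad p (z + real i *\<^sub>R v) \<bullet> h))) (at z)"
  proof (intro has_derivative_sum has_derivative_scaleR_right)
    fix i
    have "((\<lambda>z. z + real i *\<^sub>R v) has_derivative (\<lambda>h. h)) (at z)"
      by (auto intro!: derivative_eq_intros)
    from has_derivative_compose [OF this poly_space_has_gradient(1) [OF assms]]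
    show "((\<lambda>z. p (z + real i *\<^sub>R v)) has_derivative (\<bullet>) (grad p (z + real i *\<^sub>R v))) (at z)" .
  qed
  moreover have "((\<lambda>z. \<Sum>i\<le>Suc r. ?c i *\<^sub>R p (z + real i *\<^sub>R v)) has_derivative (\<lambda>h. 0)) (at z)"
    by (subst poly_space_finite_difference [OF assms]) simp
  ultimately have eq: "(\<lambda>h. \<Sum>i\<le>Suc r. ?c i *\<^sub>R (grad p (z + real i *\<^sub>R v) \<bullet> h)) = (\<lambda>h. 0)"
    by (rule has_derivative_unique)
  have "(\<Sum>i\<le>Suc r. ?c i *\<^sub>R grad p (z + real i *\<^sub>R v)) \<bullet> h = 0" for h
    using fun_cong [OF eq, of h] by (simp add: inner_sum_left del: sum.atMost_Suc)
  then show ?thesis using inner_eq_zero_iff by blast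
qed

lemma power_sum_le:
  fixes a :: "'a \<Rightarrow> real"
  assumes "finite I" "\<And>i. i \<in> I \<Longrightarrow> 0 \<le> a i" "0 < d"
  shows "(\<Sum>i\<in>I. a i) ^ d \<le> real (card I) ^ d * (\<Sum>i\<in>I. a i ^ d)"
proof (cases "I = {}")
  case True then show ?thesis using \<open>0 < d\<close> by (simp add: zero_power)
next
  case False
  then obtain k where k: "k \<in> I" "\<And>i. i \<in> I \<Longrightarrow> a i \<le> a k"
    using finite_imageI [OF assms(1), of a] Max_in [of "a ` I"] Max_ge [of "a ` I"]
    by (metis (no_types, opaque_lifting) False imageE image_is_empty rev_image_eqI)
  have "(\<Sum>i\<in>I. a i) \<le> real (card I) * a k"
    using sum_bounded_above [of I a "a k"] k by simp
  then have "(\<Sum>i\<in>I. a i) ^ d \<le> (real (card I) * a k) ^ d"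
    by (intro power_mono sum_nonneg assms)
  also have "\<dots> = real (card I) ^ d * a k ^ d" by (simp add: power_mult_distrib)
  also have "a k ^ d \<le> (\<Sum>i\<in>I. a i ^ d)"
    by (rule member_le_sum) (use k assms in auto)
  finally show ?thesis by (simp add: mult_left_mono)
qed

text \<open>
  The finite difference identity with step \<open>(y - z) / (r + 1)\<close>, solved for the value at
  \<open>z\<close>. The remaining sample points lie on the segment from \<open>z\<close> to \<open>y\<close>, away from
  \<open>z\<close>.
\<close>

lemma norm_extrapolation:
  fixes q :: "real^'n \<Rightarrow> 'b::real_normed_vector"
  assumes fd: "\<And>z v. (\<Sum>i\<le>Suc r. ((-1) ^ i * real (Suc r choose i)) *\<^sub>R q (z + real i *\<^sub>R v)) = 0"
    and "0 < d"
  shows "norm (q z) ^ d \<le> (real (Suc r) * 2 ^ Suc r) ^ d *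
     (\<Sum>i=1..Suc r. norm (q (z + (real i / real (Suc r)) *\<^sub>R (y - z))) ^ d)"
proof -
  let ?c = "\<lambda>i. (-1) ^ i * real (Suc r choose i) :: real"
  let ?y = "\<lambda>i. z + (real i / real (Suc r)) *\<^sub>R (y - z)"
  have "0 = (\<Sum>i\<le>Suc r. ?c i *\<^sub>R q (?y i))"
    using fd [of z "(1 / real (Suc r)) *\<^sub>R (y - z)"] by (simp only: scaleR_scaleR times_divide_eq_right mult_1_right)
  also have "\<dots> = q z + (\<Sum>i\<in>{..Suc r} - {0}. ?c i *\<^sub>R q (?y i))"
    by (subst sum.remove [of _ 0]) simp_all
  also have "{..Suc r} - {0} = {1..Suc r}" by auto
  finally have q: "q z = - (\<Sum>i\<in>{1..Suc r}. ?c i *\<^sub>R q (?y i))"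
    by (simp only: eq_neg_iff_add_eq_0)
  have "norm (q z) \<le> (\<Sum>i\<in>{1..Suc r}. norm (?c i *\<^sub>R q (?y i)))"
    unfolding q norm_minus_cancel by (rule norm_sum)
  also have "\<dots> \<le> (\<Sum>i\<in>{1..Suc r}. 2 ^ Suc r * norm (q (?y i)))"
  proof (intro sum_mono)
    fix i assume "i \<in> {1..Suc r}"
    have "Suc r choose i \<le> 2 ^ Suc r" by (rule binomial_le_pow2)
    then have "real (Suc r choose i) \<le> real (2 ^ Suc r)" by (simp only: of_nat_le_iff)
    then have "\<bar>?c i\<bar> \<le> 2 ^ Suc r" by (simp add: abs_mult power_abs del: binomial_Suc_Suc)
    then show "norm (?c i *\<^sub>R q (?y i)) \<le> 2 ^ Suc r * norm (q (?y i))"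
      unfolding norm_scaleR by (rule mult_right_mono) simp
  qed
  also have "\<dots> = 2 ^ Suc r * (\<Sum>i\<in>{1..Suc r}. norm (q (?y i)))"
    by (rule sum_distrib_left [symmetric])
  finally have "norm (q z) ^ d \<le> (2 ^ Suc r * (\<Sum>i\<in>{1..Suc r}. norm (q (?y i)))) ^ d"
    by (rule power_mono) (rule norm_ge_zero)
  also have "\<dots> = (2 ^ Suc r) ^ d * (\<Sum>i\<in>{1..Suc r}. norm (q (?y i))) ^ d"
    by (rule power_mult_distrib)
  also have "\<dots> \<le> (2 ^ Suc r) ^ d * (real (card {1..Suc r}) ^ d * (\<Sum>i\<in>{1..Suc r}. norm (q (?y i)) ^ d))"
    by (intro mult_left_mono power_sum_le) (use \<open>0 < d\<close> in auto)
  also have "\<dots> = (real (Suc r) * 2 ^ Suc r) ^ d * (\<Sum>i\<in>{1..Suc r}. norm (q (?y i)) ^ d)"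
    unfolding card_atLeastAtMost power_mult_distrib by (simp only: mult_ac diff_Suc_1)
  finally show ?thesis .
qed

lemma nn_integral_lborel_affine:
  fixes f :: "'a::euclidean_space \<Rightarrow> ennreal"
  assumes [measurable]: "f \<in> borel_measurable borel" and "c \<noteq> 0"
  shows "(\<integral>\<^sup>+x. f x \<partial>lborel) = ennreal (\<bar>c\<bar> ^ DIM('a)) * (\<integral>\<^sup>+x. f (t + c *\<^sub>R x) \<partial>lborel)"
  by (subst lborel_affine [OF \<open>c \<noteq> 0\<close>, of t])
    (simp add: nn_integral_density nn_integral_distr nn_integral_cmult)

text \<open>
  A value of a polynomial on a convex set is bounded by a mean over the set: integrate the extrapolation bound
  over \<open>y \<in> K\<close>. By convexity the sample points stay in \<open>K\<close>, and each of them depends on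
  \<open>y\<close> through a homothety of ratio at least \<open>1 / (r + 1)\<close>, so the change of variables costs at
  most \<open>(r + 1) ^ d\<close>. The constant depends neither on the shape nor on the size of \<open>K\<close>.
\<close>

lemma norm_power_le_mean:
  fixes q :: "real^'n \<Rightarrow> 'b::real_normed_vector"
  assumes fd: "\<And>z v. (\<Sum>i\<le>Suc r. ((-1) ^ i * real (Suc r choose i)) *\<^sub>R q (z + real i *\<^sub>R v)) = 0"
    and cont: "continuous_on UNIV q" and K: "convex K" "K \<in> sets borel" "z \<in> K"
  shows "ennreal (norm (q z) ^ CARD('n)) * emeasure lborel K \<le>
     ennreal ((real (Suc r) * 2 ^ Suc r) ^ CARD('n) * (real (Suc r) * real (Suc r) ^ CARD('n))) *
       (\<integral>\<^sup>+x\<in>K. ennreal (norm (q x) ^ CARD('n)) \<partial>lborel)"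
proof -
  let ?d = "CARD('n)" and ?C = "(real (Suc r) * 2 ^ Suc r) ^ CARD('n)"
  let ?t = "\<lambda>i. real i / real (Suc r)"
  define I where "I = (\<integral>\<^sup>+x\<in>K. ennreal (norm (q x) ^ ?d) \<partial>lborel)"
  note [measurable] = borel_measurable_continuous_onI [OF cont] K(2)
  have le: "(\<integral>\<^sup>+y\<in>K. ennreal (norm (q (z + ?t i *\<^sub>R (y - z))) ^ ?d) \<partial>lborel) \<le> ennreal (real (Suc r) ^ ?d) * I"
    if i: "i \<in> {1..Suc r}" for i
  proof -
    have t: "0 < i" "0 < ?t i" "?t i \<le> 1" using i by auto
    let ?J = "\<integral>\<^sup>+y. ennreal (norm (q ((1 - ?t i) *\<^sub>R z + ?t i *\<^sub>R y)) ^ ?d) * indicator K ((1 - ?t i) *\<^sub>R z + ?t i *\<^sub>R y) \<partial>lborel"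
    have "(\<integral>\<^sup>+y\<in>K. ennreal (norm (q (z + ?t i *\<^sub>R (y - z))) ^ ?d) \<partial>lborel) \<le> ?J"
    proof (rule nn_integral_mono)
      fix y
      have eq: "z + ?t i *\<^sub>R (y - z) = (1 - ?t i) *\<^sub>R z + ?t i *\<^sub>R y" by (simp add: algebra_simps)
      have "y \<in> K \<Longrightarrow> (1 - ?t i) *\<^sub>R z + ?t i *\<^sub>R y \<in> K"
        using K t by (intro convexD) auto
      then show "ennreal (norm (q (z + ?t i *\<^sub>R (y - z))) ^ ?d) * indicator K y
          \<le> ennreal (norm (q ((1 - ?t i) *\<^sub>R z + ?t i *\<^sub>R y)) ^ ?d) * indicator K ((1 - ?t i) *\<^sub>R z + ?t i *\<^sub>R y)"
        unfolding eq by (auto simp: indicator_def)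
    qed
    also have "?J = ennreal (1 / ?t i ^ ?d) * (ennreal (?t i ^ ?d) * ?J)"
      using t i by (simp add: ennreal_mult' [symmetric] mult.assoc [symmetric] del: of_nat_Suc)
    also have "ennreal (?t i ^ ?d) * ?J = I"
    proof -
      have "?t i \<noteq> 0" using t by simp
      from nn_integral_lborel_affine [OF _ this, of "\<lambda>x. ennreal (norm (q x) ^ ?d) * indicator K x" "(1 - ?t i) *\<^sub>R z"] t i
      show ?thesis by (simp add: I_def)
    qed
    also have "ennreal (1 / ?t i ^ ?d) * I \<le> ennreal (real (Suc r) ^ ?d) * I"
    proof (intro mult_right_mono ennreal_leI)
      have "1 / ?t i ^ ?d = (real (Suc r) / real i) ^ ?d" by (simp add: power_divide)
      also have "\<dots> \<le> real (Suc r) ^ ?d"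
        using i by (intro power_mono) (auto simp: divide_le_eq)
      finally show "1 / ?t i ^ ?d \<le> real (Suc r) ^ ?d" .
    qed simp
    finally show ?thesis .
  qed
  have "ennreal (norm (q z) ^ ?d) * emeasure lborel K = (\<integral>\<^sup>+y\<in>K. ennreal (norm (q z) ^ ?d) \<partial>lborel)"
    by (simp add: nn_integral_cmult_indicator)
  also have "\<dots> \<le> (\<integral>\<^sup>+y. ennreal ?C * (\<Sum>i\<in>{1..Suc r}. ennreal (norm (q (z + ?t i *\<^sub>R (y - z))) ^ ?d) * indicator K y) \<partial>lborel)"
  proof (rule nn_integral_mono)
    fix y
    have "norm (q z) ^ ?d \<le> ?C * (\<Sum>i\<in>{1..Suc r}. norm (q (z + ?t i *\<^sub>R (y - z))) ^ ?d)"
      by (rule norm_extrapolation [OF fd]) simp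
    then have "ennreal (norm (q z) ^ ?d) \<le> ennreal ?C * (\<Sum>i\<in>{1..Suc r}. ennreal (norm (q (z + ?t i *\<^sub>R (y - z))) ^ ?d))"
      by (subst sum_ennreal, simp, subst ennreal_mult' [symmetric])
         (simp_all add: ennreal_leI del: sum.cl_ivl_Suc)
    then show "ennreal (norm (q z) ^ ?d) * indicator K y \<le> ennreal ?C * (\<Sum>i\<in>{1..Suc r}. ennreal (norm (q (z + ?t i *\<^sub>R (y - z))) ^ ?d) * indicator K y)"
      by (auto simp: indicator_def simp del: sum.cl_ivl_Suc)
  qed
  also have "\<dots> = ennreal ?C * (\<Sum>i\<in>{1..Suc r}. (\<integral>\<^sup>+y\<in>K. ennreal (norm (q (z + ?t i *\<^sub>R (y - z))) ^ ?d) \<partial>lborel))"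
    by (subst nn_integral_cmult, measurable) (subst nn_integral_sum, simp_all del: sum.cl_ivl_Suc)
  also have "\<dots> \<le> ennreal ?C * (\<Sum>i\<in>{1..Suc r}. ennreal (real (Suc r) ^ ?d) * I)"
    by (intro mult_left_mono sum_mono le) auto
  also have "\<dots> = ennreal (?C * (real (Suc r) * real (Suc r) ^ ?d)) * I"
    by (simp add: ennreal_mult' mult.assoc ennreal_of_nat_eq_real_of_nat del: sum.cl_ivl_Suc of_nat_Suc)
  finally show ?thesis unfolding I_def .
qed

lemma Lp_norm_nonneg: "0 \<le> Lp_norm p S f"
  by (simp add: Lp_norm_def)

lemma Lp_norm_power:
  fixes q :: "real^'n \<Rightarrow> 'b::real_normed_vector"
  assumes "0 < d" "S \<in> sets lebesgue" "(\<lambda>x. norm (q x)) \<in> borel_measurable (lebesgue_on S)"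
  shows "Lp_norm (real d) S q ^ d = enn2real (\<integral>\<^sup>+x\<in>S. ennreal (norm (q x) ^ d) \<partial>lebesgue)"
proof -
  have [measurable]: "(\<lambda>x. norm (q x)) \<in> borel_measurable (lebesgue_on S)" by fact
  have "Lp_norm (real d) S q ^ d = (\<integral>x. norm (q x) powr real d \<partial>lebesgue_on S)"
    using \<open>0 < d\<close> by (simp add: Lp_norm_def powr_realpow' powr_powr flip: powr_realpow')
  also have "\<dots> = (\<integral>x. norm (q x) ^ d \<partial>lebesgue_on S)"
    using \<open>0 < d\<close> by (simp add: powr_realpow')
  also have "\<dots> = enn2real (\<integral>\<^sup>+x. ennreal (norm (q x) ^ d) \<partial>lebesgue_on S)"
    by (rule integral_eq_nn_integral) auto
  also have "\<dots> = enn2real (\<integral>\<^sup>+x\<in>S. ennreal (norm (q x) ^ d) \<partial>lebesgue)"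
    using assms by (subst nn_integral_restrict_space) auto
  finally show ?thesis .
qed

lemma Lp_norm_continuous_power:
  fixes q :: "real^'n \<Rightarrow> 'b::real_normed_vector"
  assumes "0 < d" "compact K" "continuous_on UNIV q"
  shows "ennreal (Lp_norm (real d) K q ^ d) = (\<integral>\<^sup>+x\<in>K. ennreal (norm (q x) ^ d) \<partial>lborel)"
proof -
  have K[measurable]: "K \<in> sets borel" using \<open>compact K\<close> by (simp add: borel_compact)
  have [measurable]: "(\<lambda>x. norm (q x)) \<in> borel_measurable borel"
    by (intro borel_measurable_continuous_onI continuous_intros assms)
  obtain B where B: "\<And>x. x \<in> K \<Longrightarrow> norm (q x) \<le> B"
    using compact_imp_bounded [OF compact_continuous_image [OF continuous_on_subset [OF assms(3)] assms(2)]]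
    by (auto simp: bounded_iff)
  have "(\<integral>\<^sup>+x\<in>K. ennreal (norm (q x) ^ d) \<partial>lborel) \<le> (\<integral>\<^sup>+x\<in>K. ennreal (B ^ d) \<partial>lborel)"
    by (intro nn_integral_mono) (auto simp: indicator_def intro!: ennreal_leI power_mono B)
  also have "\<dots> < \<infinity>"
    using emeasure_compact_finite [OF assms(2)] by (simp add: nn_integral_cmult_indicator ennreal_mult_less_top)
  finally have fin: "(\<integral>\<^sup>+x\<in>K. ennreal (norm (q x) ^ d) \<partial>lborel) < \<infinity>" .
  have "Lp_norm (real d) K q ^ d = enn2real (\<integral>\<^sup>+x\<in>K. ennreal (norm (q x) ^ d) \<partial>lebesgue)"
    by (rule Lp_norm_power) (use assms in \<open>auto intro!: measurable_restrict_space1 measurable_completion\<close>)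
  also have "(\<integral>\<^sup>+x\<in>K. ennreal (norm (q x) ^ d) \<partial>lebesgue) = (\<integral>\<^sup>+x\<in>K. ennreal (norm (q x) ^ d) \<partial>lborel)"
    by (simp add: nn_integral_completion)
  finally show ?thesis using fin by simp
qed

text \<open>
  By the previous estimate the gradient on \<open>K\<close> is at most a constant times its \<open>L\<^sup>d\<close> norm
  divided by the \<open>d\<close>-th root of the volume of \<open>K\<close>. The volume is at least that of a ball of radius
  \<open>s\<close>, whose \<open>d\<close>-th root is a multiple of \<open>s\<close>. The mean value inequality turns the
  gradient bound into a Lipschitz bound.
\<close>

lemma poly_lipschitz_bound:
  fixes r :: nat
  obtains Q :: real where "1 \<le> Q"
    "\<And>(p :: real^'n \<Rightarrow> real) K c s x y.
       \<lbrakk>p \<in> poly_space r; convex K; compact K; 0 < s; cball c s \<subseteq> K; x \<in> K; y \<in> K\<rbrakk>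
       \<Longrightarrow> \<bar>p x - p y\<bar> \<le> Q / s * Lp_norm (real CARD('n)) K (grad p) * dist x y"
proof -
  let ?d = "CARD('n)"
  define C where "C = (real (Suc r) * 2 ^ Suc r) ^ CARD('n) * (real (Suc r) * real (Suc r) ^ CARD('n))"
  have "0 \<le> C" by (simp add: C_def)
  define \<omega> where "\<omega> = unit_ball_vol (real ?d)"
  have \<omega>: "0 < \<omega>" by (simp add: \<omega>_def)
  \<comment> \<open>the maximum with 1 bounds the \<open>d\<close>-th root of \<open>C / \<omega>\<close>\<close>
  define Q where "Q = max 1 (C / \<omega>)"
  have Q: "1 \<le> Q" "C / \<omega> \<le> Q ^ ?d"
    using power_increasing [of 1 ?d Q] by (auto simp: Q_def simp del: power_increasing_iff)
  show thesis
  proof (rule that [of Q])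
    show "1 \<le> Q" by fact
  next
    fix p :: "real^'n \<Rightarrow> real" and K :: "(real^'n) set" and c and s :: real and x y
    assume p: "p \<in> poly_space r" and K: "convex K" "compact K" and s: "0 < s" "cball c s \<subseteq> K"
      and xy: "x \<in> K" "y \<in> K"
    define a where "a = Lp_norm (real CARD('n)) K (grad p)"
    have a0: "0 \<le> a" by (simp add: a_def Lp_norm_nonneg)
    have bnd: "norm (grad p z) \<le> Q / s * a" if "z \<in> K" for z
    proof -
      have "ennreal (norm (grad p z) ^ ?d) * ennreal (\<omega> * s ^ ?d) = ennreal (norm (grad p z) ^ ?d) * emeasure lborel (cball c s)"
        using s by (simp add: emeasure_cball \<omega>_def)
      also have "\<dots> \<le> ennreal (norm (grad p z) ^ ?d) * emeasure lborel K"
        using s K by (intro mult_left_mono emeasure_mono) (auto simp: borel_compact)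
      also have "\<dots> \<le> ennreal C * (\<integral>\<^sup>+x\<in>K. ennreal (norm (grad p x) ^ CARD('n)) \<partial>lborel)"
        unfolding C_def using K that
        by (intro norm_power_le_mean grad_finite_difference p poly_space_has_gradient(2) [OF p]) (auto simp: borel_compact)
      also have "\<dots> = ennreal C * ennreal (a ^ ?d)"
        unfolding a_def using K poly_space_has_gradient(2) [OF p] by (subst Lp_norm_continuous_power) auto
      finally have "norm (grad p z) ^ ?d * (\<omega> * s ^ ?d) \<le> C * a ^ ?d"
        using \<omega> s \<open>0 \<le> C\<close> a0 by (simp add: ennreal_mult [symmetric])
      then have "norm (grad p z) ^ ?d \<le> C / \<omega> * (a / s) ^ ?d"
        using \<omega> s by (simp add: field_simps power_divide)
      also have "\<dots> \<le> Q ^ ?d * (a / s) ^ ?d"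
        using Q a0 s by (intro mult_right_mono) auto
      also have "\<dots> = (Q / s * a) ^ ?d"
        by (simp add: power_mult_distrib power_divide)
      finally show ?thesis
        by (rule power_mono_iff [THEN iffD1, rotated -1]) (use Q s a0 in auto)
    qed
    have "norm (p x - p y) \<le> (Q / s * a) * norm (x - y)"
    proof (rule differentiable_bound [OF K(1) _ _ xy(1,2)])
      fix z assume "z \<in> K"
      show "(p has_derivative (\<bullet>) (grad p z)) (at z within K)"
        using poly_space_has_gradient(1) [OF p] by (rule has_derivative_at_withinI)
      show "onorm ((\<bullet>) (grad p z)) \<le> Q / s * a"
      proof (rule onorm_le)
        fix h
        have "norm (grad p z \<bullet> h) \<le> norm (grad p z) * norm h" by (simp add: Cauchy_Schwarz_ineq2)
        also have "\<dots> \<le> Q / s * a * norm h" by (intro mult_right_mono bnd \<open>z \<in> K\<close>) simp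
        finally show "norm (grad p z \<bullet> h) \<le> Q / s * a * norm h" .
      qed
    qed
    then show "\<bar>p x - p y\<bar> \<le> Q / s * Lp_norm (real CARD('n)) K (grad p) * dist x y"
      by (simp add: a_def dist_norm)
  qed
qed

section \<open>The critical Hardy inequality\<close>

text \<open>
  The power function lies above its tangent at \<open>c\<close>.
\<close>

lemma power_tangent_le:
  fixes a c :: real
  assumes "0 \<le> a" "0 < c"
  shows "real d * c ^ (d - 1) * a \<le> a ^ d + (real d - 1) * c ^ d"
proof (cases d)
  case 0 then show ?thesis by simp
next
  case (Suc k)
  have "1 + real d * (a / c - 1) \<le> (1 + (a / c - 1)) ^ d"
    using assms by (intro Bernoulli_inequality) auto
  then have "c ^ d * (1 + real d * (a / c - 1)) \<le> c ^ d * (a / c) ^ d"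
    using assms by (intro mult_left_mono) auto
  moreover have "c ^ d * (1 + real d * (a / c - 1)) = real d * c ^ (d - 1) * a - (real d - 1) * c ^ d"
    using assms Suc by (simp add: field_simps)
  moreover have "c ^ d * (a / c) ^ d = a ^ d" using assms by (simp add: power_divide)
  ultimately show ?thesis by linarith
qed

text \<open>
  Jensen's inequality for powers: integrate the tangent inequality at the mean value \<open>c\<close> of
  \<open>f\<close>. Infinite integrals are included, so that it can be used before integrability is known.
\<close>

lemma nn_integral_power_mean:
  fixes f :: "'a \<Rightarrow> real"
  assumes [measurable]: "f \<in> borel_measurable M" and nn: "\<And>x. x \<in> space M \<Longrightarrow> 0 \<le> f x"
    and M: "emeasure M (space M) = ennreal L" "0 < L" and d: "0 < d"
  shows "(\<integral>\<^sup>+x. ennreal (f x) \<partial>M) ^ d \<le> ennreal (L ^ (d - 1)) * (\<integral>\<^sup>+x. ennreal (f x ^ d) \<partial>M)"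
proof (cases "(\<integral>\<^sup>+x. ennreal (f x ^ d) \<partial>M) = \<infinity>")
  case True
  then show ?thesis using \<open>0 < L\<close> by (simp add: ennreal_mult_top)
next
  case False
  define I J where "I = (\<integral>\<^sup>+x. ennreal (f x) \<partial>M)" and "J = (\<integral>\<^sup>+x. ennreal (f x ^ d) \<partial>M)"
  have le: "f x \<le> 1 + f x ^ d" if "x \<in> space M" for x
  proof (cases "f x \<le> 1")
    case True then show ?thesis using nn [OF that] by (simp add: add_increasing2)
  next
    case False
    then have "f x ^ 1 \<le> f x ^ d" using d by (intro power_increasing) auto
    then show ?thesis by simp
  qed
  have "I \<le> (\<integral>\<^sup>+x. 1 + ennreal (f x ^ d) \<partial>M)"
    unfolding I_def using le nn
    by (intro nn_integral_mono) (metis ennreal_1 ennreal_leI ennreal_plus zero_le_one zero_le_power)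
  also have "\<dots> = ennreal L + J"
    using M by (subst nn_integral_add) (auto simp: J_def)
  also have "\<dots> < \<infinity>" using False by (simp add: J_def less_top [symmetric])
  finally obtain i where i: "I = ennreal i" "0 \<le> i" by (cases I) auto
  obtain j where j: "J = ennreal j" "0 \<le> j" using False by (cases J) (auto simp: J_def)
  show ?thesis
  proof (cases "i = 0")
    case True
    then show ?thesis using i d by (simp add: I_def [symmetric] zero_power)
  next
    case False
    define c where "c = i / L"
    have c: "0 < c" using False i M by (simp add: c_def)
    have "ennreal (real d * c ^ (d - 1) * i) = (\<integral>\<^sup>+x. ennreal (real d * c ^ (d - 1)) * ennreal (f x) \<partial>M)"
      using c i by (subst nn_integral_cmult) (auto simp: I_def [symmetric] ennreal_mult)
    also have "\<dots> \<le> (\<integral>\<^sup>+x. ennreal (f x ^ d) + ennreal ((real d - 1) * c ^ d) \<partial>M)"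
      using power_tangent_le [OF nn c, of _ d] c d nn
      by (intro nn_integral_mono) (auto simp: ennreal_mult [symmetric] ennreal_plus [symmetric] simp del: ennreal_plus intro!: ennreal_leI)
    also have "\<dots> = J + ennreal ((real d - 1) * c ^ d) * ennreal L"
      using M by (subst nn_integral_add) (auto simp: J_def)
    also have "\<dots> = ennreal (j + (real d - 1) * c ^ d * L)"
      using j c d M by (simp add: ennreal_mult)
    finally have "real d * c ^ (d - 1) * i \<le> j + (real d - 1) * c ^ d * L"
      using j c d M by (subst (asm) ennreal_le_iff) auto
    moreover have "real d * c ^ (d - 1) * i = real d * (c ^ d * L)"
      using M d by (cases d) (auto simp: c_def)
    moreover have "(real d - 1) * c ^ d * L = real d * (c ^ d * L) - c ^ d * L"
      by (simp add: algebra_simps)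
    ultimately have "c ^ d * L \<le> j" by linarith
    then have "L ^ (d - 1) * (c ^ d * L) \<le> L ^ (d - 1) * j"
      using M by (intro mult_left_mono) auto
    moreover have "L ^ (d - 1) * (c ^ d * L) = i ^ d"
      using M d by (cases d) (auto simp: c_def power_divide)
    ultimately have "i ^ d \<le> L ^ (d - 1) * j" by simp
    then show ?thesis
      using i j M by (simp add: I_def [symmetric] J_def [symmetric] ennreal_power ennreal_mult [symmetric] ennreal_leI)
  qed
qed

lemma nn_integral_inverse_Icc:
  assumes "0 < \<tau>" "\<tau> \<le> 1"
  shows "(\<integral>\<^sup>+t\<in>{\<tau>..1}. ennreal (1 / t) \<partial>lborel) = ennreal (ln (1 / \<tau>))"
proof -
  have "(\<integral>\<^sup>+t\<in>{\<tau>..1}. ennreal (1 / t) \<partial>lborel) = ennreal (ln 1 - ln \<tau>)"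
    using assms by (intro nn_integral_FTC_Icc) (auto intro!: derivative_eq_intros)
  then show ?thesis using assms by (simp add: ln_div)
qed

text \<open>
  The power mean inequality for \<open>t * f t\<close> and the measure with density \<open>1 / t\<close> on the interval,
  which has mass \<open>ln (1 / \<tau>)\<close>.
\<close>

lemma nn_integral_Icc_power_le_weighted:
  fixes f :: "real \<Rightarrow> real"
  assumes [measurable]: "f \<in> borel_measurable borel" and nn: "\<And>x. 0 \<le> f x"
    and \<tau>: "0 < \<tau>" "\<tau> < 1" and d: "0 < d"
  shows "(\<integral>\<^sup>+t\<in>{\<tau>..1}. ennreal (f t) \<partial>lborel) ^ d \<le>
    ennreal (ln (1 / \<tau>) ^ (d - 1)) * (\<integral>\<^sup>+t\<in>{\<tau>..1}. ennreal (t ^ (d - 1) * f t ^ d) \<partial>lborel)"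
proof -
  define M where "M = density lborel (\<lambda>t. ennreal (1 / t) * indicator {\<tau>..1} t)"
  have [simp]: "sets M = sets borel" "space M = UNIV" by (auto simp: M_def)
  have [measurable_cong]: "sets M = sets borel" by simp
  have eq: "(\<integral>\<^sup>+t. ennreal (g t * t) \<partial>M) = (\<integral>\<^sup>+t\<in>{\<tau>..1}. ennreal (g t) \<partial>lborel)"
    if [measurable]: "g \<in> borel_measurable borel" for g
    unfolding M_def
    by (subst nn_integral_density)
       (use \<tau> in \<open>auto intro!: nn_integral_cong simp: indicator_def ennreal_mult' [symmetric]\<close>)
  have "emeasure M (space M) = (\<integral>\<^sup>+t\<in>{\<tau>..1}. ennreal (1 / t) \<partial>lborel)"
    unfolding M_def by (subst emeasure_density) auto
  then have L: "emeasure M (space M) = ennreal (ln (1 / \<tau>))"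
    using \<tau> by (simp add: nn_integral_inverse_Icc)
  have eq2: "(\<integral>\<^sup>+t. ennreal (\<bar>f t * t\<bar> ^ d) \<partial>M) = (\<integral>\<^sup>+t\<in>{\<tau>..1}. ennreal (t ^ (d - 1) * f t ^ d) \<partial>lborel)"
  proof -
    have "1 / t * \<bar>f t * t\<bar> ^ d = t ^ (d - 1) * f t ^ d" if "0 < t" for t
      using that nn [of t] d by (cases d) (simp_all add: power_mult_distrib abs_mult)
    then show ?thesis
      unfolding M_def using \<tau>
      by (subst nn_integral_density)
         (auto intro!: nn_integral_cong simp: indicator_def ennreal_mult' [symmetric])
  qed
  have "(\<integral>\<^sup>+t\<in>{\<tau>..1}. ennreal (f t) \<partial>lborel) = (\<integral>\<^sup>+t. ennreal (f t * t) \<partial>M)"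
    by (simp add: eq)
  also have "\<dots> \<le> (\<integral>\<^sup>+t. ennreal \<bar>f t * t\<bar> \<partial>M)"
    by (intro nn_integral_mono ennreal_leI) simp
  finally have "(\<integral>\<^sup>+t\<in>{\<tau>..1}. ennreal (f t) \<partial>lborel) ^ d \<le> (\<integral>\<^sup>+t. ennreal \<bar>f t * t\<bar> \<partial>M) ^ d"
    by (intro power_mono) auto
  also have "\<dots> \<le> ennreal (ln (1 / \<tau>) ^ (d - 1)) * (\<integral>\<^sup>+t. ennreal (\<bar>f t * t\<bar> ^ d) \<partial>M)"
    using \<tau> by (intro nn_integral_power_mean L d) (auto simp: ln_div)
  finally show ?thesis by (simp add: eq2)
qed

text \<open>
  The function \<open>e\<close> bounds the variation of \<open>u\<close> over distances at most \<open>h\<close>, so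
  \<open>e / h\<close> acts as the gradient of \<open>u\<close>. The ray through \<open>x\<close> is cut into pieces of length at
  most \<open>h\<close>. On each piece the increment of \<open>u\<close> is at most every value of \<open>e\<close> there, hence
  at most its mean. The term \<open>1 / \<tau>\<close> accounts for rounding the number of pieces.
\<close>

lemma step_function_le_line_integral:
  fixes u e :: "'a::real_normed_vector \<Rightarrow> real"
  assumes e: "(\<lambda>t. e (t *\<^sub>R x)) \<in> borel_measurable borel"
    and u0: "\<And>x. norm x \<le> \<tau> \<Longrightarrow> u x = 0" and nn: "\<And>x. 0 \<le> u x"
    and step: "\<And>x y z. \<lbrakk>norm x < \<rho>; norm y < \<rho>; dist x y \<le> h; z \<in> closed_segment y x\<rbrakk> \<Longrightarrow> u x \<le> u y + e z"
    and \<tau>: "0 < \<tau>" "\<tau> \<le> 1 / 2" and "0 < h" "\<rho> \<le> 1" and x: "\<tau> \<le> norm x" "norm x < \<rho>"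
  shows "ennreal (u x) \<le> ennreal (2 * (1 / h + 1 / \<tau>) * norm x) * (\<integral>\<^sup>+t\<in>{\<tau>..1}. ennreal (e (t *\<^sub>R x)) \<partial>lborel)"
proof -
  note [measurable] = e
  define n where "n = nat \<lceil>norm x / h\<rceil>"
  have "0 < norm x" using \<tau> x by linarith
  then have "0 < norm x / h" using \<open>0 < h\<close> by simp
  then have n0: "0 < n" and n: "norm x / h \<le> real n" "real n \<le> norm x / h + 1"
    unfolding n_def by linarith+
  define l where "l = (1 - \<tau>) / real n"
  have l: "0 < l" "1 / (2 * real n) \<le> l" using \<tau> n0 by (auto simp: l_def field_simps)
  have lx: "l * norm x \<le> h"
  proof -
    have "l * norm x \<le> (1 / real n) * norm x"
      unfolding l_def using \<tau> by (intro mult_right_mono divide_right_mono) auto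
    also have "\<dots> \<le> h" using n n0 \<open>0 < h\<close> by (simp add: field_simps)
    finally show ?thesis .
  qed
  define t where "t k = \<tau> + l * real k" for k
  have t0: "t 0 = \<tau>" and tn: "t n = 1" using n0 by (auto simp: t_def l_def)
  have tS: "t (Suc k) = t k + l" for k by (simp add: t_def algebra_simps)
  have tle: "t k \<le> 1" if "k \<le> n" for k
  proof -
    have "t k \<le> t n" unfolding t_def using that l by (intro add_left_mono mult_left_mono) auto
    then show ?thesis by (simp add: tn)
  qed
  have tpos: "\<tau> \<le> t k" for k using l \<tau> by (simp add: t_def)
  have small: "norm (s *\<^sub>R x) < \<rho>" if "0 \<le> s" "s \<le> 1" for s
    using that x mult_left_le_one_le [of "norm x" s] by simp
  have main: "k \<le> n \<Longrightarrow> ennreal (l * u (t k *\<^sub>R x)) \<le> (\<integral>\<^sup>+s\<in>{\<tau>..t k}. ennreal (e (s *\<^sub>R x)) \<partial>lborel)" for k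
  proof (induction k)
    case 0
    have "norm (\<tau> *\<^sub>R x) \<le> \<tau>"
      using x \<tau> \<open>\<rho> \<le> 1\<close> by (auto intro!: mult_left_le)
    then show ?case by (simp add: u0 t0)
  next
    case (Suc k)
    have k: "t (Suc k) \<le> 1" "t k \<le> 1" using tle [of k] tle [of "Suc k"] Suc.prems by auto
    have le: "u (t (Suc k) *\<^sub>R x) - u (t k *\<^sub>R x) \<le> e (s *\<^sub>R x)" if s: "t k < s" "s \<le> t (Suc k)" for s
    proof -
      have "u (t (Suc k) *\<^sub>R x) \<le> u (t k *\<^sub>R x) + e (s *\<^sub>R x)"
      proof (rule step)
        show "norm (t (Suc k) *\<^sub>R x) < \<rho>" "norm (t k *\<^sub>R x) < \<rho>"
          using k tpos [of k] tpos [of "Suc k"] \<tau> by (auto intro!: small simp del: norm_scaleR)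
        show "dist (t (Suc k) *\<^sub>R x) (t k *\<^sub>R x) \<le> h"
          using lx l by (simp add: dist_norm tS scaleR_diff_left [symmetric])
        define a where "a = (s - t k) / l"
        have a: "0 \<le> a" "a \<le> 1" "s = (1 - a) * t k + a * t (Suc k)"
          using s l by (auto simp: a_def tS field_simps)
        show "s *\<^sub>R x \<in> closed_segment (t k *\<^sub>R x) (t (Suc k) *\<^sub>R x)"
          unfolding in_segment using a by (intro exI [of _ a]) (simp add: scaleR_add_left)
      qed
      then show ?thesis by simp
    qed
    have "ennreal (l * u (t (Suc k) *\<^sub>R x)) = ennreal (l * u (t k *\<^sub>R x) + l * (u (t (Suc k) *\<^sub>R x) - u (t k *\<^sub>R x)))"
      by (simp add: algebra_simps)
    also have "\<dots> \<le> ennreal (l * u (t k *\<^sub>R x)) + ennreal (l * (u (t (Suc k) *\<^sub>R x) - u (t k *\<^sub>R x)))"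
      by (cases "0 \<le> l * (u (t (Suc k) *\<^sub>R x) - u (t k *\<^sub>R x))")
         (use l nn in \<open>auto simp: ennreal_plus [symmetric] ennreal_neg simp del: ennreal_plus intro!: ennreal_leI\<close>)
    also have "\<dots> \<le> (\<integral>\<^sup>+s\<in>{\<tau>..t k}. ennreal (e (s *\<^sub>R x)) \<partial>lborel) + (\<integral>\<^sup>+s\<in>{t k<..t (Suc k)}. ennreal (e (s *\<^sub>R x)) \<partial>lborel)"
    proof (rule add_mono)
      show "ennreal (l * u (t k *\<^sub>R x)) \<le> (\<integral>\<^sup>+s\<in>{\<tau>..t k}. ennreal (e (s *\<^sub>R x)) \<partial>lborel)"
        using Suc by simp
      have "ennreal (l * (u (t (Suc k) *\<^sub>R x) - u (t k *\<^sub>R x))) =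
          (\<integral>\<^sup>+s\<in>{t k<..t (Suc k)}. ennreal (u (t (Suc k) *\<^sub>R x) - u (t k *\<^sub>R x)) \<partial>lborel)"
        using l by (subst nn_integral_cmult_indicator) (simp_all add: tS ennreal_mult' mult.commute)
      also have "\<dots> \<le> (\<integral>\<^sup>+s\<in>{t k<..t (Suc k)}. ennreal (e (s *\<^sub>R x)) \<partial>lborel)"
        using le by (intro nn_integral_mono) (auto simp: indicator_def intro!: ennreal_leI)
      finally show "ennreal (l * (u (t (Suc k) *\<^sub>R x) - u (t k *\<^sub>R x))) \<le> \<dots>" .
    qed
    also have "\<dots> = (\<integral>\<^sup>+s\<in>{\<tau>..t (Suc k)}. ennreal (e (s *\<^sub>R x)) \<partial>lborel)"
      using tpos [of k] l
      by (subst nn_integral_add [symmetric])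
         (auto intro!: nn_integral_cong simp: indicator_def tS)
    finally show ?case .
  qed
  have "1 \<le> norm x / \<tau>" using x \<tau> by simp
  then have "real n \<le> norm x / h + norm x / \<tau>" using n by linarith
  then have "2 * real n \<le> 2 * (norm x / h + norm x / \<tau>)" by (rule mult_left_mono) simp
  also have "\<dots> = 2 * (1 / h + 1 / \<tau>) * norm x" by (simp add: algebra_simps)
  finally have n2: "2 * real n \<le> 2 * (1 / h + 1 / \<tau>) * norm x" .
  have "ennreal (u x) \<le> ennreal (2 * real n * (l * u x))"
  proof (rule ennreal_leI)
    have "1 * u x \<le> (2 * real n * l) * u x"
      using l n0 nn by (intro mult_right_mono) (auto simp: field_simps)
    then show "u x \<le> 2 * real n * (l * u x)" by (simp add: mult_ac)
  qed
  also have "\<dots> = ennreal (2 * real n) * ennreal (l * u x)"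
    by (rule ennreal_mult) (use l nn in auto)
  also have "\<dots> \<le> ennreal (2 * (1 / h + 1 / \<tau>) * norm x) * (\<integral>\<^sup>+t\<in>{\<tau>..1}. ennreal (e (t *\<^sub>R x)) \<partial>lborel)"
    using main [of n] tn by (intro mult_mono ennreal_leI n2) auto
  finally show ?thesis .
qed

text \<open>
  Bound \<open>u\<close> by integrals along rays, apply the weighted power mean inequality on each ray, and
  exchange the integrals. For fixed \<open>t\<close> the substitution \<open>y = t *\<^sub>R x\<close> gives the factor
  \<open>1 / t ^ d\<close>, which leaves the weight \<open>1 / t\<close>. So the power mean inequality contributes
  \<open>d - 1\<close> logarithms and the outer integral the last one.
\<close>

lemma critical_hardy_inequality:
  fixes u e :: "'a::euclidean_space \<Rightarrow> real"
  assumes [measurable]: "u \<in> borel_measurable borel" "e \<in> borel_measurable borel"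
    and nn: "\<And>x. 0 \<le> u x" "\<And>x. 0 \<le> e x"
    and u0: "\<And>x. norm x \<le> \<tau> \<Longrightarrow> u x = 0"
    and step: "\<And>x y z. \<lbrakk>norm x < \<rho>; norm y < \<rho>; dist x y \<le> h; z \<in> closed_segment y x\<rbrakk> \<Longrightarrow> u x \<le> u y + e z"
    and \<tau>: "0 < \<tau>" "\<tau> \<le> 1 / 2" and "0 < h" "\<rho> \<le> 1"
  defines "M \<equiv> 2 * (1 / h + 1 / \<tau>)"
  shows "(\<integral>\<^sup>+x\<in>ball 0 \<rho>. ennreal ((u x / norm x) ^ DIM('a)) \<partial>lborel)
    \<le> ennreal ((M * ln (1 / \<tau>)) ^ DIM('a)) * (\<integral>\<^sup>+x. ennreal (e x ^ DIM('a)) \<partial>lborel)"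
proof -
  let ?d = "DIM('a)"
  define L where "L = ln (1 / \<tau>)"
  define J where "J = (\<integral>\<^sup>+x. ennreal (e x ^ ?d) \<partial>lborel)"
  have L: "0 < L" using \<tau> by (simp add: L_def)
  have M: "0 < M" using \<tau> \<open>0 < h\<close> by (simp add: M_def add_pos_pos)
  have pt: "ennreal ((u x / norm x) ^ ?d) * indicator (ball 0 \<rho>) x
     \<le> ennreal (M ^ ?d * L ^ (?d - 1)) * (\<integral>\<^sup>+t\<in>{\<tau>..1}. ennreal (t ^ (?d - 1) * e (t *\<^sub>R x) ^ ?d) \<partial>lborel)" for x
  proof (cases "\<tau> \<le> norm x \<and> norm x < \<rho>")
    case True
    then have x: "0 < norm x" using \<tau> by linarith
    have "ennreal (u x / norm x) = ennreal (1 / norm x) * ennreal (u x)"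
      using nn x by (simp add: ennreal_mult [symmetric] del: norm_eq_zero)
    also have "\<dots> \<le> ennreal (1 / norm x) * (ennreal (M * norm x) * (\<integral>\<^sup>+t\<in>{\<tau>..1}. ennreal (e (t *\<^sub>R x)) \<partial>lborel))"
      unfolding M_def using assms True
      by (intro mult_left_mono step_function_le_line_integral [where \<rho> = \<rho>]) auto
    also have "\<dots> = ennreal M * (\<integral>\<^sup>+t\<in>{\<tau>..1}. ennreal (e (t *\<^sub>R x)) \<partial>lborel)"
      using x M by (simp add: mult.assoc [symmetric] ennreal_mult [symmetric])
    finally have "ennreal (u x / norm x) ^ ?d \<le> (ennreal M * (\<integral>\<^sup>+t\<in>{\<tau>..1}. ennreal (e (t *\<^sub>R x)) \<partial>lborel)) ^ ?d"
      by (intro power_mono) auto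
    also have "\<dots> = ennreal (M ^ ?d) * (\<integral>\<^sup>+t\<in>{\<tau>..1}. ennreal (e (t *\<^sub>R x)) \<partial>lborel) ^ ?d"
      using M by (simp add: power_mult_distrib ennreal_power)
    also have "\<dots> \<le> ennreal (M ^ ?d) * (ennreal (L ^ (?d - 1)) * (\<integral>\<^sup>+t\<in>{\<tau>..1}. ennreal (t ^ (?d - 1) * e (t *\<^sub>R x) ^ ?d) \<partial>lborel))"
      unfolding L_def using \<tau> nn by (intro mult_left_mono nn_integral_Icc_power_le_weighted) auto
    finally show ?thesis
      using nn M L True by (simp add: ennreal_power ennreal_mult mult.assoc)
  next
    case False
    then show ?thesis using u0 [of x] by (auto simp: indicator_def zero_power)
  qed
  have scale: "(\<integral>\<^sup>+x. ennreal (e (t *\<^sub>R x) ^ ?d) \<partial>lborel) = ennreal (1 / t ^ ?d) * J" if "0 < t" for t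
  proof -
    have "J = ennreal (t ^ ?d) * (\<integral>\<^sup>+x. ennreal (e (t *\<^sub>R x) ^ ?d) \<partial>lborel)"
      unfolding J_def using that
      nn_integral_lborel_affine [of "\<lambda>x. ennreal (e x ^ ?d)" t 0] by simp
    then show ?thesis using that by (simp add: mult.assoc [symmetric] ennreal_mult [symmetric])
  qed
  have "(\<integral>\<^sup>+x\<in>ball 0 \<rho>. ennreal ((u x / norm x) ^ ?d) \<partial>lborel)
     \<le> (\<integral>\<^sup>+x. ennreal (M ^ ?d * L ^ (?d - 1)) * (\<integral>\<^sup>+t\<in>{\<tau>..1}. ennreal (t ^ (?d - 1) * e (t *\<^sub>R x) ^ ?d) \<partial>lborel) \<partial>lborel)"
    by (intro nn_integral_mono pt)
  also have "\<dots> = ennreal (M ^ ?d * L ^ (?d - 1)) * (\<integral>\<^sup>+x. (\<integral>\<^sup>+t\<in>{\<tau>..1}. ennreal (t ^ (?d - 1) * e (t *\<^sub>R x) ^ ?d) \<partial>lborel) \<partial>lborel)"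
    by (rule nn_integral_cmult) measurable
  also have "(\<integral>\<^sup>+x. (\<integral>\<^sup>+t\<in>{\<tau>..1}. ennreal (t ^ (?d - 1) * e (t *\<^sub>R x) ^ ?d) \<partial>lborel) \<partial>lborel)
     = (\<integral>\<^sup>+t. (\<integral>\<^sup>+x. ennreal (t ^ (?d - 1) * e (t *\<^sub>R x) ^ ?d) * indicator {\<tau>..1} t \<partial>lborel) \<partial>lborel)"
    by (rule lborel_pair.Fubini') measurable
  also have "\<dots> = (\<integral>\<^sup>+t. ennreal (1 / t) * indicator {\<tau>..1} t * J \<partial>lborel)"
  proof (rule nn_integral_cong)
    fix t :: real
    show "(\<integral>\<^sup>+x. ennreal (t ^ (?d - 1) * e (t *\<^sub>R x) ^ ?d) * indicator {\<tau>..1} t \<partial>lborel) = ennreal (1 / t) * indicator {\<tau>..1} t * J"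
    proof (cases "t \<in> {\<tau>..1}")
      case True
      then have t: "0 < t" using \<tau> by auto
      have "t ^ ?d = t * t ^ (?d - 1)" by (simp add: power_eq_if)
      then have "t ^ (?d - 1) * (1 / t ^ ?d) = 1 / t" using t by simp
      then have "ennreal (t ^ (?d - 1)) * (ennreal (1 / t ^ ?d) * J) = ennreal (1 / t) * J"
        using t by (simp add: mult.assoc [symmetric] ennreal_mult [symmetric])
      moreover have "(\<integral>\<^sup>+x. ennreal (t ^ (?d - 1) * e (t *\<^sub>R x) ^ ?d) \<partial>lborel) = ennreal (t ^ (?d - 1)) * (\<integral>\<^sup>+x. ennreal (e (t *\<^sub>R x) ^ ?d) \<partial>lborel)"
        using t nn by (subst nn_integral_cmult [symmetric]) (auto simp: ennreal_mult)
      ultimately show ?thesis using True t by (simp add: scale)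
    qed auto
  qed
  also have "\<dots> = ennreal L * J"
    using \<tau> by (subst nn_integral_multc) (auto simp: nn_integral_inverse_Icc L_def)
  also have "ennreal (M ^ ?d * L ^ (?d - 1)) * (ennreal L * J) = ennreal (M ^ ?d * L ^ (?d - 1) * L) * J"
    using M L by (simp add: mult.assoc [symmetric] ennreal_mult [symmetric])
  also have "M ^ ?d * L ^ (?d - 1) * L = (M * L) ^ ?d"
    using power_minus_mult [of ?d L] by (simp add: power_mult_distrib mult.assoc)
  finally show ?thesis by (simp only: J_def L_def)
qed

section \<open>Simplicial meshes\<close>

lemma negligible_aff_dim_less:
  fixes S :: "'a::euclidean_space set"
  assumes "aff_dim S < int DIM('a)"
  shows "negligible S"
proof -
  obtain a b where "a \<noteq> 0" "S \<subseteq> {x. a \<bullet> x = b}"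
    using assms by (rule aff_lowdim_subset_hyperplane)
  then show ?thesis using negligible_hyperplane [of a b] negligible_subset by blast
qed

locale simplicial_mesh =
  fixes T :: "(real^'n) set set"
  assumes triang: "triangulation T" and full: "\<And>K. K \<in> T \<Longrightarrow> int CARD('n) simplex K"
begin

lemma finite_mesh: "finite T"
  using triang by (simp add: triangulation_def)

lemma element:
  assumes "K \<in> T"
  shows "convex K" "compact K" "closed K" "aff_dim K = int CARD('n)" "polytope K" "K \<noteq> {}" "interior K \<noteq> {}"
    "closure (interior K) = K" "rel_interior K = interior K"
proof -
  show "convex K" "compact K" "closed K" "polytope K" and dim: "aff_dim K = int CARD('n)"
    using full [OF assms] by (auto intro: convex_simplex compact_simplex closed_simplex simplex_imp_polytope aff_dim_simplex)
  show "K \<noteq> {}" using dim by auto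
  show "rel_interior K = interior K" using dim by (intro interior_rel_interior) simp
  then show "interior K \<noteq> {}" using \<open>convex K\<close> \<open>K \<noteq> {}\<close> rel_interior_eq_empty by metis
  then show "closure (interior K) = K" using \<open>convex K\<close> \<open>closed K\<close> by (simp add: convex_closure_interior)
qed

lemma Int_face: "\<lbrakk>A \<in> T; B \<in> T\<rbrakk> \<Longrightarrow> A \<inter> B face_of A" "\<lbrakk>A \<in> T; B \<in> T\<rbrakk> \<Longrightarrow> A \<inter> B face_of B"
  using triang unfolding triangulation_def by (blast, metis Int_commute)

lemma Int_proper:
  assumes "A \<in> T" "B \<in> T" "A \<noteq> B"
  shows "A \<inter> B \<noteq> A"
proof
  assume "A \<inter> B = A"
  then have "A face_of B" using Int_face [OF assms(1,2)] by simp
  then have "aff_dim A < aff_dim B" using assms element(1) face_of_aff_dim_lt by metis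
  then show False using assms by (simp add: element)
qed

lemma Int_interior_empty:
  assumes "A \<in> T" "B \<in> T" "A \<noteq> B"
  shows "A \<inter> interior B = {}"
proof -
  have "A \<inter> B \<noteq> B" using Int_proper [of B A] assms by (simp add: Int_commute)
  then have "A \<inter> B \<inter> interior B = {}" using Int_face assms by (intro face_of_disjoint_interior) auto
  then show ?thesis using interior_subset by blast
qed

lemma aff_dim_Int:
  assumes "A \<in> T" "B \<in> T" "A \<noteq> B"
  shows "aff_dim (A \<inter> B) < int CARD('n)"
  using face_of_aff_dim_lt [OF _ Int_face(1) Int_proper] element assms by metis

lemma facet_eq_proper_face:
  assumes "A \<in> T" "F facet_of A" "G face_of A" "G \<noteq> A" "F \<subseteq> G"
  shows "F = G"
proof (rule ccontr)
  assume "F \<noteq> G"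
  have "F face_of G"
    using assms by (meson face_of_imp_subset face_of_subset facet_of_imp_face_of)
  then have "aff_dim F < aff_dim G"
    using face_of_aff_dim_lt \<open>F \<noteq> G\<close> assms(3) face_of_imp_convex by metis
  moreover have "aff_dim G < aff_dim A"
    using face_of_aff_dim_lt assms element(1) by metis
  ultimately show False using assms(2) by (simp add: facet_of_def)
qed

lemma facet_hyperplane:
  assumes "A \<in> T" "F facet_of A" "norm m = 1" "F \<subseteq> {x. m \<bullet> x = c}"
  shows "affine hull F = {x. m \<bullet> x = c}"
proof (rule affine_dim_equal)
  show "affine hull F \<subseteq> {x. m \<bullet> x = c}" by (rule hull_minimal) (use assms affine_hyperplane in auto)
  have "m \<noteq> 0" using assms(3) by auto
  then show "aff_dim (affine hull F) = aff_dim {x. m \<bullet> x = c}"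
    using assms(1,2) by (simp add: facet_of_def element aff_dim_hyperplane)
  show "affine hull F \<noteq> {}" using assms(2) by (simp add: facet_of_def)
qed (auto simp: affine_hyperplane)

lemma not_subset_hyperplane:
  assumes "A \<in> T" "m \<noteq> 0"
  shows "\<not> A \<subseteq> {x. m \<bullet> x = c}"
proof
  assume "A \<subseteq> {x. m \<bullet> x = c}"
  then have "aff_dim A \<le> aff_dim {x. m \<bullet> x = c}" by (rule aff_dim_subset)
  then show False using assms by (simp add: element aff_dim_hyperplane)
qed

text \<open>
  The facet spans a hyperplane, which determines the unit normal up to its sign. The opposite sign would confine
  \<open>A\<close> to the hyperplane.
\<close>

lemma outward_normal_eqI:
  assumes A: "A \<in> T" "F facet_of A" and m: "norm m = 1" "A \<subseteq> {x. m \<bullet> x \<le> c}" "F \<subseteq> {x. m \<bullet> x = c}"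
  shows "outward_normal A F = m"
  unfolding outward_normal_def
proof (rule the_equality)
  have "A \<inter> {x. m \<bullet> x = c} face_of A"
    using m element(1) [OF A(1)] by (intro face_of_Int_supporting_hyperplane_le) auto
  moreover have "A \<inter> {x. m \<bullet> x = c} \<noteq> A"
    using not_subset_hyperplane [OF A(1), of m c] m(1) by fastforce
  ultimately have "F = A \<inter> {x. m \<bullet> x = c}"
    using A m(3) facet_of_imp_subset by (intro facet_eq_proper_face) auto
  then show "norm m = 1 \<and> (\<exists>b. A \<subseteq> {x. m \<bullet> x \<le> b} \<and> F = A \<inter> {x. m \<bullet> x = b})"
    using m by blast
next
  fix n assume "norm n = 1 \<and> (\<exists>b. A \<subseteq> {x. n \<bullet> x \<le> b} \<and> F = A \<inter> {x. n \<bullet> x = b})"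
  then obtain b where n: "norm n = 1" "A \<subseteq> {x. n \<bullet> x \<le> b}" "F = A \<inter> {x. n \<bullet> x = b}" by blast
  have eq: "{x. m \<bullet> x = c} = {x. n \<bullet> x = b}"
    using facet_hyperplane [OF A m(1,3)] facet_hyperplane [OF A n(1), of b] n(3) by auto
  obtain p where "p \<in> F" using A(2) by (auto simp: facet_of_def)
  then have p: "m \<bullet> p = c" "n \<bullet> p = b" using m n by auto
  define y where "y = n - (n \<bullet> m) *\<^sub>R m"
  have mm: "m \<bullet> m = 1" "n \<bullet> n = 1" using m n by (simp_all add: norm_eq_1)
  have "m \<bullet> y = 0" by (simp add: y_def inner_diff_right mm inner_commute)
  then have "p + y \<in> {x. m \<bullet> x = c}" using p by (simp add: inner_add_right)
  then have "n \<bullet> y = 0" unfolding eq using p by (simp add: inner_add_right)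
  then have "y \<bullet> y = 0" using \<open>m \<bullet> y = 0\<close> by (simp add: y_def inner_diff_left)
  then have nm: "n = (n \<bullet> m) *\<^sub>R m" by (simp add: y_def)
  then have "norm n = \<bar>n \<bullet> m\<bar> * norm m" by (metis norm_scaleR)
  then have "\<bar>n \<bullet> m\<bar> = 1" using m n by simp
  then consider "n \<bullet> m = 1" | "n \<bullet> m = -1" by linarith
  then show "n = m"
  proof cases
    case 1 then show ?thesis using nm by simp
  next
    case 2
    then have "n = - m" using nm by simp
    then have "A \<subseteq> {x. m \<bullet> x = c}" using n(2) m(2) p by (force simp: inner_minus_left)
    moreover have "m \<noteq> 0" using m(1) by auto
    ultimately show ?thesis using not_subset_hyperplane [OF A(1)] by blast
  qed
qed

text \<open>
  The interiors of two elements are disjoint, so a hyperplane separates the elements. It contains the common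
  facet, hence is its affine hull, and its unit normal points out of one element and into the other.
\<close>

lemma common_facet_separation:
  assumes A: "A \<in> T" "F facet_of A" and B: "B \<in> T" "F facet_of B" and "A \<noteq> B"
  obtains c where "norm (outward_normal A F) = 1" "outward_normal B F = - outward_normal A F"
    "A \<subseteq> {x. outward_normal A F \<bullet> x \<le> c}" "B \<subseteq> {x. outward_normal A F \<bullet> x \<ge> c}"
    "F \<subseteq> {x. outward_normal A F \<bullet> x = c}"
proof -
  have "interior A \<inter> interior B = {}"
    using Int_interior_empty [OF A(1) B(1) \<open>A \<noteq> B\<close>] interior_subset by blast
  then obtain a b where a: "a \<noteq> 0" "\<forall>x\<in>interior A. a \<bullet> x \<le> b" "\<forall>x\<in>interior B. b \<le> a \<bullet> x"
    using separating_hyperplane_sets [of "interior A" "interior B"] A B by (auto simp: element)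
  define m c where "m = (1 / norm a) *\<^sub>R a" and "c = b / norm a"
  have m1: "norm m = 1" using a by (simp add: m_def)
  have "interior A \<subseteq> {x. m \<bullet> x \<le> c}" "interior B \<subseteq> {x. m \<bullet> x \<ge> c}"
    using a by (auto simp: m_def c_def divide_right_mono)
  then have "closure (interior A) \<subseteq> {x. m \<bullet> x \<le> c}" "closure (interior B) \<subseteq> {x. m \<bullet> x \<ge> c}"
    by (simp_all add: closure_minimal closed_halfspace_le closed_halfspace_ge)
  then have sub: "A \<subseteq> {x. m \<bullet> x \<le> c}" "B \<subseteq> {x. m \<bullet> x \<ge> c}" using A B by (auto simp: element)
  then have F: "F \<subseteq> {x. m \<bullet> x = c}"
    using A(2) B(2) by (fastforce dest!: facet_of_imp_subset)
  have "outward_normal A F = m" by (rule outward_normal_eqI [OF A m1 sub(1) F])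
  moreover have "outward_normal B F = - m"
    by (rule outward_normal_eqI [OF B, where c = "- c"]) (use m1 sub F in auto)
  ultimately show thesis using that [of c] m1 sub F by auto
qed

text \<open>
  A third element would be separated from both by the hyperplane of the facet, on which it would then have to lie.
\<close>

lemma common_facet_only_two:
  assumes A: "A \<in> T" "F facet_of A" and B: "B \<in> T" "F facet_of B" and "A \<noteq> B"
  shows "{K \<in> T. F facet_of K} = {A, B}"
proof -
  have False if C: "C \<in> T" "F facet_of C" "C \<noteq> A" "C \<noteq> B" for C
  proof -
    define m where "m = outward_normal A F"
    obtain p where p: "p \<in> F" using A(2) by (auto simp: facet_of_def)
    obtain c1 where 1: "norm m = 1" "outward_normal B F = - m" "F \<subseteq> {x. m \<bullet> x = c1}"
      using common_facet_separation [OF A B \<open>A \<noteq> B\<close>] unfolding m_def by metis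
    obtain c2 where 2: "C \<subseteq> {x. m \<bullet> x \<ge> c2}" "F \<subseteq> {x. m \<bullet> x = c2}"
      using common_facet_separation [OF A C(1,2)] C(3) unfolding m_def by metis
    obtain c3 where 3: "C \<subseteq> {x. (- m) \<bullet> x \<ge> c3}" "F \<subseteq> {x. (- m) \<bullet> x = c3}"
      using common_facet_separation [OF B C(1,2)] C(4) 1(2) by metis
    have "c2 = m \<bullet> p" "c3 = - (m \<bullet> p)" using p 2 3 by auto
    then have "C \<subseteq> {x. m \<bullet> x = m \<bullet> p}" using 2(1) 3(1) by (force simp: inner_minus_left)
    moreover have "m \<noteq> 0" using 1(1) by auto
    ultimately show False using not_subset_hyperplane [OF C(1)] by blast
  qed
  then show ?thesis using assms by blast
qed

lemma norm_jump:
  assumes A: "A \<in> T" "F facet_of A" and B: "B \<in> T" "F facet_of B" and "A \<noteq> B"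
  shows "norm (jump T g F x) = \<bar>g A x - g B x\<bar>"
proof -
  obtain c where *: "norm (outward_normal A F) = 1" "outward_normal B F = - outward_normal A F"
    using common_facet_separation [OF assms] by metis
  have "jump T g F x = g A x *\<^sub>R outward_normal A F + g B x *\<^sub>R outward_normal B F"
    unfolding jump_def common_facet_only_two [OF assms] using \<open>A \<noteq> B\<close> by simp
  also have "\<dots> = (g A x - g B x) *\<^sub>R outward_normal A F" by (simp add: * scaleR_diff_left)
  finally show ?thesis using * by simp
qed

lemma Int_facet:
  assumes "A \<in> T" "B \<in> T" "A \<noteq> B" "int CARD('n) - 1 \<le> aff_dim (A \<inter> B)"
  shows "A \<inter> B facet_of A" "A \<inter> B facet_of B"
proof -
  have "aff_dim (A \<inter> B) = int CARD('n) - 1" using aff_dim_Int [OF assms(1-3)] assms(4) by simp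
  moreover have "A \<inter> B \<noteq> {}" using assms(4) by (auto simp: aff_dim_empty dest: aff_dim_negative_iff [THEN iffD2])
  ultimately show "A \<inter> B facet_of A" "A \<inter> B facet_of B"
    using assms Int_face by (auto simp: facet_of_def element)
qed

text \<open>
  If the segment from \<open>x\<close> to \<open>y\<close> meets \<open>A\<close>, then \<open>y\<close> lies in the affine
  hull of \<open>x\<close> and \<open>A\<close>, which is a null set when \<open>A\<close> has codimension at least two.
\<close>

lemma generic_segment:
  fixes x :: "real^'n"
  assumes "finite \<A>" "\<And>A. A \<in> \<A> \<Longrightarrow> aff_dim A \<le> int CARD('n) - 2" "x \<notin> \<Union>\<A>" "open U" "U \<noteq> {}"
  obtains y where "y \<in> U" "closed_segment x y \<inter> \<Union>\<A> = {}"
proof -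
  have neg: "negligible (affine hull (insert x A))" if "A \<in> \<A>" for A
  proof -
    have "aff_dim (affine hull (insert x A)) \<le> aff_dim A + 1" by (simp add: aff_dim_insert)
    then show ?thesis using assms(2) [OF that] by (intro negligible_aff_dim_less) simp
  qed
  have "negligible (\<Union>A\<in>\<A>. affine hull (insert x A))"
    using assms(1) neg by (intro negligible_Union) auto
  then have "\<not> U \<subseteq> (\<Union>A\<in>\<A>. affine hull (insert x A))"
    using assms(4,5) open_not_negligible negligible_subset by blast
  then obtain y where y: "y \<in> U" "\<And>A. A \<in> \<A> \<Longrightarrow> y \<notin> affine hull (insert x A)" by blast
  have "z \<notin> A" if A: "A \<in> \<A>" and z: "z \<in> closed_segment x y" for z A
  proof
    assume "z \<in> A"
    then have "z \<noteq> x" using assms(3) A by blast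
    obtain u where u: "z = (1 - u) *\<^sub>R x + u *\<^sub>R y" using z by (auto simp: in_segment)
    then have "u \<noteq> 0" using \<open>z \<noteq> x\<close> by auto
    then have "y = (1 - 1 / u) *\<^sub>R x + (1 / u) *\<^sub>R z"
      by (simp add: u algebra_simps)
    moreover have "(1 - 1 / u) *\<^sub>R x + (1 / u) *\<^sub>R z \<in> affine hull (insert x A)"
      using \<open>z \<in> A\<close> by (intro mem_affine [OF affine_affine_hull]) (auto intro: hull_inc)
    ultimately show False using y(2) [OF A] by simp
  qed
  then show thesis using that y(1) by blast
qed

definition adjacent :: "((real^'n) set \<times> (real^'n) set) set" where
  "adjacent = {(A, B). A \<in> T \<and> B \<in> T \<and> A \<noteq> B \<and> A \<inter> B facet_of A \<and> A \<inter> B facet_of B}"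

text \<open>
  Choose \<open>y\<close> such that the segment misses all intersections of elements of codimension at least two.
  The elements that can be reached from \<open>A\<close> through facets and the other elements then cover the segment by
  two closed sets that are disjoint on it, and connectedness leaves no room for the second set.
\<close>

lemma adjacent_chain:
  assumes A: "A \<in> T" "x \<in> interior A" and B: "B \<in> T" "U \<subseteq> B" "open U" "U \<noteq> {}"
    and sub: "\<And>y. y \<in> U \<Longrightarrow> closed_segment x y \<subseteq> \<Union>T"
  obtains y where "y \<in> U"
    "(A, B) \<in> (adjacent \<inter> {K. K \<inter> closed_segment x y \<noteq> {}} \<times> {K. K \<inter> closed_segment x y \<noteq> {}})\<^sup>*"
proof -
  define \<A> where "\<A> = {P \<inter> Q | P Q. P \<in> T \<and> Q \<in> T \<and> P \<noteq> Q \<and> aff_dim (P \<inter> Q) \<le> int CARD('n) - 2}"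
  have "\<A> \<subseteq> (\<lambda>(P, Q). P \<inter> Q) ` (T \<times> T)" by (auto simp: \<A>_def)
  then have "finite \<A>"
    using finite_mesh by (meson finite_SigmaI finite_imageI finite_subset)
  moreover have "aff_dim P \<le> int CARD('n) - 2" if "P \<in> \<A>" for P
    using that by (auto simp: \<A>_def)
  moreover have "x \<notin> \<Union>\<A>"
  proof
    assume "x \<in> \<Union>\<A>"
    then obtain P Q where "P \<in> T" "Q \<in> T" "P \<noteq> Q" "x \<in> P" "x \<in> Q" by (auto simp: \<A>_def)
    then show False using Int_interior_empty [of P A] Int_interior_empty [of Q A] A by blast
  qed
  ultimately obtain y where y: "y \<in> U" "closed_segment x y \<inter> \<Union>\<A> = {}"
    using generic_segment [of \<A> x U] B(3,4) by metis
  define N where "N = {K. K \<inter> closed_segment x y \<noteq> {}}"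
  define R where "R = adjacent \<inter> N \<times> N"
  define S where "S = {K \<in> T. (A, K) \<in> R\<^sup>*}"
  have xy: "x \<in> A" "y \<in> B" using A(2) B(2) y(1) interior_subset by blast+
  have step: "Q \<in> S" if "P \<in> S" "Q \<in> T" "z \<in> P" "z \<in> Q" "z \<in> closed_segment x y" for P Q z
  proof (cases "P = Q")
    case False
    have P: "P \<in> T" "(A, P) \<in> R\<^sup>*" using that(1) by (simp_all add: S_def)
    have "P \<inter> Q \<notin> \<A>" using y(2) that by blast
    then have "\<not> aff_dim (P \<inter> Q) \<le> int CARD('n) - 2"
      using that(2) P(1) False unfolding \<A>_def by blast
    then have "(P, Q) \<in> adjacent" using P(1) that(2) False Int_facet [of P Q] by (simp add: adjacent_def)
    moreover have "P \<in> N" "Q \<in> N" using that unfolding N_def by blast+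
    ultimately have "(P, Q) \<in> R" by (simp add: R_def)
    with P(2) have "(A, Q) \<in> R\<^sup>*" by (rule rtrancl_into_rtrancl)
    then show ?thesis using that(2) by (simp add: S_def)
  qed (use that in simp)
  have fin: "finite S" "finite (T - S)" using finite_mesh by (auto simp: S_def)
  have "B \<in> S"
  proof (rule ccontr)
    assume "B \<notin> S"
    have "connected (closed_segment x y)" by simp
    moreover have "closed (\<Union>S)" "closed (\<Union>(T - S))"
      using fin element by (auto intro!: closed_Union simp: S_def)
    moreover have "closed_segment x y \<subseteq> \<Union>S \<union> \<Union>(T - S)" using sub [OF y(1)] by (auto simp: S_def)
    moreover have "\<Union>S \<inter> \<Union>(T - S) \<inter> closed_segment x y = {}" using step by blast
    moreover have "A \<in> S" using A by (simp add: S_def)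
    then have "\<Union>S \<inter> closed_segment x y \<noteq> {}" using xy by auto
    moreover have "\<Union>(T - S) \<inter> closed_segment x y \<noteq> {}" using xy B \<open>B \<notin> S\<close> by auto
    ultimately show False unfolding connected_closed by blast
  qed
  then show thesis using that [OF y(1)] by (simp add: S_def R_def N_def)
qed

end

section \<open>Vertices and the boundary of the mesh\<close>

text \<open>
  A face of least dimension containing \<open>x\<close>: if \<open>x\<close> were on its relative boundary, it would lie in a
  proper subface.
\<close>

lemma polytope_minimal_face:
  fixes K :: "'a::euclidean_space set"
  assumes "polytope K" "x \<in> K"
  obtains G where "G face_of K" "x \<in> rel_interior G"
proof -
  have "K face_of K \<and> x \<in> K" using assms face_of_refl polytope_imp_convex by blast
  then obtain G where G: "G face_of K" "x \<in> G"
    and min: "\<And>F. F face_of K \<Longrightarrow> x \<in> F \<Longrightarrow> nat (aff_dim G + 1) \<le> nat (aff_dim F + 1)"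
    using ex_has_least_nat [of "\<lambda>G. G face_of K \<and> x \<in> G" K "\<lambda>G. nat (aff_dim G + 1)"] by metis
  have poly: "polytope G" using G assms face_of_polytope_polytope by blast
  have "x \<in> rel_interior G"
  proof (rule ccontr)
    assume "x \<notin> rel_interior G"
    then have "x \<in> rel_frontier G" using G(2) closure_subset by (auto simp: rel_frontier_def)
    then obtain F where F: "F facet_of G" "x \<in> F"
      using rel_frontier_of_polyhedron polytope_imp_polyhedron [OF poly] by blast
    then have "F face_of K" using G(1) facet_of_imp_face_of face_of_trans by blast
    then have "nat (aff_dim G + 1) \<le> nat (aff_dim F + 1)" using min F by blast
    moreover have "aff_dim F = aff_dim G - 1" using F by (simp add: facet_of_def)
    moreover have "0 \<le> aff_dim F" using F(2) aff_dim_negative_iff [of F] by (metis empty_iff not_less)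
    ultimately show False by linarith
  qed
  then show thesis using that G(1) by blast
qed

text \<open>
  The vertices other than 0 are linearly independent, so some \<open>a\<close> has inner product 1 with all of them.
  Hence \<open>K\<close> lies in the slab where \<open>a \<bullet> x\<close> is between 0 and 1, and the face \<open>G\<close>, which
  misses the vertex 0, lies where it is 1. The inscribed ball forces the slab to have width at least \<open>2 * s\<close>.
\<close>

lemma simplex_vertex_distance:
  fixes K :: "'a::euclidean_space set"
  assumes K: "n simplex K" "0 extreme_point_of K" and G: "G face_of K" "0 \<notin> G" "z \<in> G"
    and s: "0 < s" "cball c s \<subseteq> K"
  shows "2 * s \<le> norm z"
proof -
  obtain C where C: "\<not> affine_dependent C" "K = convex hull C"
    using K(1) by (auto simp: simplex_def)
  have "0 \<in> C" using K(2) C(2) extreme_point_of_convex_hull by blast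
  then have "C = insert 0 (C - {0})" by blast
  moreover have "{x - 0 |x. x \<in> C - {0}} = C - {0}" by auto
  ultimately have "independent (C - {0})"
    using dependent_imp_affine_dependent [of 0 "C - {0}"] C(1) by (metis Diff_iff insertI1)
  then obtain f :: "'a \<Rightarrow> real" where f: "linear f" "\<And>x. x \<in> C - {0} \<Longrightarrow> f x = 1"
    using linear_independent_extend [of "C - {0}" "\<lambda>_. 1"] by blast
  define a where "a = adjoint f 1"
  have fa: "f x = a \<bullet> x" for x using adjoint_works [OF f(1), of x 1] by (simp add: a_def inner_commute)
  have C01: "a \<bullet> x \<in> {0..1}" if "x \<in> C" for x using f(2) [of x] that by (cases "x = 0") (auto simp: fa)
  have "K \<subseteq> {x. a \<bullet> x \<ge> 0} \<inter> {x. a \<bullet> x \<le> 1}"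
    unfolding C(2) using C01
    by (intro hull_minimal convex_Int convex_halfspace_ge convex_halfspace_le) auto
  then have K01: "0 \<le> a \<bullet> x" "a \<bullet> x \<le> 1" if "x \<in> K" for x using that by auto
  have "G = convex hull {x. x extreme_point_of G}"
    using G(1) K(1) by (intro Krein_Milman_Minkowski) (meson compact_simplex convex_simplex face_of_imp_compact face_of_imp_convex)+
  moreover have "{x. x extreme_point_of G} \<subseteq> C - {0}"
    using extreme_point_of_face [OF G(1)] extreme_point_of_convex_hull C(2) G(2) by blast
  ultimately have "G \<subseteq> convex hull (C - {0})" by (metis hull_mono)
  also have "\<dots> \<subseteq> {x. a \<bullet> x = 1}"
    using f(2) by (intro hull_minimal convex_hyperplane) (auto simp: fa)
  finally have "a \<bullet> z = 1" using G(3) by auto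
  then have "1 \<le> norm a * norm z" using norm_cauchy_schwarz [of a z] by simp
  have "a \<noteq> 0" using \<open>a \<bullet> z = 1\<close> by auto
  define v where "v = (s / norm a) *\<^sub>R a"
  have "norm v = s" using s \<open>a \<noteq> 0\<close> by (simp add: v_def)
  then have "c + v \<in> K" "c - v \<in> K" using s(2) by (auto simp: dist_norm)
  then have "a \<bullet> (c + v) - a \<bullet> (c - v) \<le> 1" using K01(1)[of "c - v"] K01(2)[of "c + v"] by linarith
  moreover have "a \<bullet> v = s * norm a" using \<open>a \<noteq> 0\<close> by (simp add: v_def dot_square_norm power2_eq_square)
  ultimately have "2 * s * norm a \<le> 1" by (simp add: inner_add_right inner_diff_right)
  then have "2 * s * norm a * norm z \<le> norm z" using mult_right_mono [of "2 * s * norm a" 1 "norm z"] by simp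
  moreover have "2 * s * 1 \<le> 2 * s * (norm a * norm z)"
    using \<open>1 \<le> norm a * norm z\<close> s by (intro mult_left_mono) auto
  ultimately show ?thesis by (simp add: mult.assoc)
qed

context simplicial_mesh
begin

text \<open>
  Compare volumes: the inscribed balls are disjoint.
\<close>

lemma card_elements_le:
  assumes "N \<subseteq> T" "0 < s" "0 \<le> R" "\<And>K. K \<in> N \<Longrightarrow> cball (c K) s \<subseteq> K" "\<And>K. K \<in> N \<Longrightarrow> K \<subseteq> cball x R"
  shows "real (card N) * s ^ CARD('n) \<le> R ^ CARD('n)"
proof -
  let ?\<omega> = "unit_ball_vol (real CARD('n))"
  have fin: "finite N" using assms(1) finite_mesh finite_subset by blast
  have int: "ball (c K) s \<subseteq> interior K" if "K \<in> N" for K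
    using assms(4) [OF that] ball_subset_cball by (intro interior_maximal) auto
  have "disjoint_family_on (\<lambda>K. ball (c K) s) N"
    unfolding disjoint_family_on_def
  proof (intro ballI impI)
    fix A B assume "A \<in> N" "B \<in> N" "A \<noteq> B"
    then have "interior A \<inter> interior B = {}"
      using Int_interior_empty [of A B] assms(1) interior_subset by blast
    then show "ball (c A) s \<inter> ball (c B) s = {}" using int \<open>A \<in> N\<close> \<open>B \<in> N\<close> by blast
  qed
  then have "(\<Sum>K\<in>N. emeasure lborel (ball (c K) s)) = emeasure lborel (\<Union>K\<in>N. ball (c K) s)"
    using fin by (intro sum_emeasure) auto
  also have "\<dots> \<le> emeasure lborel (cball x R)"
    using int interior_subset assms(5) by (intro emeasure_mono) (blast, simp)
  finally have "of_nat (card N) * ennreal (?\<omega> * s ^ CARD('n)) \<le> ennreal (?\<omega> * R ^ CARD('n))"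
    using assms(2,3) by (simp add: emeasure_ball emeasure_cball)
  then have "ennreal (real (card N) * (?\<omega> * s ^ CARD('n))) \<le> ennreal (?\<omega> * R ^ CARD('n))"
    using assms(2) by (simp add: ennreal_mult ennreal_of_nat_eq_real_of_nat)
  then have "real (card N) * (?\<omega> * s ^ CARD('n)) \<le> ?\<omega> * R ^ CARD('n)"
    using assms(3) by (subst (asm) ennreal_le_iff) auto
  then have "?\<omega> * (real (card N) * s ^ CARD('n)) \<le> ?\<omega> * R ^ CARD('n)" by (simp add: mult_ac)
  then show ?thesis by simp
qed

lemma locally_star:
  obtains \<epsilon> where "0 < \<epsilon>" "\<And>y K. dist w y < \<epsilon> \<Longrightarrow> y \<in> K \<Longrightarrow> K \<in> T \<Longrightarrow> w \<in> K"
proof -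
  have "closed (\<Union>{K \<in> T. w \<notin> K})" using finite_mesh element(3) by (intro closed_Union) auto
  then have "open (- \<Union>{K \<in> T. w \<notin> K})" by (simp add: open_closed)
  moreover have "w \<in> - \<Union>{K \<in> T. w \<notin> K}" by simp
  ultimately obtain \<epsilon> where "0 < \<epsilon>" "ball w \<epsilon> \<subseteq> - \<Union>{K \<in> T. w \<notin> K}"
    using open_contains_ball by blast
  then show thesis by (intro that [of \<epsilon>]) auto
qed

text \<open>
  All elements at \<open>w\<close> contain the whole of \<open>G\<close>, because \<open>w\<close> is a relative interior point of
  \<open>G\<close>. Since \<open>x\<close> lies between \<open>w\<close> and another point \<open>w'\<close> of \<open>G\<close>, contracting a
  small ball about \<open>w\<close> towards \<open>w'\<close> gives a ball about \<open>x\<close>, and each of its points stays in an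
  element.
\<close>

lemma interior_along_face:
  assumes G: "K \<in> T" "G face_of K" and x: "x \<in> rel_interior G" and w: "w \<in> rel_interior G" "w \<in> interior (\<Union>T)"
  shows "x \<in> interior (\<Union>T)"
proof -
  obtain \<epsilon>1 where \<epsilon>1: "0 < \<epsilon>1" "\<And>y K. dist w y < \<epsilon>1 \<Longrightarrow> y \<in> K \<Longrightarrow> K \<in> T \<Longrightarrow> w \<in> K" 
    using locally_star by blast
  obtain \<epsilon>2 where \<epsilon>2: "0 < \<epsilon>2" "ball w \<epsilon>2 \<subseteq> \<Union>T" using w(2) mem_interior by blast
  define \<epsilon> where "\<epsilon> = min \<epsilon>1 \<epsilon>2"
  have sub: "G \<subseteq> K'" if "K' \<in> T" "w \<in> K'" for K'
  proof -
    have "G \<subseteq> K \<inter> K'"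
    proof (rule subset_of_face_of [OF Int_face(1) [OF G(1) that(1)]])
      show "G \<subseteq> K" using G(2) face_of_imp_subset by blast
      then show "K \<inter> K' \<inter> rel_interior G \<noteq> {}" using that w(1) rel_interior_subset by blast
    qed
    then show ?thesis by blast
  qed
  have conv: "convex G" using G face_of_imp_convex by blast
  have "G \<noteq> {}" "w \<in> G" using w(1) rel_interior_subset by auto
  then obtain e where e: "e > 1" "(1 - e) *\<^sub>R w + e *\<^sub>R x \<in> G"
    using convex_rel_interior_iff [OF conv, of x] x by blast
  define w' t where "w' = (1 - e) *\<^sub>R w + e *\<^sub>R x" and "t = 1 - 1 / e"
  have t: "0 < t" "t < 1" using e by (auto simp: t_def)
  have xeq: "x = (1 - t) *\<^sub>R w' + t *\<^sub>R w"
    using e by (simp add: t_def w'_def algebra_simps)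
  have "ball x (t * \<epsilon>) \<subseteq> \<Union>T"
  proof
    fix y assume y: "y \<in> ball x (t * \<epsilon>)"
    define z where "z = w + (1 / t) *\<^sub>R (y - x)"
    have "dist w z < \<epsilon>"
      using y t by (simp add: z_def dist_norm norm_minus_commute [of x y] pos_divide_less_eq mult.commute)
    then have "z \<in> \<Union>T" using \<epsilon>2 by (auto simp: \<epsilon>_def)
    then obtain K' where K': "K' \<in> T" "z \<in> K'" by blast
    then have "G \<subseteq> K'" using sub \<epsilon>1(2) [of z K'] \<open>dist w z < \<epsilon>\<close> by (auto simp: \<epsilon>_def)
    then have "w' \<in> K'" using e by (auto simp: w'_def)
    have "y = x + t *\<^sub>R (z - w)" using t by (simp add: z_def)
    also have "\<dots> = (1 - t) *\<^sub>R w' + t *\<^sub>R z" by (subst xeq) (simp add: algebra_simps)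
    also have "\<dots> \<in> K'"
      using element(1) [OF K'(1)] \<open>w' \<in> K'\<close> K'(2) t by (intro convexD) auto
    finally show "y \<in> \<Union>T" using K'(1) by blast
  qed
  moreover have "0 < t * \<epsilon>" using t \<epsilon>1 \<epsilon>2 by (simp add: \<epsilon>_def)
  ultimately show ?thesis using mem_interior by blast
qed

text \<open>
  Take for \<open>G\<close> the face having \<open>x\<close> in its relative interior. If a vertex of \<open>G\<close> were
  interior to the mesh, so would be relative interior points of \<open>G\<close> close to it, and then \<open>x\<close>.
\<close>

lemma frontier_face_vertices:
  assumes "x \<in> frontier (\<Union>T)"
  obtains K G where "K \<in> T" "G face_of K" "x \<in> G" "\<And>v. v extreme_point_of G \<Longrightarrow> v \<in> frontier (\<Union>T)"
proof -
  have "closed (\<Union>T)" using finite_mesh element(3) by (intro closed_Union) auto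
  then have fr: "frontier (\<Union>T) = \<Union>T - interior (\<Union>T)" by (simp add: frontier_def)
  then obtain K where K: "K \<in> T" "x \<in> K" using assms by auto
  obtain G where G: "G face_of K" "x \<in> rel_interior G"
    using polytope_minimal_face [OF element(5) [OF K(1)] K(2)] by blast
  have "v \<in> frontier (\<Union>T)" if v: "v extreme_point_of G" for v
  proof (rule ccontr)
    assume nfr: "v \<notin> frontier (\<Union>T)"
    have vG: "v \<in> G" using v by (simp add: extreme_point_of_def)
    then have "v \<in> K" using G face_of_imp_subset by blast
    then have "v \<in> interior (\<Union>T)" using nfr fr K by auto
    then obtain \<epsilon> where \<epsilon>: "0 < \<epsilon>" "ball v \<epsilon> \<subseteq> interior (\<Union>T)"
      using open_contains_ball [of "interior (\<Union>T)"] by auto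
    define e where "e = min 1 (\<epsilon> / (2 * (norm (v - x) + 1)))"
    have e: "0 < e" "e \<le> 1" using \<epsilon> by (auto simp: e_def add_nonneg_pos)
    define w where "w = v - e *\<^sub>R (v - x)"
    have "w \<in> rel_interior G"
      unfolding w_def using G e vG face_of_imp_convex by (intro rel_interior_convex_shrink) auto
    moreover have "dist v w < \<epsilon>"
    proof -
      have "dist v w = e * norm (v - x)" using e by (simp add: w_def dist_norm)
      also have "\<dots> \<le> e * (norm (v - x) + 1)" using e by (intro mult_left_mono) auto
      also have "\<dots> \<le> \<epsilon> / (2 * (norm (v - x) + 1)) * (norm (v - x) + 1)"
        by (intro mult_right_mono) (auto simp: e_def)
      also have "\<dots> = \<epsilon> / 2" by (simp add: field_simps add_nonneg_eq_0_iff)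
      also have "\<dots> < \<epsilon>" using \<epsilon> by simp
      finally show ?thesis .
    qed
    then have "w \<in> interior (\<Union>T)" using \<epsilon>(2) by auto
    ultimately have "x \<in> interior (\<Union>T)" using interior_along_face K(1) G by blast
    then show False using assms fr by blast
  qed
  then show thesis using that K G rel_interior_subset by blast
qed

text \<open>
  For a unit vector \<open>v\<close> at distance at most \<open>h\<close> from \<open>x\<close>, expanding the square of the distance
  confines \<open>v\<close> to a half space. The vertices of the boundary face of \<open>x\<close> are such vectors, so the half
  space contains their convex hull, and in particular \<open>x\<close>.
\<close>

lemma frontier_norm:
  assumes sph: "\<And>K v. \<lbrakk>K \<in> T; v extreme_point_of K; v \<in> frontier (\<Union>T)\<rbrakk> \<Longrightarrow> norm v = 1"
    and h: "\<And>K. K \<in> T \<Longrightarrow> diameter K \<le> h" and x: "x \<in> frontier (\<Union>T)"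
  shows "1 - h\<^sup>2 \<le> (norm x)\<^sup>2"
proof -
  obtain K G where K: "K \<in> T" "G face_of K" "x \<in> G" and v: "\<And>v. v extreme_point_of G \<Longrightarrow> v \<in> frontier (\<Union>T)"
    using frontier_face_vertices [OF x] by blast
  have "compact G" "convex G" using K element(1,2) face_of_imp_compact face_of_imp_convex by blast+
  then have "G = convex hull {v. v extreme_point_of G}" by (rule Krein_Milman_Minkowski)
  also have "\<dots> \<subseteq> {v. 1 + (norm x)\<^sup>2 - h\<^sup>2 \<le> 2 *\<^sub>R x \<bullet> v}"
  proof (intro hull_minimal convex_halfspace_ge subsetI CollectI)
    fix v assume "v \<in> {v. v extreme_point_of G}"
    then have *: "v extreme_point_of K" "v \<in> G" "v \<in> frontier (\<Union>T)"
      using extreme_point_of_face [OF K(2)] v by blast+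
    then have 1: "norm v = 1" using sph K by blast
    have "v \<in> K" "x \<in> K" using * K face_of_imp_subset by blast+
    then have "dist v x \<le> h"
      using h [OF K(1)] diameter_bounded_bound [OF compact_imp_bounded [OF element(2) [OF K(1)]]] by force
    then have "(norm (v - x))\<^sup>2 \<le> h\<^sup>2" by (intro power_mono) (auto simp: dist_norm)
    moreover have "(norm (v - x))\<^sup>2 = 1 - 2 * (x \<bullet> v) + (norm x)\<^sup>2"
      using 1 by (simp add: power2_norm_eq_inner inner_diff inner_commute norm_eq_1 algebra_simps)
    ultimately show "1 + (norm x)\<^sup>2 - h\<^sup>2 \<le> 2 *\<^sub>R x \<bullet> v" by simp
  qed
  finally have "1 + (norm x)\<^sup>2 - h\<^sup>2 \<le> 2 * (norm x)\<^sup>2" using K(3) by (auto simp: power2_norm_eq_inner)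
  then show ?thesis by simp
qed

lemma ball_subset_Union:
  assumes "\<And>K v. \<lbrakk>K \<in> T; v extreme_point_of K; v \<in> frontier (\<Union>T)\<rbrakk> \<Longrightarrow> norm v = 1"
    and "\<And>K. K \<in> T \<Longrightarrow> diameter K \<le> h" and "0 \<in> \<Union>T"
  shows "ball 0 (sqrt (1 - h\<^sup>2)) \<subseteq> \<Union>T"
proof (cases "ball (0 :: real^'n) (sqrt (1 - h\<^sup>2)) = {}")
  case False
  then have "0 < sqrt (1 - h\<^sup>2)" by simp
  then have pos: "0 < 1 - h\<^sup>2" by simp
  have "ball 0 (sqrt (1 - h\<^sup>2)) \<inter> frontier (\<Union>T) = {}"
  proof -
    have False if "x \<in> frontier (\<Union>T)" "norm x < sqrt (1 - h\<^sup>2)" for x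
    proof -
      have "sqrt (1 - h\<^sup>2) \<le> norm x"
        using frontier_norm [OF assms(1,2) that(1)] by (intro real_le_lsqrt) auto
      then show False using that by simp
    qed
    then show ?thesis by auto
  qed
  moreover have "0 \<in> ball 0 (sqrt (1 - h\<^sup>2)) \<inter> \<Union>T" using pos assms(3) by auto
  ultimately show ?thesis
    using connected_Int_frontier [of "ball 0 (sqrt (1 - h\<^sup>2))" "\<Union>T"] convex_ball convex_connected by blast
qed blast

lemma extreme_point_all:
  assumes "K \<in> T" "v extreme_point_of K" "K' \<in> T" "v \<in> K'"
  shows "v extreme_point_of K'"
proof -
  have "v \<in> K \<inter> K'" using assms by (auto simp: extreme_point_of_def)
  then have "v extreme_point_of (K \<inter> K')"
    using extreme_point_of_face [OF Int_face(1) [OF assms(1,3)]] assms(2) by blast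
  then show ?thesis using extreme_point_of_face [OF Int_face(2) [OF assms(1,3)]] by blast
qed

text \<open>
  On the segment from 0 to a point of \<open>K'\<close> some point \<open>z\<close> lies both in an element \<open>A\<close> that
  contains 0 and in an element \<open>B\<close> that does not. Then \<open>A \<inter> B\<close> is a face of \<open>A\<close> missing the
  vertex 0.
\<close>

lemma distance_from_vertex:
  assumes ball: "ball 0 \<rho> \<subseteq> \<Union>T" and ext: "\<And>K. \<lbrakk>K \<in> T; 0 \<in> K\<rbrakk> \<Longrightarrow> 0 extreme_point_of K"
    and s: "0 < s" "\<And>K. K \<in> T \<Longrightarrow> cball (c K) s \<subseteq> K"
    and x: "K' \<in> T" "0 \<notin> K'" "x \<in> K'" "norm x < \<rho>"
  shows "2 * s \<le> norm x"
proof (rule ccontr)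
  assume "\<not> 2 * s \<le> norm x"
  define S where "S = {K \<in> T. 0 \<in> K}"
  have norm: "norm z \<le> norm x" if "z \<in> closed_segment 0 x" for z
    using segment_bound(1) [OF that] by simp
  have seg: "closed_segment 0 x \<subseteq> \<Union>T"
  proof
    fix z assume "z \<in> closed_segment 0 x"
    then have "norm z < \<rho>" using norm [of z] x(4) by simp
    then have "z \<in> ball 0 \<rho>" by simp
    then show "z \<in> \<Union>T" using ball by blast
  qed
  have "connected (closed_segment 0 x)" by simp
  moreover have "closed (\<Union>S)" "closed (\<Union>(T - S))"
    using finite_mesh element(3) by (auto intro!: closed_Union simp: S_def)
  moreover have "closed_segment 0 x \<subseteq> \<Union>S \<union> \<Union>(T - S)" using seg unfolding S_def by blast
  moreover have "0 \<in> \<Union>T" using seg ends_in_segment(1) by blast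
  then have "0 \<in> \<Union>S" by (auto simp: S_def)
  then have "\<Union>S \<inter> closed_segment 0 x \<noteq> {}" using ends_in_segment(1) by blast
  moreover have "K' \<in> T - S" using x by (simp add: S_def)
  then have "\<Union>(T - S) \<inter> closed_segment 0 x \<noteq> {}" using x(3) ends_in_segment(2) by blast
  ultimately have "\<Union>S \<inter> \<Union>(T - S) \<inter> closed_segment 0 x \<noteq> {}"
    unfolding connected_closed by blast
  then obtain z A B where z: "z \<in> closed_segment 0 x" "A \<in> T" "0 \<in> A" "B \<in> T" "0 \<notin> B" "z \<in> A" "z \<in> B"
    unfolding S_def by blast
  have "2 * s \<le> norm z"
    by (rule simplex_vertex_distance [OF full ext Int_face(1), of A B z s "c A"]) (use z s in auto)
  then show False using norm [OF z(1)] \<open>\<not> 2 * s \<le> norm x\<close> by simp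
qed

end

section \<open>Piecewise constant functions\<close>

text \<open>
  A chain can be shortened to at most \<open>card R\<close> steps.
\<close>

lemma rtrancl_difference_le:
  fixes w :: "'a \<Rightarrow> real"
  assumes "finite R" "(A, B) \<in> R\<^sup>*" "\<And>P Q. (P, Q) \<in> R \<Longrightarrow> \<bar>w P - w Q\<bar> \<le> \<beta>" "0 \<le> \<beta>"
  shows "\<bar>w A - w B\<bar> \<le> real (card R) * \<beta>"
proof -
  have len: "\<bar>w A - w B\<bar> \<le> real n * \<beta>" if "(A, B) \<in> R ^^ n" for n
    using that
  proof (induction n arbitrary: B)
    case (Suc n)
    then obtain P where "(A, P) \<in> R ^^ n" "(P, B) \<in> R" by auto
    then show ?case using Suc.IH [of P] assms(3) [of P B] by (simp add: algebra_simps)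
  qed simp
  obtain n where "n \<le> card R" "(A, B) \<in> R ^^ n"
    using assms(2) unfolding rtrancl_finite_eq_relpow [OF assms(1)] by auto
  then have "\<bar>w A - w B\<bar> \<le> real n * \<beta>" "real n * \<beta> \<le> real (card R) * \<beta>"
    using len assms(4) by (auto intro: mult_right_mono)
  then show ?thesis by linarith
qed

context simplicial_mesh
begin

text \<open>
  Small shifts put \<open>x\<close> and \<open>y\<close> into general position, so that a chain of adjacent elements along a
  segment leads from \<open>A\<close> to \<open>B\<close>. All elements of the chain are near \<open>z\<close>. By volume there are at
  most \<open>(5 / \<kappa>) ^ d\<close> elements near \<open>z\<close>, hence at most the square of this number of steps.
\<close>

lemma neighbour_values:
  fixes w E :: "(real^'n) set \<Rightarrow> real"
  assumes h: "0 < h" "\<And>K. K \<in> T \<Longrightarrow> diameter K \<le> h" and ball: "ball 0 \<rho> \<subseteq> \<Union>T"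
    and \<kappa>: "0 < \<kappa>" "\<And>K. K \<in> T \<Longrightarrow> cball (c K) (\<kappa> * h) \<subseteq> K"
    and E: "\<And>K. 0 \<le> E K" "\<And>P Q. (P, Q) \<in> adjacent \<Longrightarrow> \<bar>w P - w Q\<bar> ^ CARD('n) \<le> E P + E Q"
    and A: "A \<in> T" "x \<in> A" "norm x < \<rho>" and B: "B \<in> T" "y \<in> B" "norm y < \<rho>" and xy: "dist x y \<le> h"
    and z: "z \<in> closed_segment y x"
  shows "\<bar>w A - w B\<bar> \<le> ((5 / \<kappa>) ^ CARD('n))\<^sup>2 * root CARD('n) (\<Sum>K | K \<in> T \<and> infdist z K \<le> 4 * h. E K)"
proof -
  let ?d = "CARD('n)"
  define N where "N = {K \<in> T. infdist z K \<le> 4 * h}"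
  define \<beta> where "\<beta> = root ?d (\<Sum>K\<in>N. E K)"
  have finN: "finite N" using finite_mesh by (simp add: N_def)
  have \<beta>0: "0 \<le> \<beta>" using E(1) by (simp add: \<beta>_def sum_nonneg)
  have diam: "dist p q \<le> h" if "K \<in> T" "p \<in> K" "q \<in> K" for K p q
    using h(2) [OF that(1)] diameter_bounded_bound [OF compact_imp_bounded [OF element(2) [OF that(1)]] that(2,3)] by simp
  have "real (card N) * (\<kappa> * h) ^ ?d \<le> (5 * h) ^ ?d"
  proof (rule card_elements_le [where c = c and x = z])
    fix K assume "K \<in> N"
    then have K: "K \<in> T" "infdist z K \<le> 4 * h" by (auto simp: N_def)
    obtain p where p: "p \<in> K" "dist z p = infdist z K"
      using infdist_attains_inf [OF element(3) element(6)] K(1) by metis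
    show "K \<subseteq> cball z (5 * h)"
    proof
      fix q assume "q \<in> K"
      then have "dist p q \<le> h" using diam K p by blast
      then show "q \<in> cball z (5 * h)" using dist_triangle [of z q p] p K by simp
    qed
  qed (use \<kappa> h N_def in auto)
  then have cardN: "real (card N) \<le> (5 / \<kappa>) ^ ?d"
    using h \<kappa> by (simp add: power_mult_distrib power_divide field_simps)
  \<comment> \<open>move the end points into general position\<close>
  have "x \<in> closure (interior A)" "y \<in> closure (interior B)" using A B by (auto simp: element)
  define \<delta> where "\<delta> = min (h / 2) (min (\<rho> - norm x) (\<rho> - norm y))"
  have \<delta>: "0 < \<delta>" using h A B by (simp add: \<delta>_def)
  obtain x' where x': "x' \<in> interior A" "dist x' x < \<delta>"
    using \<open>x \<in> closure (interior A)\<close> \<delta> closure_approachable by blast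
  define U where "U = interior B \<inter> ball y \<delta>"
  obtain b where "b \<in> interior B" "dist b y < \<delta>"
    using \<open>y \<in> closure (interior B)\<close> \<delta> closure_approachable by blast
  then have "b \<in> U" by (simp add: U_def dist_commute)
  then have "U \<noteq> {}" by blast
  have x'\<rho>: "x' \<in> ball 0 \<rho>"
    using x'(2) norm_triangle_sub [of x' x] by (simp add: \<delta>_def dist_norm)
  have U\<rho>: "U \<subseteq> ball 0 \<rho>"
  proof
    fix q assume "q \<in> U"
    then have "norm (q - y) < \<delta>" by (simp add: U_def dist_norm norm_minus_commute)
    then show "q \<in> ball 0 \<rho>" using norm_triangle_sub [of q y] by (simp add: \<delta>_def)
  qed
  have segT: "closed_segment x' q \<subseteq> \<Union>T" if "q \<in> U" for q
    using closed_segment_subset [OF x'\<rho> _ convex_ball] U\<rho> that ball by blast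
  have "U \<subseteq> B" "open U" using interior_subset by (auto simp: U_def)
  then obtain y' where y': "y' \<in> U"
      "(A, B) \<in> (adjacent \<inter> {K. K \<inter> closed_segment x' y' \<noteq> {}} \<times> {K. K \<inter> closed_segment x' y' \<noteq> {}})\<^sup>*"
    using adjacent_chain [OF A(1) x'(1) B(1) _ _ \<open>U \<noteq> {}\<close> segT] by metis
  define R where "R = adjacent \<inter> {K. K \<inter> closed_segment x' y' \<noteq> {}} \<times> {K. K \<inter> closed_segment x' y' \<noteq> {}}"
  have near: "K \<in> N" if K: "K \<in> T" "K \<inter> closed_segment x' y' \<noteq> {}" for K
  proof -
    obtain p where p: "p \<in> K" "p \<in> closed_segment x' y'" using K(2) by blast
    have "dist x' x < h / 2" "dist y y' < h / 2" using x' y'(1) by (auto simp: U_def \<delta>_def)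
    moreover have "dist x' y' \<le> dist x' x + dist x y + dist y y'"
      using dist_triangle [of x' y' x] dist_triangle [of x y' y] by linarith
    moreover have "dist x' p \<le> dist x' y'" using segment_bound(1) [OF p(2)] by (simp add: dist_norm norm_minus_commute)
    moreover have "dist z x \<le> h"
      using segment_bound(2) [OF z] xy by (simp add: dist_norm norm_minus_commute)
    moreover have "dist z p \<le> dist z x + dist x' x + dist x' p"
      using dist_triangle [of z p x] dist_triangle [of x p x'] by (simp add: dist_commute)
    ultimately have "dist z p \<le> 4 * h" using xy h(1) by linarith
    then show ?thesis using infdist_le [OF p(1), of z] K(1) by (simp add: N_def)
  qed
  have RN: "R \<subseteq> N \<times> N" using near unfolding R_def adjacent_def by blast
  then have finR: "finite R" using finN finite_subset by blast
  have "card R \<le> card N * card N"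
    using card_mono [OF _ RN] finN by (simp add: card_cartesian_product)
  then have "real (card R) \<le> real (card N) * real (card N)" by (metis of_nat_le_iff of_nat_mult)
  also have "\<dots> \<le> ((5 / \<kappa>) ^ ?d)\<^sup>2"
    unfolding power2_eq_square using cardN by (intro mult_mono) auto
  finally have cardR: "real (card R) \<le> ((5 / \<kappa>) ^ ?d)\<^sup>2" .
  have "\<bar>w A - w B\<bar> \<le> real (card R) * \<beta>"
  proof (rule rtrancl_difference_le [OF finR _ _ \<beta>0])
    show "(A, B) \<in> R\<^sup>*" using y'(2) by (simp add: R_def)
    fix P Q assume PQ: "(P, Q) \<in> R"
    then have "P \<in> N" "Q \<in> N" "(P, Q) \<in> adjacent" using RN by (blast, blast, simp add: R_def)
    then have "P \<noteq> Q" by (simp add: adjacent_def)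
    then have "\<bar>w P - w Q\<bar> ^ ?d \<le> (\<Sum>K\<in>{P, Q}. E K)"
      using E(2) [OF \<open>(P, Q) \<in> adjacent\<close>] by simp
    also have "\<dots> \<le> (\<Sum>K\<in>N. E K)"
      using \<open>P \<in> N\<close> \<open>Q \<in> N\<close> finN E(1) by (intro sum_mono2) auto
    finally have "root ?d (\<bar>w P - w Q\<bar> ^ ?d) \<le> \<beta>" unfolding \<beta>_def by (intro real_root_le_mono) auto
    then show "\<bar>w P - w Q\<bar> \<le> \<beta>" by (simp add: real_root_power_cancel)
  qed
  also have "\<dots> \<le> ((5 / \<kappa>) ^ ?d)\<^sup>2 * \<beta>" using cardR \<beta>0 by (rule mult_right_mono)
  finally show ?thesis by (simp add: \<beta>_def N_def)
qed

end

context simplicial_mesh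
begin

text \<open>
  The Hardy inequality for the largest \<open>\<bar>w K\<bar>\<close> over the elements \<open>K\<close> containing \<open>x\<close>, a
  choice that is defined everywhere and needs no exceptional set on the faces. The variation \<open>e z\<close> collects
  \<open>E K\<close> over the elements near \<open>z\<close>. In its integral each \<open>E K\<close> counts with the volume of a
  neighbourhood of \<open>K\<close>, of order \<open>h ^ d\<close>, which cancels the power of \<open>1 / h\<close> in the
  Hardy inequality.
\<close>

lemma piecewise_constant_hardy:
  fixes w E :: "(real^'n) set \<Rightarrow> real"
  defines "u \<equiv> \<lambda>x. Max ((\<lambda>K. \<bar>w K\<bar> * indicator K x) ` T)"
  assumes h: "0 < h" "\<And>K. K \<in> T \<Longrightarrow> diameter K \<le> h" and ball: "ball 0 \<rho> \<subseteq> \<Union>T" and \<rho>: "\<rho> \<le> 1"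
    and \<kappa>: "0 < \<kappa>" "\<And>K. K \<in> T \<Longrightarrow> cball (c K) (\<kappa> * h) \<subseteq> K" "\<kappa> * h \<le> 1 / 2"
    and E: "\<And>K. 0 \<le> E K" "\<And>P Q. (P, Q) \<in> adjacent \<Longrightarrow> \<bar>w P - w Q\<bar> ^ CARD('n) \<le> E P + E Q"
    and w0: "\<And>K x. \<lbrakk>K \<in> T; x \<in> K; norm x \<le> \<kappa> * h\<rbrakk> \<Longrightarrow> w K = 0" and T: "T \<noteq> {}"
  shows "(\<integral>\<^sup>+x\<in>ball 0 \<rho>. ennreal ((u x / norm x) ^ CARD('n)) \<partial>lborel)
      \<le> ennreal ((10 * (1 + 1 / \<kappa>) * ((5 / \<kappa>) ^ CARD('n))\<^sup>2) ^ CARD('n) * unit_ball_vol (real CARD('n)) * ln (1 / (\<kappa> * h)) ^ CARD('n) * (\<Sum>K\<in>T. E K))"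
proof -
  let ?d = "CARD('n)"
  have umem: "u x \<in> (\<lambda>K. \<bar>w K\<bar> * indicator K x) ` T" for x
    unfolding u_def using finite_mesh T by (intro Max_in) auto
  have uge: "\<bar>w K\<bar> * indicator K x \<le> u x" if "K \<in> T" for K x
    unfolding u_def using finite_mesh that by (intro Max_ge) auto
  have u0: "0 \<le> u x" for x using umem [of x] by auto
  have umeas: "u \<in> borel_measurable borel"
  proof -
    have "K \<in> sets borel" if "K \<in> T" for K using element(3) [OF that] by simp
    then show ?thesis
      unfolding u_def using finite_mesh
      by (intro borel_measurable_Max borel_measurable_times borel_measurable_indicator) auto
  qed
  have uK: "\<bar>w K\<bar> \<le> u x" if "K \<in> T" "x \<in> K" for K x
    using uge [OF that(1), of x] that(2) by simp
  define M where "M = ((5 / \<kappa>) ^ ?d)\<^sup>2"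
  have M0: "0 \<le> M" by (simp add: M_def)
  define e where "e z = M * root ?d (\<Sum>K | K \<in> T \<and> infdist z K \<le> 4 * h. E K)" for z
  have e_alt: "(\<Sum>K | K \<in> T \<and> infdist z K \<le> 4 * h. E K) = (\<Sum>K\<in>T. E K * indicator {z. infdist z K \<le> 4 * h} z)" for z
    unfolding sum.inter_filter [OF finite_mesh] by (intro sum.cong) (auto simp: indicator_def)
  have near_sets: "{z. infdist z K \<le> 4 * h} \<in> sets borel" for K :: "(real^'n) set"
  proof -
    have "closed {z. infdist z K \<le> 4 * h}"
      by (intro closed_Collect_le continuous_intros)
    then show ?thesis by (rule borel_closed)
  qed
  have emeas: "e \<in> borel_measurable borel"
  proof -
    have sum: "(\<lambda>z. \<Sum>K\<in>T. E K * indicator {z. infdist z K \<le> 4 * h} z) \<in> borel_measurable borel"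
      using near_sets by (intro borel_measurable_sum borel_measurable_times borel_measurable_indicator) auto
    have root: "(root ?d :: real \<Rightarrow> real) \<in> borel_measurable borel"
      by (intro borel_measurable_continuous_onI continuous_intros)
    show ?thesis
      unfolding e_def [abs_def] e_alt
      by (rule borel_measurable_times [OF borel_measurable_const measurable_compose [OF sum root]])
  qed
  have e0: "0 \<le> e z" for z using E(1) M0 by (simp add: e_def sum_nonneg)
  have hardy: "(\<integral>\<^sup>+x\<in>ball 0 \<rho>. ennreal ((u x / norm x) ^ DIM(real^'n)) \<partial>lborel)
    \<le> ennreal ((2 * (1 / h + 1 / (\<kappa> * h)) * ln (1 / (\<kappa> * h))) ^ DIM(real^'n)) * (\<integral>\<^sup>+x. ennreal (e x ^ DIM(real^'n)) \<partial>lborel)"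
  proof (rule critical_hardy_inequality [OF umeas emeas u0 e0])
    show "u x = 0" if "norm x \<le> \<kappa> * h" for x
    proof -
      obtain K where K: "K \<in> T" "u x = \<bar>w K\<bar> * indicator K x" using umem [of x] by blast
      then show ?thesis using w0 [OF K(1) _ that] by (cases "x \<in> K") auto
    qed
    fix x y z :: "real^'n"
    assume xyz: "norm x < \<rho>" "norm y < \<rho>" "dist x y \<le> h" "z \<in> closed_segment y x"
    obtain A where A: "A \<in> T" "u x = \<bar>w A\<bar> * indicator A x" using umem [of x] by blast
    show "u x \<le> u y + e z"
    proof (cases "x \<in> A")
      case True
      have "y \<in> \<Union>T" using ball xyz(2) by (auto simp: subset_eq)
      then obtain B where B: "B \<in> T" "y \<in> B" by blast
      have "\<bar>w A - w B\<bar> \<le> e z"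
        unfolding e_def M_def
        by (rule neighbour_values [OF h ball \<kappa>(1,2) E A(1) True xyz(1) B xyz(2-4)])
      then show ?thesis using uK [OF B] A True by simp
    next
      case False
      then show ?thesis using A u0 [of y] e0 [of z] by simp
    qed
  qed (use h \<kappa> \<rho> in auto)
  have "(\<integral>\<^sup>+z. ennreal (e z ^ ?d) \<partial>lborel) = (\<integral>\<^sup>+z. (\<Sum>K\<in>T. ennreal (M ^ ?d * E K) * indicator {z. infdist z K \<le> 4 * h} z) \<partial>lborel)"
  proof (rule nn_integral_cong)
    fix z
    have "e z ^ ?d = M ^ ?d * (\<Sum>K\<in>T. E K * indicator {z. infdist z K \<le> 4 * h} z)"
      unfolding e_def e_alt
      by (simp add: power_mult_distrib real_root_pow_pos2 sum_nonneg E(1))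
    also have "\<dots> = (\<Sum>K\<in>T. M ^ ?d * E K * indicator {z. infdist z K \<le> 4 * h} z)"
      by (simp add: sum_distrib_left mult.assoc)
    also have "ennreal \<dots> = (\<Sum>K\<in>T. ennreal (M ^ ?d * E K * indicator {z. infdist z K \<le> 4 * h} z))"
      using E(1) M0 by (intro sum_ennreal [symmetric]) auto
    also have "\<dots> = (\<Sum>K\<in>T. ennreal (M ^ ?d * E K) * indicator {z. infdist z K \<le> 4 * h} z)"
      by (intro sum.cong) (auto simp: indicator_def)
    finally show "ennreal (e z ^ ?d) = \<dots>" .
  qed
  also have "\<dots> = (\<Sum>K\<in>T. ennreal (M ^ ?d * E K) * emeasure lborel {z. infdist z K \<le> 4 * h})"
    using near_sets by (subst nn_integral_sum) (auto simp: nn_integral_cmult_indicator)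
  also have "\<dots> \<le> (\<Sum>K\<in>T. ennreal (M ^ ?d * E K) * ennreal (unit_ball_vol (real ?d) * (5 * h) ^ ?d))"
  proof (intro sum_mono mult_left_mono)
    fix K assume K: "K \<in> T"
    have "{z. infdist z K \<le> 4 * h} \<subseteq> cball (c K) (5 * h)"
    proof
      fix z assume z: "z \<in> {z. infdist z K \<le> 4 * h}"
      obtain p where p: "p \<in> K" "dist z p = infdist z K"
        using infdist_attains_inf [OF element(3) element(6)] K by metis
      have "c K \<in> K" using \<kappa> h K by (auto simp: subset_eq)
      then have "dist p (c K) \<le> h"
        using p h(2) [OF K] diameter_bounded_bound [OF compact_imp_bounded [OF element(2) [OF K]], of p "c K"] by simp
      then show "z \<in> cball (c K) (5 * h)"
        using dist_triangle [of z "c K" p] p(2) z by (simp add: dist_commute)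
    qed
    then have "emeasure lborel {z. infdist z K \<le> 4 * h} \<le> emeasure lborel (cball (c K) (5 * h))"
      by (intro emeasure_mono) auto
    then show "emeasure lborel {z. infdist z K \<le> 4 * h} \<le> ennreal (unit_ball_vol (real ?d) * (5 * h) ^ ?d)"
      using h by (simp add: emeasure_cball)
  qed auto
  also have "\<dots> = (\<Sum>K\<in>T. ennreal (M ^ ?d * E K * (unit_ball_vol (real ?d) * (5 * h) ^ ?d)))"
    using E(1) M0 h by (intro sum.cong) (simp_all add: ennreal_mult)
  also have "\<dots> = ennreal (\<Sum>K\<in>T. M ^ ?d * E K * (unit_ball_vol (real ?d) * (5 * h) ^ ?d))"
    using E(1) M0 h by (intro sum_ennreal) auto
  also have "(\<Sum>K\<in>T. M ^ ?d * E K * (unit_ball_vol (real ?d) * (5 * h) ^ ?d))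
     = M ^ ?d * (unit_ball_vol (real ?d) * (5 * h) ^ ?d) * (\<Sum>K\<in>T. E K)"
    unfolding sum_distrib_left by (intro sum.cong) (simp_all only: mult_ac)
  finally have eint: "(\<integral>\<^sup>+z. ennreal (e z ^ ?d) \<partial>lborel) \<le> ennreal (M ^ ?d * (unit_ball_vol (real ?d) * (5 * h) ^ ?d) * (\<Sum>K\<in>T. E K))" .
  define L where "L = ln (1 / (\<kappa> * h))"
  define D where "D = 2 * (1 / h + 1 / (\<kappa> * h)) * L"
  have "0 \<le> L"
    using \<kappa> h unfolding L_def by (intro ln_ge_zero) (simp add: field_simps)
  then have "0 \<le> D" using h \<kappa> by (simp add: D_def)
  have "(\<integral>\<^sup>+x\<in>ball 0 \<rho>. ennreal ((u x / norm x) ^ ?d) \<partial>lborel) \<le> ennreal (D ^ ?d) * (\<integral>\<^sup>+x. ennreal (e x ^ ?d) \<partial>lborel)"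
    using hardy by (simp add: D_def L_def)
  also have "\<dots> \<le> ennreal (D ^ ?d) * ennreal (M ^ ?d * (unit_ball_vol (real ?d) * (5 * h) ^ ?d) * (\<Sum>K\<in>T. E K))"
    by (intro mult_left_mono eint) simp
  also have "\<dots> = ennreal (D ^ ?d * (M ^ ?d * (unit_ball_vol (real ?d) * (5 * h) ^ ?d) * (\<Sum>K\<in>T. E K)))"
    using \<open>0 \<le> D\<close> by (simp add: ennreal_mult')
  also have "D ^ ?d * (M ^ ?d * (unit_ball_vol (real ?d) * (5 * h) ^ ?d) * (\<Sum>K\<in>T. E K))
      = (D * M * (5 * h)) ^ ?d * unit_ball_vol (real ?d) * (\<Sum>K\<in>T. E K)"
    by (simp add: power_mult_distrib mult_ac)
  also have "D * M * (5 * h) = 10 * (1 + 1 / \<kappa>) * M * L"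
    using h \<kappa> by (simp add: D_def field_simps)
  also have "(10 * (1 + 1 / \<kappa>) * M * L) ^ ?d * unit_ball_vol (real ?d) * (\<Sum>K\<in>T. E K)
      = (10 * (1 + 1 / \<kappa>) * M) ^ ?d * unit_ball_vol (real ?d) * L ^ ?d * (\<Sum>K\<in>T. E K)"
    by (simp add: power_mult_distrib mult_ac)
  finally show "(\<integral>\<^sup>+x\<in>ball 0 \<rho>. ennreal ((u x / norm x) ^ CARD('n)) \<partial>lborel)
      \<le> ennreal ((10 * (1 + 1 / \<kappa>) * ((5 / \<kappa>) ^ CARD('n))\<^sup>2) ^ CARD('n) * unit_ball_vol (real CARD('n)) * ln (1 / (\<kappa> * h)) ^ CARD('n) * (\<Sum>K\<in>T. E K))"
    by (simp add: M_def L_def)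
qed

end

text \<open>
  Away from the origin the weight varies on an element only by a bounded factor, because \<open>h\<close> is at most
  \<open>norm x / \<kappa>\<close>. So the integral of the weighted constant \<open>W\<close> over \<open>K\<close> is comparable with
  that over an inner ball, and \<open>b\<close>, the bound for the oscillation, contributes a local term.
\<close>

lemma element_weighted_integral:
  fixes p :: "real^'n \<Rightarrow> real"
  assumes h: "0 < h" and \<kappa>: "0 < \<kappa>" and K: "K \<in> sets borel" "K \<subseteq> cball c h" "ball c (\<kappa> * h / 2) \<subseteq> K"
    and far: "\<And>x. x \<in> K \<Longrightarrow> \<kappa> * h \<le> norm x"
    and p: "\<And>x. x \<in> K \<Longrightarrow> \<bar>p x\<bar> \<le> W + b" and Wb: "0 \<le> W" "0 \<le> b"
  shows "(\<integral>\<^sup>+x\<in>K. ennreal ((\<bar>p x\<bar> / norm x) ^ CARD('n)) \<partial>lborel) \<le>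
     ennreal (2 ^ CARD('n) * (b / \<kappa>) ^ CARD('n) * unit_ball_vol (real CARD('n)))
     + ennreal (2 ^ CARD('n) * ((1 + 1 / \<kappa>)\<^sup>2 * (2 / \<kappa>)) ^ CARD('n)) *
         (\<integral>\<^sup>+x\<in>ball c (\<kappa> * h / 2). ennreal ((W / norm x) ^ CARD('n)) \<partial>lborel)"
proof -
  let ?d = "CARD('n)" and ?\<omega> = "unit_ball_vol (real CARD('n))"
  define k where "k = 1 + 1 / \<kappa>"
  have k: "1 \<le> k" using \<kappa> by (simp add: k_def)
  have \<kappa>h: "0 < \<kappa> * h" using h \<kappa> by simp
  have [measurable]: "ball c (\<kappa> * h / 2) \<in> sets borel" by simp
  have "c \<in> ball c (\<kappa> * h / 2)" using \<kappa>h by simp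
  then have cK: "c \<in> K" using K(3) by blast
  have hle: "h \<le> norm x / \<kappa>" if "x \<in> K" for x using far [OF that] \<kappa> by (simp add: field_simps)
  have cx: "norm c \<le> k * norm x" and xc: "norm x \<le> k * norm c" if x: "x \<in> K" for x
  proof -
    have "norm (c - x) \<le> h" using K(2) x by (auto simp: dist_norm)
    then have "norm c \<le> norm x + h" "norm x \<le> norm c + h"
      using norm_triangle_sub [of c x] norm_triangle_sub [of x c] by (auto simp: norm_minus_commute)
    then show "norm c \<le> k * norm x" "norm x \<le> k * norm c"
      using hle [OF x] hle [OF cK] by (auto simp: k_def algebra_simps)
  qed
  define m where "m = W / norm c"
  have c0: "0 < norm c" using far [OF cK] \<kappa>h by linarith
  have m0: "0 \<le> m" using Wb by (simp add: m_def)
  have pt: "(\<bar>p x\<bar> / norm x) ^ ?d \<le> 2 ^ ?d * ((k * m) ^ ?d + (b / (\<kappa> * h)) ^ ?d)" if x: "x \<in> K" for x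
  proof -
    have x0: "0 < norm x" using far [OF x] \<kappa>h by linarith
    have "\<bar>p x\<bar> / norm x \<le> W / norm x + b / norm x"
      using p [OF x] x0 by (simp add: add_divide_distrib [symmetric] divide_right_mono)
    also have "\<dots> \<le> k * m + b / (\<kappa> * h)"
    proof (rule add_mono)
      have "W * norm c \<le> W * (k * norm x)" using cx [OF x] Wb by (intro mult_left_mono) auto
      then show "W / norm x \<le> k * m" using x0 c0 by (simp add: m_def divide_simps mult_ac)
      show "b / norm x \<le> b / (\<kappa> * h)" using far [OF x] Wb mult_pos_pos [OF x0 \<kappa>h] by (intro divide_left_mono) auto
    qed
    finally have "(\<bar>p x\<bar> / norm x) ^ ?d \<le> (\<Sum>i\<in>{True, False}. if i then k * m else b / (\<kappa> * h)) ^ ?d"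
      by (intro power_mono) auto
    also have "\<dots> \<le> real (card {True, False}) ^ ?d * (\<Sum>i\<in>{True, False}. (if i then k * m else b / (\<kappa> * h)) ^ ?d)"
      using k m0 \<kappa>h Wb by (intro power_sum_le) auto
    finally show ?thesis by simp
  qed
  define J where "J = (\<integral>\<^sup>+x\<in>ball c (\<kappa> * h / 2). ennreal ((W / norm x) ^ ?d) \<partial>lborel)"
  have "ennreal (m ^ ?d) * ennreal (?\<omega> * (\<kappa> * h / 2) ^ ?d) = (\<integral>\<^sup>+x\<in>ball c (\<kappa> * h / 2). ennreal (m ^ ?d) \<partial>lborel)"
    using \<kappa>h by (subst nn_integral_cmult_indicator) (auto simp: emeasure_ball)
  also have "\<dots> \<le> (\<integral>\<^sup>+x. ennreal (k ^ ?d) * (ennreal ((W / norm x) ^ ?d) * indicator (ball c (\<kappa> * h / 2)) x) \<partial>lborel)"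
  proof (rule nn_integral_mono)
    fix x
    have "m ^ ?d \<le> k ^ ?d * (W / norm x) ^ ?d" if "x \<in> ball c (\<kappa> * h / 2)"
    proof -
      have x: "x \<in> K" using that K(3) by blast
      have x0: "0 < norm x" using far [OF x] \<kappa>h by linarith
      have "W * norm x \<le> W * (k * norm c)" using xc [OF x] Wb by (intro mult_left_mono) auto
      then have "m \<le> k * (W / norm x)" using x0 c0 by (simp add: m_def divide_simps mult_ac)
      then have "m ^ ?d \<le> (k * (W / norm x)) ^ ?d" using m0 by (rule power_mono)
      then show ?thesis by (simp only: power_mult_distrib)
    qed
    then show "ennreal (m ^ ?d) * indicator (ball c (\<kappa> * h / 2)) x
       \<le> ennreal (k ^ ?d) * (ennreal ((W / norm x) ^ ?d) * indicator (ball c (\<kappa> * h / 2)) x)"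
      using k by (auto simp: indicator_def ennreal_mult' [symmetric] intro!: ennreal_leI)
  qed
  also have "\<dots> = ennreal (k ^ ?d) * (\<integral>\<^sup>+x\<in>ball c (\<kappa> * h / 2). ennreal ((W / norm x) ^ ?d) \<partial>lborel)"
    by (rule nn_integral_cmult) measurable
  finally have mJ: "ennreal (m ^ ?d) * ennreal (?\<omega> * (\<kappa> * h / 2) ^ ?d) \<le> ennreal (k ^ ?d) * J"
    by (simp only: J_def)
  have kJ: "ennreal (2 ^ ?d * (k * (2 / \<kappa>)) ^ ?d) * (ennreal (k ^ ?d) * J) = ennreal (2 ^ ?d * (k\<^sup>2 * (2 / \<kappa>)) ^ ?d) * J"
  proof -
    have "2 ^ ?d * (k * (2 / \<kappa>)) ^ ?d * k ^ ?d = 2 ^ ?d * (k\<^sup>2 * (2 / \<kappa>)) ^ ?d"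
      by (simp only: power_mult_distrib power2_eq_square mult_ac)
    then show ?thesis using k \<kappa> by (simp only: mult.assoc [symmetric] ennreal_mult'' [symmetric] zero_le_power)
  qed
  have "(\<integral>\<^sup>+x\<in>K. ennreal ((\<bar>p x\<bar> / norm x) ^ ?d) \<partial>lborel)
     \<le> (\<integral>\<^sup>+x\<in>cball c h. ennreal (2 ^ ?d * ((k * m) ^ ?d + (b / (\<kappa> * h)) ^ ?d)) \<partial>lborel)"
    using K(2) by (intro nn_integral_mono) (auto simp: indicator_def intro!: ennreal_leI pt)
  also have "\<dots> = ennreal (2 ^ ?d * ((k * m) ^ ?d + (b / (\<kappa> * h)) ^ ?d)) * ennreal (?\<omega> * h ^ ?d)"
    using h by (subst nn_integral_cmult_indicator) (auto simp: emeasure_cball)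
  also have "\<dots> = ennreal (2 ^ ?d * (k * m) ^ ?d * (?\<omega> * h ^ ?d) + 2 ^ ?d * (b / (\<kappa> * h)) ^ ?d * (?\<omega> * h ^ ?d))"
    using h by (subst ennreal_mult'' [symmetric]) (auto simp: algebra_simps)
  also have "\<dots> = ennreal (2 ^ ?d * (k * m) ^ ?d * (?\<omega> * h ^ ?d)) + ennreal (2 ^ ?d * (b / (\<kappa> * h)) ^ ?d * (?\<omega> * h ^ ?d))"
    using h k m0 \<kappa> Wb by (intro ennreal_plus) auto
  also have "2 ^ ?d * (b / (\<kappa> * h)) ^ ?d * (?\<omega> * h ^ ?d) = 2 ^ ?d * (b / \<kappa>) ^ ?d * ?\<omega>"
    using h by (simp add: power_divide power_mult_distrib)
  also have "ennreal (2 ^ ?d * (k * m) ^ ?d * (?\<omega> * h ^ ?d))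
     = ennreal (2 ^ ?d * (k * (2 / \<kappa>)) ^ ?d) * (ennreal (m ^ ?d) * ennreal (?\<omega> * (\<kappa> * h / 2) ^ ?d))"
    using h k m0 \<kappa> by (simp add: ennreal_mult' [symmetric] power_mult_distrib power_divide)
  also have "ennreal (2 ^ ?d * (k * (2 / \<kappa>)) ^ ?d) * (ennreal (m ^ ?d) * ennreal (?\<omega> * (\<kappa> * h / 2) ^ ?d))
        + ennreal (2 ^ ?d * (b / \<kappa>) ^ ?d * ?\<omega>)
      \<le> ennreal (2 ^ ?d * (k * (2 / \<kappa>)) ^ ?d) * (ennreal (k ^ ?d) * J) + ennreal (2 ^ ?d * (b / \<kappa>) ^ ?d * ?\<omega>)"
    by (intro add_right_mono mult_left_mono mJ) simp
  also have "\<dots> = ennreal (2 ^ ?d * (b / \<kappa>) ^ ?d * ?\<omega>) + ennreal (2 ^ ?d * (k\<^sup>2 * (2 / \<kappa>)) ^ ?d) * J"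
    unfolding kJ by (rule add.commute)
  finally show ?thesis by (simp only: k_def J_def)
qed

section \<open>Piecewise polynomials\<close>

text \<open>
  \<open>\<kappa>\<close> is the ratio of inscribed radius and mesh size, \<open>q\<close> the constant in the bound of the
  oscillation on an element, \<open>L\<close> the logarithm. The first two terms come from the oscillation on the elements
  away from the origin and at the origin, the last one from the Hardy inequality for the constants.
\<close>

definition hardy_const :: "nat \<Rightarrow> real \<Rightarrow> real \<Rightarrow> real \<Rightarrow> real" where
  "hardy_const d \<kappa> q L =
     2 ^ d * (q / \<kappa>) ^ d * unit_ball_vol (real d) + q ^ d * unit_ball_vol (real d) +
     2 ^ d * ((1 + 1 / \<kappa>)\<^sup>2 * (2 / \<kappa>)) ^ d *
       ((10 * (1 + 1 / \<kappa>) * ((5 / \<kappa>) ^ d)\<^sup>2) ^ d * unit_ball_vol (real d) * L ^ d * (3 ^ d * (q ^ d + 2)))"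

context simplicial_mesh
begin

lemma interior_face_cases:
  assumes "F \<in> interior_faces T"
  obtains A B where "A \<in> T" "B \<in> T" "A \<noteq> B" "F = A \<inter> B" "F facet_of A" "F facet_of B"
proof -
  obtain A B where AB: "A \<in> T" "B \<in> T" "A \<noteq> B" "F facet_of A" "F facet_of B"
    using assms by (auto simp: interior_faces_def)
  have "F = A \<inter> B"
    by (rule facet_eq_proper_face [OF AB(1,4) Int_face(1) Int_proper])
       (use AB facet_of_imp_subset in auto)
  then show thesis using that AB by blast
qed

lemma finite_interior_faces: "finite (interior_faces T)"
proof -
  have "interior_faces T \<subseteq> (\<lambda>(A, B). A \<inter> B) ` (T \<times> T)"
    by (auto elim!: interior_face_cases)
  then show ?thesis using finite_mesh by (meson finite_SigmaI finite_imageI finite_subset)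
qed

lemma sum_interior_faces:
  fixes b :: "(real^'n) set \<Rightarrow> real"
  shows "(\<Sum>K\<in>T. \<Sum>F | F \<in> interior_faces T \<and> F facet_of K. b F) = 2 * (\<Sum>F\<in>interior_faces T. b F)"
proof -
  have "(\<Sum>K\<in>T. \<Sum>F | F \<in> interior_faces T \<and> F facet_of K. b F) = (\<Sum>F\<in>interior_faces T. \<Sum>K | K \<in> T \<and> F facet_of K. b F)"
    by (rule sum.swap_restrict [OF finite_mesh finite_interior_faces])
  also have "\<dots> = (\<Sum>F\<in>interior_faces T. 2 * b F)"
  proof (rule sum.cong)
    fix F assume "F \<in> interior_faces T"
    then obtain A B where "A \<in> T" "B \<in> T" "A \<noteq> B" "F facet_of A" "F facet_of B"
      by (rule interior_face_cases)
    then have "{K \<in> T. F facet_of K} = {A, B}" "A \<noteq> B" using common_facet_only_two by auto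
    then show "(\<Sum>K | K \<in> T \<and> F facet_of K. b F) = 2 * b F" by simp
  qed simp
  finally show ?thesis by (simp add: sum_distrib_left)
qed

text \<open>
  The supremum is over a continuous function on a compact facet, hence finite.
\<close>

lemma jump_le_SUP:
  assumes A: "A \<in> T" "F facet_of A" and B: "B \<in> T" "F facet_of B" and "A \<noteq> B"
    and cont: "continuous_on UNIV (g A)" "continuous_on UNIV (g B)" and "x \<in> F"
  shows "\<bar>g A x - g B x\<bar> \<le> (SUP x\<in>F. norm (jump T g F x))"
proof -
  have eq: "norm (jump T g F y) = \<bar>g A y - g B y\<bar>" for y
    by (rule norm_jump [OF A B \<open>A \<noteq> B\<close>])
  have "compact F" using A element(1,2) facet_of_imp_face_of face_of_imp_compact by blast
  moreover have "continuous_on F (\<lambda>y. \<bar>g A y - g B y\<bar>)"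
    by (intro continuous_intros continuous_on_subset [OF cont(1)] continuous_on_subset [OF cont(2)]) auto
  ultimately have "compact ((\<lambda>y. \<bar>g A y - g B y\<bar>) ` F)" by (intro compact_continuous_image)
  then have "bdd_above ((\<lambda>y. norm (jump T g F y)) ` F)"
    unfolding eq by (intro bounded_imp_bdd_above compact_imp_bounded)
  then show ?thesis unfolding eq [symmetric] using \<open>x \<in> F\<close> by (intro cSUP_upper)
qed

lemma jump_SUP_nonneg:
  assumes "F \<in> interior_faces T" "\<And>K. K \<in> T \<Longrightarrow> continuous_on UNIV (g K)"
  shows "0 \<le> (SUP x\<in>F. norm (jump T g F x))"
proof -
  obtain A B where AB: "A \<in> T" "B \<in> T" "A \<noteq> B" "F facet_of A" "F facet_of B"
    using interior_face_cases [OF assms(1)] by metis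
  obtain x where "x \<in> F" using AB(4) by (auto simp: facet_of_def)
  then have "\<bar>g A x - g B x\<bar> \<le> (SUP x\<in>F. norm (jump T g F x))"
    using AB assms(2) by (intro jump_le_SUP) auto
  then show ?thesis by linarith
qed

text \<open>
  Split \<open>g K\<close> into the constant \<open>w K\<close> and its oscillation. On elements at the origin \<open>w K = 0\<close>, and
  the weight is compensated by \<open>g K 0 = 0\<close> and the Lipschitz bound. The energy \<open>E K\<close> of an element consists
  of its gradient and of the jumps on its faces. Every interior face belongs to two elements, so the energies
  add up to a multiple of \<open>S\<close>.
\<close>

lemma weighted_estimate:
  fixes g :: "(real^'n) set \<Rightarrow> real^'n \<Rightarrow> real"
  defines "S \<equiv> (\<Sum>K\<in>T. Lp_norm (real CARD('n)) K (grad (g K)) ^ CARD('n))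
    + (\<Sum>F\<in>interior_faces T. (SUP x\<in>F. norm (jump T g F x)) ^ CARD('n))"
  assumes h: "0 < h" "\<And>K. K \<in> T \<Longrightarrow> diameter K \<le> h" and ball: "ball 0 \<rho> \<subseteq> \<Union>T" and \<rho>: "\<rho> \<le> 1" "\<kappa> * h < \<rho>"
    and \<kappa>: "0 < \<kappa>" "\<And>K. K \<in> T \<Longrightarrow> cball (c K) (\<kappa> * h) \<subseteq> K" "\<kappa> * h \<le> 1 / 2"
    and inner: "\<And>K. K \<in> T \<Longrightarrow> ball (c K) (\<kappa> * h / 2) \<subseteq> ball 0 \<rho>"
    and ext: "\<And>K. \<lbrakk>K \<in> T; 0 \<in> K\<rbrakk> \<Longrightarrow> 0 extreme_point_of K" and T: "T \<noteq> {}"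
    and g: "\<And>K. K \<in> T \<Longrightarrow> g K \<in> poly_space r" and g0: "\<And>K. \<lbrakk>K \<in> T; 0 \<in> K\<rbrakk> \<Longrightarrow> g K 0 = 0"
    and Q: "1 \<le> Q" "\<And>(p :: real^'n \<Rightarrow> real) K c s x y. \<lbrakk>p \<in> poly_space r; convex K; compact K; 0 < s; cball c s \<subseteq> K; x \<in> K; y \<in> K\<rbrakk>
       \<Longrightarrow> \<bar>p x - p y\<bar> \<le> Q / s * Lp_norm (real CARD('n)) K (grad p) * dist x y"
  shows "(\<Sum>K\<in>T. \<integral>\<^sup>+x\<in>K. ennreal ((\<bar>g K x\<bar> / norm x) ^ CARD('n)) \<partial>lborel)
     \<le> ennreal (hardy_const CARD('n) \<kappa> (Q / \<kappa>) (ln (1 / (\<kappa> * h))) * S)"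
proof -
  let ?d = "CARD('n)" and ?\<omega> = "unit_ball_vol (real CARD('n))"
  define a where "a K = Lp_norm (real ?d) K (grad (g K))" for K
  define b where "b F = (SUP x\<in>F. norm (jump T g F x))" for F
  define q where "q = Q / \<kappa>"
  define w where "w K = (if 0 \<in> K then 0 else g K (c K))" for K
  define E where "E K = 3 ^ ?d * ((q * a K) ^ ?d + (\<Sum>F | F \<in> interior_faces T \<and> F facet_of K. b F ^ ?d))" for K
  define u where "u = (\<lambda>x. Max ((\<lambda>K. \<bar>w K\<bar> * indicator K x) ` T))"
  define L where "L = ln (1 / (\<kappa> * h))"
  define P where "P = (10 * (1 + 1 / \<kappa>) * ((5 / \<kappa>) ^ ?d)\<^sup>2) ^ ?d * ?\<omega>"
  define A2 where "A2 = 2 ^ ?d * ((1 + 1 / \<kappa>)\<^sup>2 * (2 / \<kappa>)) ^ ?d"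
  have \<kappa>h: "0 < \<kappa> * h" using h \<kappa> by simp
  have L0: "0 \<le> L" using \<kappa> \<kappa>h unfolding L_def by (intro ln_ge_zero) (simp add: field_simps)
  have P0: "0 \<le> P" "0 \<le> A2" using \<kappa> by (simp_all add: P_def A2_def)
  have q0: "0 \<le> q" using Q \<kappa> by (simp add: q_def)
  have a0: "0 \<le> a K" for K by (simp add: a_def Lp_norm_nonneg)
  have cont: "continuous_on UNIV (g K)" if "K \<in> T" for K
    using g [OF that] by (rule poly_space_continuous)
  have b0: "0 \<le> b F" if "F \<in> interior_faces T" for F
    unfolding b_def using that cont by (rule jump_SUP_nonneg)
  have b0': "0 \<le> b F ^ ?d" if "F \<in> interior_faces T" for F
    using b0 [OF that] by simp
  have cK: "c K \<in> K" if "K \<in> T" for K using \<kappa>(2) [OF that] \<kappa>h by (auto simp: subset_eq)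
  have diam: "dist x y \<le> h" if "K \<in> T" "x \<in> K" "y \<in> K" for K x y
    using h(2) [OF that(1)] diameter_bounded_bound [OF compact_imp_bounded [OF element(2) [OF that(1)]] that(2,3)] by simp
  have lip: "\<bar>g K x - g K y\<bar> \<le> Q / (\<kappa> * h) * a K * dist x y" if "K \<in> T" "x \<in> K" "y \<in> K" for K x y
    unfolding a_def
    by (rule Q(2) [OF g [OF that(1)] element(1,2) [OF that(1)] \<kappa>h \<kappa>(2) [OF that(1)] that(2,3)])
  have osc: "\<bar>g K x - g K y\<bar> \<le> q * a K" if "K \<in> T" "x \<in> K" "y \<in> K" for K x y
  proof -
    have "\<bar>g K x - g K y\<bar> \<le> Q / (\<kappa> * h) * a K * h"
      using lip [OF that] diam [OF that] a0 Q \<kappa>h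
      by (meson divide_nonneg_pos mult_left_mono mult_nonneg_nonneg order.trans zero_le_one)
    then show ?thesis using h by (simp add: q_def)
  qed
  have oscw: "\<bar>g K x - w K\<bar> \<le> q * a K" if "K \<in> T" "x \<in> K" for K x
    using osc [OF that, of 0] osc [OF that cK [OF that(1)]] g0 [OF that(1)] by (auto simp: w_def)
  have far: "\<kappa> * h < norm x" if "K \<in> T" "0 \<notin> K" "x \<in> K" for K x
  proof (cases "norm x < \<rho>")
    case True
    have "2 * (\<kappa> * h) \<le> norm x"
      by (rule distance_from_vertex [OF ball ext \<kappa>h \<kappa>(2) that True])
    then show ?thesis using \<kappa>h by linarith
  qed (use \<rho> in linarith)
  have fin: "finite {F. F \<in> interior_faces T \<and> F facet_of K}" for K
    using finite_interior_faces by simp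
  have E0: "0 \<le> E K" for K
    using q0 a0 [of K] b0' by (auto simp: E_def intro!: mult_nonneg_nonneg add_nonneg_nonneg sum_nonneg)
  have Eadj: "\<bar>w A - w B\<bar> ^ ?d \<le> E A + E B" if "(A, B) \<in> adjacent" for A B
  proof -
    have AB: "A \<in> T" "B \<in> T" "A \<noteq> B" "A \<inter> B facet_of A" "A \<inter> B facet_of B"
      using that by (auto simp: adjacent_def)
    define F where "F = A \<inter> B"
    have F: "F \<in> interior_faces T" "F facet_of A" "F facet_of B"
      using AB by (auto simp: F_def interior_faces_def)
    obtain x where x: "x \<in> F" using F(2) by (auto simp: facet_of_def)
    then have xAB: "x \<in> A" "x \<in> B" by (auto simp: F_def)
    have "\<bar>g A x - g B x\<bar> \<le> b F"
      unfolding b_def using AB F x cont by (intro jump_le_SUP) auto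
    moreover have "\<bar>g A x - w A\<bar> \<le> q * a A" "\<bar>g B x - w B\<bar> \<le> q * a B" using oscw AB xAB by auto
    moreover define v where "v i = (if i = 0 then q * a A else if i = 1 then q * a B else b F)" for i :: nat
    have "(\<Sum>i<3. v i) = q * a A + q * a B + b F" "(\<Sum>i<3. v i ^ ?d) = (q * a A) ^ ?d + (q * a B) ^ ?d + b F ^ ?d"
      by (simp_all add: v_def eval_nat_numeral)
    ultimately have "\<bar>w A - w B\<bar> ^ ?d \<le> (\<Sum>i<3. v i) ^ ?d" by (intro power_mono) auto
    also have "\<dots> \<le> real (card {..<3::nat}) ^ ?d * (\<Sum>i<3. v i ^ ?d)"
      using q0 a0 b0 [OF F(1)] by (intro power_sum_le) (auto simp: v_def)
    also have "\<dots> = 3 ^ ?d * ((q * a A) ^ ?d + (q * a B) ^ ?d + b F ^ ?d)"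
      using \<open>(\<Sum>i<3. v i ^ ?d) = _\<close> by simp
    also have "\<dots> \<le> 3 ^ ?d * ((q * a A) ^ ?d + (q * a B) ^ ?d +
        ((\<Sum>F | F \<in> interior_faces T \<and> F facet_of A. b F ^ ?d) + (\<Sum>F | F \<in> interior_faces T \<and> F facet_of B. b F ^ ?d)))"
    proof (intro mult_left_mono add_left_mono)
      have "b F ^ ?d \<le> (\<Sum>F | F \<in> interior_faces T \<and> F facet_of A. b F ^ ?d)"
        using fin F b0' by (intro member_le_sum) auto
      moreover have "0 \<le> (\<Sum>F | F \<in> interior_faces T \<and> F facet_of B. b F ^ ?d)"
        using b0' by (intro sum_nonneg) auto
      ultimately show "b F ^ ?d \<le> (\<Sum>F | F \<in> interior_faces T \<and> F facet_of A. b F ^ ?d) + (\<Sum>F | F \<in> interior_faces T \<and> F facet_of B. b F ^ ?d)"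
        by linarith
    qed simp
    also have "\<dots> = E A + E B" by (simp add: E_def algebra_simps)
    finally show ?thesis .
  qed
  have w0: "w K = 0" if "K \<in> T" "x \<in> K" "norm x \<le> \<kappa> * h" for K x
    using far [OF that(1) _ that(2)] that(3) by (auto simp: w_def)
  have wu: "\<bar>w K\<bar> \<le> u x" if "K \<in> T" "x \<in> K" for K x
    unfolding u_def using finite_mesh that by (intro Max_ge) (auto intro!: rev_image_eqI [of K])
  have hardy: "(\<integral>\<^sup>+x\<in>ball 0 \<rho>. ennreal ((u x / norm x) ^ ?d) \<partial>lborel) \<le> ennreal (P * L ^ ?d * (\<Sum>K\<in>T. E K))"
    unfolding u_def L_def P_def
    by (rule piecewise_constant_hardy [OF h ball \<rho>(1) \<kappa> E0 Eadj w0 T])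
  have sumE: "(\<Sum>K\<in>T. E K) \<le> 3 ^ ?d * (q ^ ?d + 2) * S"
  proof -
    have "(\<Sum>K\<in>T. E K) = 3 ^ ?d * (q ^ ?d * (\<Sum>K\<in>T. a K ^ ?d) + 2 * (\<Sum>F\<in>interior_faces T. b F ^ ?d))"
      unfolding E_def sum_interior_faces [symmetric]
      by (simp add: sum_distrib_left [symmetric] sum.distrib power_mult_distrib)
    also have "\<dots> \<le> 3 ^ ?d * ((q ^ ?d + 2) * S)"
    proof (rule mult_left_mono)
      have "0 \<le> (\<Sum>K\<in>T. a K ^ ?d)" "0 \<le> (\<Sum>F\<in>interior_faces T. b F ^ ?d)"
        using a0 b0' by (auto intro!: sum_nonneg)
      moreover have "S = (\<Sum>K\<in>T. a K ^ ?d) + (\<Sum>F\<in>interior_faces T. b F ^ ?d)"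
        by (simp add: S_def a_def b_def)
      ultimately show "q ^ ?d * (\<Sum>K\<in>T. a K ^ ?d) + 2 * (\<Sum>F\<in>interior_faces T. b F ^ ?d) \<le> (q ^ ?d + 2) * S"
        using q0 by (simp add: distrib_left distrib_right)
    qed simp
    finally show ?thesis by (simp add: mult.assoc)
  qed
  have aS: "(\<Sum>K\<in>T. a K ^ ?d) \<le> S"
    using b0' by (simp add: S_def a_def b_def sum_nonneg)
  define c1 where "c1 = 2 ^ ?d * (q / \<kappa>) ^ ?d * ?\<omega> + q ^ ?d * ?\<omega>"
  have c10: "0 \<le> c1" using q0 \<kappa> by (simp add: c1_def)
  define J where "J K = (\<integral>\<^sup>+x\<in>ball (c K) (\<kappa> * h / 2). ennreal ((\<bar>w K\<bar> / norm x) ^ ?d) \<partial>lborel)" for K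
  have Kle: "(\<integral>\<^sup>+x\<in>K. ennreal ((\<bar>g K x\<bar> / norm x) ^ ?d) \<partial>lborel) \<le> ennreal (c1 * a K ^ ?d) + ennreal A2 * J K"
    if K: "K \<in> T" for K
  proof -
    have Kb: "K \<in> sets borel" using element(3) [OF K] by simp
    have Kc: "K \<subseteq> cball (c K) h" using diam [OF K cK [OF K]] by auto
    show ?thesis
    proof (cases "0 \<in> K")
      case True
      have pt: "(\<bar>g K x\<bar> / norm x) ^ ?d \<le> (q / h * a K) ^ ?d" if "x \<in> K" for x
      proof (rule power_mono)
        have "\<bar>g K x\<bar> \<le> q / h * a K * norm x"
          using lip [OF K that True] g0 [OF K True] by (simp add: q_def)
        then show "\<bar>g K x\<bar> / norm x \<le> q / h * a K"
          using q0 a0 [of K] h by (cases "x = 0") (auto simp: divide_le_eq)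
      qed simp
      have "(\<integral>\<^sup>+x\<in>K. ennreal ((\<bar>g K x\<bar> / norm x) ^ ?d) \<partial>lborel) \<le> (\<integral>\<^sup>+x\<in>cball (c K) h. ennreal ((q / h * a K) ^ ?d) \<partial>lborel)"
        using Kc pt by (intro nn_integral_mono) (auto simp: indicator_def intro!: ennreal_leI)
      also have "\<dots> = ennreal ((q / h * a K) ^ ?d) * ennreal (?\<omega> * h ^ ?d)"
        using h by (subst nn_integral_cmult_indicator) (auto simp: emeasure_cball)
      also have "\<dots> = ennreal ((q / h * a K) ^ ?d * (?\<omega> * h ^ ?d))"
        using h by (subst ennreal_mult'') auto
      also have "(q / h * a K) ^ ?d * (?\<omega> * h ^ ?d) = q ^ ?d * ?\<omega> * a K ^ ?d"
        using h by (simp add: power_mult_distrib power_divide)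
      also have "ennreal (q ^ ?d * ?\<omega> * a K ^ ?d) \<le> ennreal (c1 * a K ^ ?d)"
        using a0 [of K] q0 \<kappa> by (intro ennreal_leI mult_right_mono) (auto simp: c1_def)
      also have "\<dots> \<le> ennreal (c1 * a K ^ ?d) + ennreal A2 * J K" by simp
      finally show ?thesis .
    next
      case False
      have "(\<integral>\<^sup>+x\<in>K. ennreal ((\<bar>g K x\<bar> / norm x) ^ ?d) \<partial>lborel) \<le> ennreal (2 ^ ?d * (q * a K / \<kappa>) ^ ?d * ?\<omega>) + ennreal A2 * J K"
        unfolding A2_def J_def
      proof (rule element_weighted_integral [OF h(1) \<kappa>(1) Kb Kc])
        have "ball (c K) (\<kappa> * h / 2) \<subseteq> cball (c K) (\<kappa> * h)" using \<kappa>h by (auto simp: subset_eq)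
        then show "ball (c K) (\<kappa> * h / 2) \<subseteq> K" using \<kappa>(2) [OF K] by blast
        show "\<kappa> * h \<le> norm x" if "x \<in> K" for x using far [OF K False that] by simp
        show "\<bar>g K x\<bar> \<le> \<bar>w K\<bar> + q * a K" if "x \<in> K" for x using oscw [OF K that] by linarith
      qed (use q0 a0 in auto)
      moreover have "2 ^ ?d * (q * a K / \<kappa>) ^ ?d * ?\<omega> \<le> c1 * a K ^ ?d"
      proof -
        have "2 ^ ?d * (q * a K / \<kappa>) ^ ?d * ?\<omega> = 2 ^ ?d * (q / \<kappa>) ^ ?d * ?\<omega> * a K ^ ?d"
          by (simp add: power_mult_distrib power_divide)
        also have "\<dots> \<le> c1 * a K ^ ?d" using q0 a0 [of K] by (intro mult_right_mono) (auto simp: c1_def)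
        finally show ?thesis .
      qed
      ultimately show ?thesis by (meson add_right_mono ennreal_leI order.trans)
    qed
  qed
  have Jsum: "(\<Sum>K\<in>T. J K) \<le> (\<integral>\<^sup>+x\<in>ball 0 \<rho>. ennreal ((u x / norm x) ^ ?d) \<partial>lborel)"
  proof -
    have bm: "ball (c K) (\<kappa> * h / 2) \<in> sets borel" for K by simp
    have "(\<Sum>K\<in>T. J K) = (\<integral>\<^sup>+x. (\<Sum>K\<in>T. ennreal ((\<bar>w K\<bar> / norm x) ^ ?d) * indicator (ball (c K) (\<kappa> * h / 2)) x) \<partial>lborel)"
      unfolding J_def using bm by (subst nn_integral_sum) (auto intro!: borel_measurable_times_ennreal borel_measurable_indicator)
    also have "\<dots> \<le> (\<integral>\<^sup>+x\<in>ball 0 \<rho>. ennreal ((u x / norm x) ^ ?d) \<partial>lborel)"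
    proof (rule nn_integral_mono)
      fix x
      let ?t = "\<lambda>K. ennreal ((\<bar>w K\<bar> / norm x) ^ ?d) * indicator (ball (c K) (\<kappa> * h / 2)) x"
      \<comment> \<open>the inner balls are disjoint, so at most one term is nonzero\<close>
      show "(\<Sum>K\<in>T. ?t K) \<le> ennreal ((u x / norm x) ^ ?d) * indicator (ball 0 \<rho>) x"
      proof (cases "\<exists>K\<in>T. x \<in> ball (c K) (\<kappa> * h / 2)")
        case True
        then obtain K where K: "K \<in> T" "x \<in> ball (c K) (\<kappa> * h / 2)" by blast
        have int: "ball (c K') (\<kappa> * h / 2) \<subseteq> interior K'" if "K' \<in> T" for K'
        proof (rule interior_maximal)
          have "ball (c K') (\<kappa> * h / 2) \<subseteq> cball (c K') (\<kappa> * h)" using \<kappa>h by (auto simp: subset_eq)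
          then show "ball (c K') (\<kappa> * h / 2) \<subseteq> K'" using \<kappa>(2) [OF that] by blast
        qed simp
        have only: "x \<notin> ball (c K') (\<kappa> * h / 2)" if "K' \<in> T" "K' \<noteq> K" for K'
          using int [OF that(1)] int [OF K(1)] K(2) Int_interior_empty [OF that(1) K(1) that(2)] interior_subset by blast
        have "(\<Sum>K\<in>T. ?t K) = ?t K + (\<Sum>K\<in>T - {K}. ?t K)" using finite_mesh K(1) by (rule sum.remove)
        also have "(\<Sum>K\<in>T - {K}. ?t K) = 0" using only by (intro sum.neutral) auto
        also have "?t K + 0 \<le> ennreal ((u x / norm x) ^ ?d)"
        proof -
          have "x \<in> K" using int [OF K(1)] K(2) interior_subset by blast
          then have "\<bar>w K\<bar> / norm x \<le> u x / norm x" using wu [OF K(1)] by (intro divide_right_mono) auto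
          then show ?thesis using K(2) by (auto intro!: ennreal_leI power_mono)
        qed
        finally show ?thesis using inner [OF K(1)] K(2) by auto
      next
        case False
        then have "(\<Sum>K\<in>T. ?t K) = 0" by (intro sum.neutral) auto
        then show ?thesis by simp
      qed
    qed
    finally show ?thesis .
  qed
  have S0: "0 \<le> S" using aS a0 by (meson order.trans sum_nonneg zero_le_power)
  have "(\<Sum>K\<in>T. \<integral>\<^sup>+x\<in>K. ennreal ((\<bar>g K x\<bar> / norm x) ^ ?d) \<partial>lborel) \<le> (\<Sum>K\<in>T. ennreal (c1 * a K ^ ?d) + ennreal A2 * J K)"
    by (intro sum_mono Kle)
  also have "\<dots> = ennreal (c1 * (\<Sum>K\<in>T. a K ^ ?d)) + ennreal A2 * (\<Sum>K\<in>T. J K)"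
    using c10 a0 by (simp add: sum.distrib sum_ennreal sum_distrib_left)
  also have "\<dots> \<le> ennreal (c1 * S) + ennreal A2 * ennreal (P * L ^ ?d * (3 ^ ?d * (q ^ ?d + 2) * S))"
  proof (intro add_mono mult_left_mono ennreal_leI)
    show "(\<Sum>K\<in>T. a K ^ ?d) \<le> S" by (rule aS)
    have "(\<Sum>K\<in>T. J K) \<le> ennreal (P * L ^ ?d * (\<Sum>K\<in>T. E K))" by (rule order.trans [OF Jsum hardy])
    also have "\<dots> \<le> ennreal (P * L ^ ?d * (3 ^ ?d * (q ^ ?d + 2) * S))"
      using P0 L0 by (intro ennreal_leI mult_left_mono sumE) auto
    finally show "(\<Sum>K\<in>T. J K) \<le> \<dots>" .
  qed (use c10 in auto)
  also have "\<dots> = ennreal (c1 * S + A2 * (P * L ^ ?d * (3 ^ ?d * (q ^ ?d + 2) * S)))"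
    unfolding ennreal_mult' [OF P0(2), symmetric]
    using c10 S0 P0 L0 q0 by (intro ennreal_plus [symmetric]) auto
  also have "c1 * S + A2 * (P * L ^ ?d * (3 ^ ?d * (q ^ ?d + 2) * S)) = hardy_const ?d \<kappa> q L * S"
  proof -
    have "hardy_const ?d \<kappa> q L = c1 + A2 * (P * L ^ ?d * (3 ^ ?d * (q ^ ?d + 2)))"
      by (simp only: hardy_const_def c1_def A2_def P_def)
    then show ?thesis by (simp only: distrib_right mult.assoc)
  qed
  finally show ?thesis by (simp add: q_def L_def)
qed

end

text \<open>
  The terms without logarithm are absorbed because \<open>m * l\<close> is at least 1.
\<close>

lemma hardy_const_le:
  assumes "0 \<le> q" "0 < \<kappa>" "0 \<le> L" "L \<le> m * l" "1 \<le> m * l"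
  shows "hardy_const d \<kappa> q L \<le> hardy_const d \<kappa> q 1 * (m * l) ^ d"
proof -
  let ?A = "2 ^ d * (q / \<kappa>) ^ d * unit_ball_vol (real d) + q ^ d * unit_ball_vol (real d)"
  define B where "B = 2 ^ d * ((1 + 1 / \<kappa>)\<^sup>2 * (2 / \<kappa>)) ^ d *
       ((10 * (1 + 1 / \<kappa>) * ((5 / \<kappa>) ^ d)\<^sup>2) ^ d * unit_ball_vol (real d) * (3 ^ d * (q ^ d + 2)))"
  have eq: "hardy_const d \<kappa> q x = ?A + B * x ^ d" for x by (simp add: hardy_const_def B_def mult_ac)
  have "0 \<le> B" "0 \<le> ?A" using assms by (auto simp: B_def)
  moreover have "L ^ d \<le> (m * l) ^ d" using assms by (intro power_mono) auto
  moreover have "1 \<le> (m * l) ^ d" using assms by (intro one_le_power)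
  ultimately have "?A * 1 + B * L ^ d \<le> ?A * (m * l) ^ d + B * (m * l) ^ d"
    by (intro add_mono mult_left_mono) auto
  then show ?thesis by (simp only: eq) (simp add: algebra_simps)
qed

text \<open>
  A supremum need not be attained; the factor 4 instead of 2 leaves the room to choose a ball.
\<close>

lemma exists_inscribed_ball:
  fixes K :: "(real^'n) set"
  assumes K: "0 < \<sigma>" "diameter K \<le> \<sigma> * inball_diameter K"
    and s: "0 < s" "4 * \<sigma> * s \<le> diameter K"
  obtains c where "cball c s \<subseteq> K"
proof -
  have "4 * s * \<sigma> \<le> inball_diameter K * \<sigma>" using K(2) s(2) by (simp add: mult_ac)
  then have "4 * s \<le> inball_diameter K" using K(1) by (rule mult_right_le_imp_le)
  then have less: "2 * s < inball_diameter K" using s by linarith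
  define D where "D = {diameter (cball x s) | x s. cball x s \<subseteq> K}"
  \<comment> \<open>the empty ball\<close>
  have "cball 0 (-1) \<subseteq> K" by simp
  then have "D \<noteq> {}" unfolding D_def by blast
  moreover have "2 * s < Sup D" using less by (simp only: inball_diameter_def D_def)
  ultimately have "\<exists>y\<in>D. 2 * s < y" by (rule less_cSupD)
  then obtain x t where t: "cball x t \<subseteq> K" "2 * s < diameter (cball x t)" unfolding D_def by blast
  then have "0 \<le> t" using s by (cases "0 \<le> t") auto
  then have "s \<le> t" using t(2) by simp
  then have "cball x s \<subseteq> K" using t(1) by auto
  then show thesis by (rule that)
qed

lemma powr_sum_root:
  fixes x :: "'a \<Rightarrow> real"
  assumes "\<And>i. i \<in> I \<Longrightarrow> 0 \<le> x i" "0 < d"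
  shows "((\<Sum>i\<in>I. x i powr real d) powr (1 / real d)) ^ d = (\<Sum>i\<in>I. x i ^ d)"
proof -
  have eq: "(\<Sum>i\<in>I. x i powr real d) = (\<Sum>i\<in>I. x i ^ d)"
    using assms by (intro sum.cong) (auto simp: powr_realpow')
  have "0 \<le> (\<Sum>i\<in>I. x i ^ d)" using assms by (intro sum_nonneg) auto
  then have "((\<Sum>i\<in>I. x i ^ d) powr (1 / real d)) powr real d = (\<Sum>i\<in>I. x i ^ d)"
    using assms(2) unfolding powr_powr by simp
  moreover have "((\<Sum>i\<in>I. x i ^ d) powr (1 / real d)) powr real d = ((\<Sum>i\<in>I. x i ^ d) powr (1 / real d)) ^ d"
    using assms(2) by (intro powr_realpow') auto
  ultimately show ?thesis unfolding eq by simp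
qed

theorem theorem2p1:
  fixes \<sigma>\<^sub>1 \<sigma>\<^sub>2 :: real and r :: nat
  assumes "\<sigma>\<^sub>1 > 0" and "\<sigma>\<^sub>2 > 0"
  shows "\<exists>C>0. \<exists>h\<^sub>0>0. \<forall>(T :: (real^'n) set set) f g.
    ball_triangulation T \<and> mesh_size T < h\<^sub>0 \<and>
    shape_regular \<sigma>\<^sub>1 T \<and> inverse_assumption \<sigma>\<^sub>2 T \<and>
    in_Lp (real CARD('n)) (\<Union>T) f \<and> piecewise_poly r T f g \<and> zero_at_origin T g \<longrightarrow>
      in_Lp (real CARD('n)) (\<Union>T) (\<lambda>x. f x / norm x) \<and>
      Lp_norm (real CARD('n)) (\<Union>T) (\<lambda>x. f x / norm x)
        \<le> C * ln (1 / mesh_size T) * (broken_grad_norm T g + jump_norm T g)"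
proof -
  let ?d = "CARD('n)"
  obtain Q where Q: "1 \<le> Q" "\<And>(p :: real^'n \<Rightarrow> real) K c s x y. \<lbrakk>p \<in> poly_space r; convex K; compact K; 0 < s; cball c s \<subseteq> K; x \<in> K; y \<in> K\<rbrakk>
       \<Longrightarrow> \<bar>p x - p y\<bar> \<le> Q / s * Lp_norm (real CARD('n)) K (grad p) * dist x y"
    by (rule poly_lipschitz_bound [of r]) blast
  \<comment> \<open>shape regularity and the inverse assumption give every element a ball of radius \<open>\<kappa> * h\<close>\<close>
  define \<kappa> where "\<kappa> = min (1 / (4 * \<sigma>\<^sub>1 * \<sigma>\<^sub>2)) (1 / 2)"
  have \<kappa>: "0 < \<kappa>" "\<kappa> \<le> 1 / 2" using assms by (auto simp: \<kappa>_def)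
  \<comment> \<open>for \<open>h \<le> 1 / 2\<close>, both 1 and \<open>ln (1 / (\<kappa> * h))\<close> are at most \<open>m * ln (1 / h)\<close>\<close>
  define m where "m = 1 + ln (1 / \<kappa>) / ln 2 + 1 / ln 2"
  have m: "1 \<le> m" using \<kappa> by (simp add: m_def)
  define C0 where "C0 = hardy_const ?d \<kappa> (Q / \<kappa>) 1"
  define C where "C = max 1 C0 * m"
  have C: "0 < C" using m by (simp add: C_def)
  \<comment> \<open>then \<open>1 - \<kappa> * h / 2 < sqrt (1 - h\<^sup>2)\<close>, which puts balls of radius \<open>\<kappa> * h / 2\<close> in the
    elements into the covered ball\<close>
  define h0 where "h0 = \<kappa> / 4"
  have "0 < h0" using \<kappa> by (simp add: h0_def)
  show ?thesis
  proof (rule exI [of _ C], rule conjI [OF C], rule exI [of _ h0], rule conjI [OF \<open>0 < h0\<close>], intro allI impI)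
    fix T :: "(real^'n) set set" and f g
    assume A: "ball_triangulation T \<and> mesh_size T < h0 \<and> shape_regular \<sigma>\<^sub>1 T \<and> inverse_assumption \<sigma>\<^sub>2 T \<and>
      in_Lp (real ?d) (\<Union>T) f \<and> piecewise_poly r T f g \<and> zero_at_origin T g"
    define h where "h = mesh_size T"
    interpret simplicial_mesh T
      using A by unfold_locales (auto simp: ball_triangulation_def)
    obtain K0 where K0: "K0 \<in> T" "0 extreme_point_of K0" using A by (auto simp: ball_triangulation_def)
    then have T: "T \<noteq> {}" by auto
    have diam: "diameter K \<le> h" if "K \<in> T" for K
      unfolding h_def mesh_size_def using finite_mesh that by (intro Max_ge) auto
    have dpos: "0 < diameter K" if K: "K \<in> T" for K
    proof -
      obtain x where x: "x \<in> K" using element(6) [OF K] by blast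
      have "\<not> K \<subseteq> {x}" using aff_dim_subset [of K "{x}"] element(4) [OF K] by auto
      then obtain y where xy: "x \<in> K" "y \<in> K" "x \<noteq> y" using x by blast
      then have "dist x y \<le> diameter K"
        using diameter_bounded_bound [OF compact_imp_bounded [OF element(2) [OF K]]] by blast
      then show ?thesis using xy(3) by (meson dist_pos_lt less_le_trans)
    qed
    have h: "0 < h" using dpos [OF K0(1)] diam [OF K0(1)] by linarith
    have hk: "h < \<kappa> / 4" using A by (simp add: h_def h0_def)
    then have h18: "h < 1 / 8" using \<kappa> by simp
    have "\<exists>c. cball c (\<kappa> * h) \<subseteq> K" if K: "K \<in> T" for K
    proof -
      have "h \<le> \<sigma>\<^sub>2 * diameter K" using A K by (auto simp: inverse_assumption_def h_def)
      moreover have "\<kappa> * (4 * \<sigma>\<^sub>1 * \<sigma>\<^sub>2) \<le> 1"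
        using assms mult_right_mono [of \<kappa> "1 / (4 * \<sigma>\<^sub>1 * \<sigma>\<^sub>2)" "4 * \<sigma>\<^sub>1 * \<sigma>\<^sub>2"] by (simp add: \<kappa>_def)
      then have "\<kappa> * (4 * \<sigma>\<^sub>1 * \<sigma>\<^sub>2) * diameter K \<le> diameter K"
        using mult_right_mono [of _ 1 "diameter K"] dpos [OF K] by fastforce
      moreover have "\<kappa> * (4 * \<sigma>\<^sub>1) * h \<le> \<kappa> * (4 * \<sigma>\<^sub>1) * (\<sigma>\<^sub>2 * diameter K)"
        using calculation(1) \<kappa> assms by (intro mult_left_mono) auto
      ultimately have small: "4 * \<sigma>\<^sub>1 * (\<kappa> * h) \<le> diameter K" by (simp add: mult_ac)
      have "diameter K \<le> \<sigma>\<^sub>1 * inball_diameter K" using A K by (auto simp: shape_regular_def)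
      then obtain c where "cball c (\<kappa> * h) \<subseteq> K"
        using small \<kappa> h by (elim exists_inscribed_ball [OF assms(1)]) auto
      then show ?thesis by blast
    qed
    then obtain c where c: "\<And>K. K \<in> T \<Longrightarrow> cball (c K) (\<kappa> * h) \<subseteq> K" by metis
    \<comment> \<open>the radius of the covered ball\<close>
    define \<rho> where "\<rho> = sqrt (1 - h\<^sup>2)"
    have "0 \<in> K0" using K0(2) by (simp add: extreme_point_of_def)
    have ball: "ball 0 \<rho> \<subseteq> \<Union>T"
      unfolding \<rho>_def
    proof (rule ball_subset_Union)
      show "norm v = 1" if "K \<in> T" "v extreme_point_of K" "v \<in> frontier (\<Union>T)" for K v
        using A that by (auto simp: ball_triangulation_def)
      show "diameter K \<le> h" if "K \<in> T" for K by (rule diam [OF that])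
      show "0 \<in> \<Union>T" using K0(1) \<open>0 \<in> K0\<close> by blast
    qed
    have \<rho>1: "\<rho> \<le> 1" by (simp add: \<rho>_def)
    have \<rho>2: "1 - \<kappa> * h / 2 < \<rho>"
    proof -
      have "h * h < \<kappa> / 4 * h" using hk h by (intro mult_strict_right_mono)
      then have "h\<^sup>2 < \<kappa> * h / 4" by (simp add: power2_eq_square)
      moreover have "h * h < 1 * 1" using h18 h by (intro mult_strict_mono) auto
      then have x: "0 \<le> 1 - h\<^sup>2" "1 - h\<^sup>2 \<le> 1" by (simp_all add: power2_eq_square)
      have "(1 - h\<^sup>2)\<^sup>2 \<le> 1 - h\<^sup>2"
        unfolding power2_eq_square [of "1 - h\<^sup>2"] using x by (intro mult_left_le) auto
      then have "1 - h\<^sup>2 \<le> \<rho>" unfolding \<rho>_def by (rule real_le_rsqrt)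
      moreover have "0 < \<kappa> * h" using \<kappa> h by simp
      ultimately show ?thesis by linarith
    qed
    have \<kappa>h: "0 < \<kappa> * h" "\<kappa> * h \<le> 1 / 4"
      using \<kappa> h h18 mult_mono [of \<kappa> "1 / 2" h "1 / 2"] by auto
    have ext: "0 extreme_point_of K" if "K \<in> T" "0 \<in> K" for K
      by (rule extreme_point_all [OF K0 that])
    define L where "L = ln (1 / h)"
    define G B where "G = broken_grad_norm T g" and "B = jump_norm T g"
    define S where "S = (\<Sum>K\<in>T. Lp_norm (real CARD('n)) K (grad (g K)) ^ CARD('n))
      + (\<Sum>F\<in>interior_faces T. (SUP x\<in>F. norm (jump T g F x)) ^ CARD('n))"
    have gp: "g K \<in> poly_space r" if "K \<in> T" for K using A that by (auto simp: piecewise_poly_def)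
    have est: "(\<Sum>K\<in>T. \<integral>\<^sup>+x\<in>K. ennreal ((\<bar>g K x\<bar> / norm x) ^ ?d) \<partial>lborel)
       \<le> ennreal (hardy_const ?d \<kappa> (Q / \<kappa>) (ln (1 / (\<kappa> * h))) * S)"
      unfolding S_def
    proof (rule weighted_estimate [where c = c and \<rho> = \<rho> and r = r])
      show "ball (c K) (\<kappa> * h / 2) \<subseteq> ball 0 \<rho>" if K: "K \<in> T" for K
      proof -
        have "K \<subseteq> cball 0 1" using A K by (auto simp: ball_triangulation_def)
        then have "cball (c K) (\<kappa> * h) \<subseteq> cball 0 1" using c [OF K] by blast
        then have "dist (c K) 0 + \<kappa> * h \<le> 1" using \<kappa>h cball_subset_cball_iff [of "c K" "\<kappa> * h" 0 1] by auto
        then have cn: "norm (c K) + \<kappa> * h \<le> 1" by simp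
        show ?thesis
        proof
          fix x assume "x \<in> ball (c K) (\<kappa> * h / 2)"
          then have "norm (x - c K) < \<kappa> * h / 2" by (simp add: dist_norm norm_minus_commute)
          then have "norm x < 1 - \<kappa> * h / 2" using norm_triangle_sub [of x "c K"] cn by linarith
          then show "x \<in> ball 0 \<rho>" using \<rho>2 by simp
        qed
      qed
      show "g K 0 = 0" if "K \<in> T" "0 \<in> K" for K
        using A ext [OF that] that by (auto simp: zero_at_origin_def)
    qed (use h diam ball \<rho>1 \<rho>2 \<kappa>h \<kappa> c ext T gp Q in auto)
    have d0: "0 < ?d" by simp
    have cont: "continuous_on UNIV (g K)" if "K \<in> T" for K
      using gp [OF that] by (rule poly_space_continuous)
    have G: "0 \<le> G" "G ^ ?d = (\<Sum>K\<in>T. Lp_norm (real ?d) K (grad (g K)) ^ ?d)"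
      unfolding G_def broken_grad_norm_def
      by (simp, rule powr_sum_root) (auto simp: Lp_norm_nonneg)
    have B: "0 \<le> B" "B ^ ?d = (\<Sum>F\<in>interior_faces T. (SUP x\<in>F. norm (jump T g F x)) ^ ?d)"
      unfolding B_def jump_norm_def
      by (simp, rule powr_sum_root) (auto intro!: jump_SUP_nonneg cont)
    have S: "0 \<le> S" "S \<le> (G + B) ^ ?d"
    proof -
      have SGB: "S = G ^ ?d + B ^ ?d" by (simp only: S_def G(2) B(2))
      show "0 \<le> S" unfolding SGB using G(1) B(1) by simp
      obtain k where k: "?d = Suc k" using d0 gr0_implies_Suc by blast
      have "G ^ k \<le> (G + B) ^ k" "B ^ k \<le> (G + B) ^ k" using G(1) B(1) by (auto intro: power_mono)
      then have "G * G ^ k + B * B ^ k \<le> G * (G + B) ^ k + B * (G + B) ^ k"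
        using G(1) B(1) by (intro add_mono mult_left_mono) auto
      then show "S \<le> (G + B) ^ ?d" unfolding SGB k by (simp add: distrib_right)
    qed
    have L: "ln 2 \<le> L" unfolding L_def using h h18 by (intro ln_mono) (auto simp: field_simps)
    have ln2: "0 < ln (2::real)" by simp
    have L0: "0 < L" using L ln2 by linarith
    have mL: "ln (1 / (\<kappa> * h)) \<le> m * L" "1 \<le> m * L"
    proof -
      have "1 \<le> L / ln 2" using L ln2 by (simp add: field_simps)
      have k0: "0 \<le> ln (1 / \<kappa>)" using \<kappa> by (intro ln_ge_zero) (simp add: field_simps)
      have "ln (1 / (\<kappa> * h)) = ln (1 / \<kappa>) * 1 + L"
        using \<kappa> h by (simp add: L_def ln_div ln_mult)
      also have "\<dots> \<le> ln (1 / \<kappa>) * (L / ln 2) + L"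
        using k0 \<open>1 \<le> L / ln 2\<close> by (intro add_right_mono mult_left_mono)
      also have "\<dots> \<le> m * L" using L0 ln2 by (simp add: m_def algebra_simps)
      finally show "ln (1 / (\<kappa> * h)) \<le> m * L" .
      have "0 \<le> ln (1 / \<kappa>) / ln 2 * L + L" using k0 L0 ln2 by simp
      moreover have "m * L = L / ln 2 + (ln (1 / \<kappa>) / ln 2 * L + L)" by (simp add: m_def algebra_simps)
      ultimately show "1 \<le> m * L" using \<open>1 \<le> L / ln 2\<close> by linarith
    qed
    have q0: "0 \<le> Q / \<kappa>" using Q \<kappa> by simp
    have fin: "hardy_const ?d \<kappa> (Q / \<kappa>) (ln (1 / (\<kappa> * h))) * S \<le> (C * L * (G + B)) ^ ?d"
    proof -
      have "0 \<le> ln (1 / (\<kappa> * h))" using \<kappa>h by (intro ln_ge_zero) (simp add: field_simps)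
      then have "hardy_const ?d \<kappa> (Q / \<kappa>) (ln (1 / (\<kappa> * h))) \<le> C0 * (m * L) ^ ?d"
        unfolding C0_def using q0 \<kappa> mL by (intro hardy_const_le) auto
      also have "C0 \<le> (max 1 C0) ^ ?d"
        using power_increasing [of 1 ?d "max 1 C0"] by simp
      then have "C0 * (m * L) ^ ?d \<le> (max 1 C0) ^ ?d * (m * L) ^ ?d"
        using mL by (intro mult_right_mono) auto
      also have "\<dots> = (C * L) ^ ?d" by (simp add: C_def power_mult_distrib mult_ac)
      finally have "hardy_const ?d \<kappa> (Q / \<kappa>) (ln (1 / (\<kappa> * h))) \<le> (C * L) ^ ?d" .
      then have "hardy_const ?d \<kappa> (Q / \<kappa>) (ln (1 / (\<kappa> * h))) * S \<le> (C * L) ^ ?d * (G + B) ^ ?d"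
        using S C L0 by (intro mult_mono) auto
      then show ?thesis by (simp add: power_mult_distrib)
    qed
    have UTc: "closed (\<Union>T)" using finite_mesh element(3) by (intro closed_Union) auto
    then have UT: "\<Union>T \<in> sets lebesgue" by (simp add: borel_closed)
    have fm: "f \<in> borel_measurable (lebesgue_on (\<Union>T))" using A by (simp add: in_Lp_def)
    have "(\<lambda>x :: real^'n. norm x) \<in> borel_measurable (lebesgue_on (\<Union>T))"
      by (intro measurable_restrict_space1 measurable_completion) simp
    then have fnm: "(\<lambda>x. f x / norm x) \<in> borel_measurable (lebesgue_on (\<Union>T))"
      using fm by (intro borel_measurable_divide)
    have X: "(\<integral>\<^sup>+x\<in>\<Union>T. ennreal (norm (f x / norm x) ^ ?d) \<partial>lebesgue) \<le> ennreal ((C * L * (G + B)) ^ ?d)"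
    proof -
      have KL: "K \<in> sets lebesgue" if "K \<in> T" for K using element(3) [OF that] by (simp add: borel_closed)
      have ae: "AE x in lebesgue. x \<in> K \<longrightarrow> f x = g K x" if "K \<in> T" for K
      proof -
        have "AE x in lebesgue_on K. f x = g K x" using A that by (auto simp: piecewise_poly_def)
        then show ?thesis using KL [OF that] by (subst (asm) AE_restrict_space_iff) auto
      qed
      have gm: "(\<lambda>x. ennreal ((\<bar>g K x\<bar> / norm x) ^ ?d) * indicator K x) \<in> borel_measurable borel" if "K \<in> T" for K
      proof -
        have [measurable]: "g K \<in> borel_measurable borel" using cont [OF that] by (rule borel_measurable_continuous_onI)
        have [measurable]: "K \<in> sets borel" using element(3) [OF that] by simp
        show ?thesis by measurable
      qed
      have "(\<integral>\<^sup>+x\<in>\<Union>T. ennreal (norm (f x / norm x) ^ ?d) \<partial>lebesgue)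
        \<le> (\<integral>\<^sup>+x. (\<Sum>K\<in>T. ennreal ((\<bar>g K x\<bar> / norm x) ^ ?d) * indicator K x) \<partial>lebesgue)"
      proof (rule nn_integral_mono_AE)
        have "AE x in lebesgue. \<forall>K\<in>T. x \<in> K \<longrightarrow> f x = g K x"
          using ae finite_mesh by (intro AE_finite_allI) auto
        then show "AE x in lebesgue. ennreal (norm (f x / norm x) ^ ?d) * indicator (\<Union>T) x
           \<le> (\<Sum>K\<in>T. ennreal ((\<bar>g K x\<bar> / norm x) ^ ?d) * indicator K x)"
        proof (rule AE_mp, intro AE_I2 impI)
          fix x assume x: "\<forall>K\<in>T. x \<in> K \<longrightarrow> f x = g K x"
          let ?s = "\<lambda>K. ennreal ((\<bar>g K x\<bar> / norm x) ^ ?d) * indicator K x"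
          show "ennreal (norm (f x / norm x) ^ ?d) * indicator (\<Union>T) x \<le> (\<Sum>K\<in>T. ?s K)"
          proof (cases "x \<in> \<Union>T")
            case True
            then obtain K where K: "K \<in> T" "x \<in> K" by blast
            then have "ennreal (norm (f x / norm x) ^ ?d) * indicator (\<Union>T) x = ?s K"
              using x True by simp
            also have "\<dots> \<le> (\<Sum>K\<in>T. ?s K)" using K(1) finite_mesh by (intro member_le_sum) auto
            finally show ?thesis .
          qed simp
        qed
      qed
      also have "\<dots> = (\<Sum>K\<in>T. \<integral>\<^sup>+x\<in>K. ennreal ((\<bar>g K x\<bar> / norm x) ^ ?d) \<partial>lebesgue)"
        using gm by (intro nn_integral_sum measurable_completion) simp
      also have "\<dots> = (\<Sum>K\<in>T. \<integral>\<^sup>+x\<in>K. ennreal ((\<bar>g K x\<bar> / norm x) ^ ?d) \<partial>lborel)"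
        by (simp add: nn_integral_completion)
      also have "\<dots> \<le> ennreal (hardy_const ?d \<kappa> (Q / \<kappa>) (ln (1 / (\<kappa> * h))) * S)" by (rule est)
      also have "\<dots> \<le> ennreal ((C * L * (G + B)) ^ ?d)" by (rule ennreal_leI [OF fin])
      finally show ?thesis .
    qed
    have "in_Lp (real ?d) (\<Union>T) (\<lambda>x. f x / norm x)"
      unfolding in_Lp_def
    proof (intro conjI fnm integrableI_nonneg)
      have "(\<integral>\<^sup>+x. ennreal (\<bar>f x / norm x\<bar> powr real ?d) \<partial>lebesgue_on (\<Union>T))
         = (\<integral>\<^sup>+x\<in>\<Union>T. ennreal (norm (f x / norm x) ^ ?d) \<partial>lebesgue)"
        using UT by (subst nn_integral_restrict_space) (auto simp: powr_realpow')
      also have "\<dots> < \<infinity>" using X by (rule le_less_trans) simp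
      finally show "(\<integral>\<^sup>+x. ennreal (\<bar>f x / norm x\<bar> powr real ?d) \<partial>lebesgue_on (\<Union>T)) < \<infinity>" .
      show "(\<lambda>x. \<bar>f x / norm x\<bar> powr real ?d) \<in> borel_measurable (lebesgue_on (\<Union>T))"
        using fnm by measurable
    qed auto
    moreover have "Lp_norm (real ?d) (\<Union>T) (\<lambda>x. f x / norm x) \<le> C * L * (G + B)"
    proof -
      have "Lp_norm (real ?d) (\<Union>T) (\<lambda>x. f x / norm x) ^ ?d
         = enn2real (\<integral>\<^sup>+x\<in>\<Union>T. ennreal (norm (f x / norm x) ^ ?d) \<partial>lebesgue)"
      proof (rule Lp_norm_power [OF _ UT])
        show "(\<lambda>x. norm (f x / norm x)) \<in> borel_measurable (lebesgue_on (\<Union>T))"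
          using fnm by measurable
      qed simp
      also have "\<dots> \<le> (C * L * (G + B)) ^ ?d"
        using C L0 G(1) B(1) by (intro enn2real_leI X) auto
      finally show ?thesis
        by (rule power_mono_iff [THEN iffD1, rotated -1]) (use C L0 G(1) B(1) in \<open>auto simp: Lp_norm_nonneg\<close>)
    qed
    ultimately show "in_Lp (real ?d) (\<Union>T) (\<lambda>x. f x / norm x) \<and>
      Lp_norm (real ?d) (\<Union>T) (\<lambda>x. f x / norm x) \<le> C * ln (1 / mesh_size T) * (broken_grad_norm T g + jump_norm T g)"
      unfolding L_def G_def B_def h_def by (rule conjI)
  qed
qed

end
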